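(* For each $k\in\mathbb{N}$, the vanishing locus $\Omega(\alpha_k)=\{\omega\in\Omega : \alpha_k(\omega)=0\}$ is a smooth analytic subspace of $\Omega$.
   Context: Let $\mathbb{F}=\mathbb{F}_q$, $A=\mathbb{F}[T]$, $K_\infty=\mathbb{F}((T^{-1}))$ with absolute value normalized by $|T|=q$, and $C_\infty$ the completion of an algebraic closure of $K_\infty$. Fix $r\ge 2$. The Drinfeld symmetric space is $\Omega=\Omega^r=\{(\omega_1:\dots:\omega_r)\in\mathbb{P}^{r-1}(C_\infty) : \omega_1,\dots,\omega_r \text{ linearly independent over } K_\infty\}$, a rigid analytic space; homogeneous coordinates are normalized so that $\omega_r=1$. For $\omega\in\Omega$ let $\Lambda_\omega=\sum_{i=1}^r A\omega_i$. For a discrete $\mathbb{F}$-subspace $\Lambda\subset C_\infty$ the exponential function is $e_\Lambda(X)=X\prod_{0\neq\lambda\in\Lambda}(1-X/\lambda)=\sum_{i\ge 0}\alpha_i(\Lambda)X^{q^i}$. The para-Eisenstein series $\alpha_k$ is the holomorphic function $\omega\mapsto\alpha_k(\Lambda_\omega)$ on $\Omega$ (a modular form of weight $q^k-1$ for $\mathrm{GL}(r,A)$). *)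

theory Defs
  imports "HOL-Analysis.Analysis"
    "HOL-Computational_Algebra.Formal_Laurent_Series"
begin

subsection \<open>The fields \<open>K\<^sub>\<infinity>\<close> and \<open>C\<^sub>\<infinity>\<close>\<close>

text \<open>Fields complete with respect to a non-archimedean absolute value.\<close>

class complete_valued_field = field + complete_space +
  fixes absval :: "'a \<Rightarrow> real"
  assumes dist_absval: "dist x y = absval (x - y)"
    and absval_mult: "absval (x * y) = absval x * absval y"
    and absval_ultrametric: "absval (x + y) \<le> max (absval x) (absval y)"

text \<open>
  \<open>K\<^sub>\<infinity> = \<F>((T\<^sup>-\<^sup>1))\<close> is the type \<^typ>\<open>'f fls\<close> of Laurent series in the uniformizer \<open>T\<^sup>-\<^sup>1\<close>, so that
  \<open>T\<close> is \<^term>\<open>fls_X_inv\<close>; \<open>A = \<F>[T]\<close> is the type \<^typ>\<open>'f poly\<close>.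
\<close>

definition absval_K :: "'f::{field,finite} fls \<Rightarrow> real" where
  "absval_K x = (if x = 0 then 0 else real CARD('f) powi (- fls_subdegree x))"

definition A_to_K :: "'f::{field,finite} poly \<Rightarrow> 'f fls" where
  "A_to_K a = poly (map_poly fls_const a) fls_X_inv"

definition algebraic_elements :: "('f::{field,finite} fls \<Rightarrow> 'c::field) \<Rightarrow> 'c set" where
  "algebraic_elements \<iota> = {c. \<exists>p. p \<noteq> 0 \<and> poly (map_poly \<iota> p) c = 0}"

text \<open>
  The pair of a type \<^typ>\<open>'c\<close> and an embedding \<open>\<iota>\<close> of \<open>K\<^sub>\<infinity>\<close> is a completion of an algebraic closure of
  \<open>K\<^sub>\<infinity>\<close> (completeness is part of the class). This determines it up to isometric isomorphism over
  \<open>K\<^sub>\<infinity>\<close>.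
\<close>

locale completed_algebraic_closure =
  fixes \<iota> :: "'f::{field,finite} fls \<Rightarrow> 'c::complete_valued_field"
  assumes hom_one: "\<iota> 1 = 1"
    and hom_add: "\<iota> (x + y) = \<iota> x + \<iota> y"
    and hom_mult: "\<iota> (x * y) = \<iota> x * \<iota> y"
    and absval_hom: "absval (\<iota> x) = absval_K x"
    and algebraically_closed:
      "\<lbrakk>degree p > 0; \<And>i. coeff p i \<in> algebraic_elements \<iota>\<rbrakk>
        \<Longrightarrow> \<exists>x \<in> algebraic_elements \<iota>. poly p x = 0"
    and dense: "closure (algebraic_elements \<iota>) = UNIV"

subsection \<open>The Drinfeld symmetric space\<close>

text \<open>
  Since \<open>\<omega>\<^sub>r = 1\<close>, points are given by their first \<open>r - 1\<close> coordinates, which are indexed by \<^typ>\<open>'n\<close>;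
  hence \<open>r = CARD('n) + 1 \<ge> 2\<close>. The indices of homogeneous coordinates form the type
  \<^typ>\<open>'n option\<close>, with \<^term>\<open>None\<close> standing for \<open>r\<close>.
\<close>

definition hcoord :: "'c::field ^ 'n \<Rightarrow> 'n option \<Rightarrow> 'c" where
  "hcoord \<omega> j = (case j of None \<Rightarrow> 1 | Some i \<Rightarrow> \<omega> $ i)"

definition K_form ::
  "('f::{field,finite} fls \<Rightarrow> 'c::field) \<Rightarrow> ('n::finite option \<Rightarrow> 'f fls) \<Rightarrow> 'c ^ 'n \<Rightarrow> 'c" where
  "K_form \<iota> l \<omega> = (\<Sum>j\<in>UNIV. \<iota> (l j) * hcoord \<omega> j)"

definition Omega :: "('f::{field,finite} fls \<Rightarrow> 'c::complete_valued_field) \<Rightarrow> ('c ^ 'n::finite) set" where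
  "Omega \<iota> = {\<omega>. \<forall>l. K_form \<iota> l \<omega> = 0 \<longrightarrow> (\<forall>j. l j = 0)}"

text \<open>
  The standard admissible covering of \<open>\<Omega>\<close> by affinoids \<open>\<Omega>\<^sub>n\<close>: \<open>|\<ell>(\<omega>)| \<ge> q\<^sup>-\<^sup>n max\<^sub>j |\<omega>\<^sub>j|\<close> for all
  unimodular linear forms \<open>\<ell>\<close> over \<open>K\<^sub>\<infinity>\<close>.
\<close>

definition Omega_aff ::
  "('f::{field,finite} fls \<Rightarrow> 'c::complete_valued_field) \<Rightarrow> nat \<Rightarrow> ('c ^ 'n::finite) set" where
  "Omega_aff \<iota> n = {\<omega> \<in> Omega \<iota>. \<forall>l. (MAX j. absval_K (l j)) = 1 \<longrightarrow>
     absval (K_form \<iota> l \<omega>) \<ge> (MAX j. absval (hcoord \<omega> j)) / real CARD('f) ^ n}"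

definition monomial_at :: "'c::field ^ 'n \<Rightarrow> ('n::finite \<Rightarrow> nat) \<Rightarrow> 'c ^ 'n \<Rightarrow> 'c" where
  "monomial_at \<omega> m x = (\<Prod>i\<in>UNIV. (x $ i - \<omega> $ i) ^ m i)"

definition polynomial_fun :: "('c::field ^ 'n::finite \<Rightarrow> 'c) \<Rightarrow> bool" where
  "polynomial_fun p \<longleftrightarrow> (\<exists>M c. finite M \<and> p = (\<lambda>x. \<Sum>m\<in>M. c m * monomial_at 0 m x))"

text \<open>
  The affinoid algebra \<open>\<O>(\<Omega>\<^sub>n)\<close> consists of the uniform limits on \<open>\<Omega>\<^sub>n\<close> of rational functions without
  poles on \<open>\<Omega>\<^sub>n\<close>.
\<close>

definition affinoid_fun :: "('c::complete_valued_field ^ 'n::finite) set \<Rightarrow> ('c ^ 'n \<Rightarrow> 'c) \<Rightarrow> bool" where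
  "affinoid_fun U f \<longleftrightarrow> (\<forall>e>0. \<exists>p s. polynomial_fun p \<and> polynomial_fun s \<and>
     (\<forall>x\<in>U. s x \<noteq> 0 \<and> absval (f x - p x / s x) < e))"

subsection \<open>Analytic subspaces\<close>

text \<open>
  Elements of the local ring \<open>\<O>\<^bsub>\<Omega>,\<omega>\<^esub>\<close> (convergent power series at \<open>\<omega>\<close>) are represented by functions
  analytic at \<open>\<omega>\<close>, two of them being identified if they agree near \<open>\<omega>\<close>.
\<close>

definition analytic_germ :: "'c::complete_valued_field ^ 'n::finite \<Rightarrow> ('c ^ 'n \<Rightarrow> 'c) \<Rightarrow> bool" where
  "analytic_germ \<omega> f \<longleftrightarrow> (\<exists>c. \<exists>\<rho>>0. \<forall>x. (\<forall>i. absval (x $ i - \<omega> $ i) < \<rho>) \<longrightarrow>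
     ((\<lambda>m. c m * monomial_at \<omega> m x) has_sum f x) UNIV)"

text \<open>The ideal of \<open>\<O>\<^bsub>\<Omega>,\<omega>\<^esub>\<close> generated by a set of (functions representing) germs.\<close>

definition germ_ideal ::
  "'c::complete_valued_field ^ 'n::finite \<Rightarrow> ('c ^ 'n \<Rightarrow> 'c) set \<Rightarrow> ('c ^ 'n \<Rightarrow> 'c) set" where
  "germ_ideal \<omega> G = {h. analytic_germ \<omega> h \<and>
     (\<exists>S u. finite S \<and> S \<subseteq> G \<and> (\<forall>g\<in>S. analytic_germ \<omega> (u g)) \<and>
        (\<forall>\<^sub>F x in nhds \<omega>. h x = (\<Sum>g\<in>S. u g x * g x)))}"

text \<open>
  A closed analytic subspace of \<open>\<Omega>\<close> is given by a coherent ideal sheaf, which is encoded by its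
  stalks; coherence means that on each \<open>\<Omega>\<^sub>n\<close> it is generated by finitely many elements of
  \<open>\<O>(\<Omega>\<^sub>n)\<close> (Kiehl).
\<close>

record ('c, 'n) subspace =
  points :: "('c ^ 'n) set"
  stalk_ideal :: "'c ^ 'n \<Rightarrow> ('c ^ 'n \<Rightarrow> 'c) set"

definition analytic_subspace ::
  "('f::{field,finite} fls \<Rightarrow> 'c::complete_valued_field) \<Rightarrow> ('c, 'n::finite) subspace \<Rightarrow> bool" where
  "analytic_subspace \<iota> Z \<longleftrightarrow>
     points Z = {\<omega> \<in> Omega \<iota>. \<forall>h \<in> stalk_ideal Z \<omega>. h \<omega> = 0} \<and>
     (\<forall>n. \<exists>G. finite G \<and> (\<forall>g\<in>G. affinoid_fun (Omega_aff \<iota> n) g) \<and>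
        (\<forall>\<omega> \<in> Omega_aff \<iota> n. (\<forall>g\<in>G. analytic_germ \<omega> g) \<and> stalk_ideal Z \<omega> = germ_ideal \<omega> G))"

definition partial_deriv ::
  "'n::finite \<Rightarrow> ('c::complete_valued_field ^ 'n \<Rightarrow> 'c) \<Rightarrow> 'c ^ 'n \<Rightarrow> 'c" where
  "partial_deriv i g \<omega> = Lim (at 0) (\<lambda>t. (g (\<omega> + axis i t) - g \<omega>) / t)"

text \<open>
  Smoothness in the sense of Bosch, Luetkebohmert and Raynaud: near the point, the ideal of the
  subspace is generated by finitely many functions whose differentials at the point are linearly
  independent.
\<close>

definition smooth_at ::
  "('c::complete_valued_field, 'n::finite) subspace \<Rightarrow> 'c ^ 'n \<Rightarrow> bool" where
  "smooth_at Z \<omega> \<longleftrightarrow> (\<exists>m::nat. \<exists>g. (\<forall>j<m. analytic_germ \<omega> (g j)) \<and>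
     stalk_ideal Z \<omega> = germ_ideal \<omega> (g ` {..<m}) \<and>
     (\<forall>b. (\<forall>i. (\<Sum>j<m. b j * partial_deriv i (g j) \<omega>) = 0) \<longrightarrow> (\<forall>j<m. b j = 0)))"

definition smooth_analytic_subspace ::
  "('f::{field,finite} fls \<Rightarrow> 'c::complete_valued_field) \<Rightarrow> ('c, 'n::finite) subspace \<Rightarrow> bool" where
  "smooth_analytic_subspace \<iota> Z \<longleftrightarrow> analytic_subspace \<iota> Z \<and> (\<forall>\<omega> \<in> points Z. smooth_at Z \<omega>)"

text \<open>
  The vanishing locus of a holomorphic function carries the structure defined by the ideal sheaf \<open>(f)\<close>, not a priori the
  reduced one.
\<close>

definition vanishing_locus ::
  "('f::{field,finite} fls \<Rightarrow> 'c::complete_valued_field) \<Rightarrow> ('c ^ 'n::finite \<Rightarrow> 'c) \<Rightarrow> ('c, 'n) subspace" where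
  "vanishing_locus \<iota> f =
     \<lparr>points = {\<omega> \<in> Omega \<iota>. f \<omega> = 0}, stalk_ideal = (\<lambda>\<omega>. germ_ideal \<omega> {f})\<rparr>"

subsection \<open>Para-Eisenstein series\<close>

definition period_lattice ::
  "('f::{field,finite} fls \<Rightarrow> 'c::complete_valued_field) \<Rightarrow> 'c ^ 'n::finite \<Rightarrow> 'c set" where
  "period_lattice \<iota> \<omega> = range (\<lambda>a :: 'n option \<Rightarrow> 'f poly. K_form \<iota> (\<lambda>j. A_to_K (a j)) \<omega>)"

text \<open>The infinite product is the limit of its finite partial products.\<close>

definition exp_lattice :: "'c::complete_valued_field set \<Rightarrow> 'c \<Rightarrow> 'c" where
  "exp_lattice \<Lambda> z =
     z * Lim (finite_subsets_at_top (\<Lambda> - {0})) (\<lambda>S. \<Prod>l\<in>S. (1 - z / l))"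

text \<open>The coefficients of \<open>e\<^sub>\<Lambda>(X) = \<Sum>\<^sub>i \<alpha>\<^sub>i(\<Lambda>) X^(q^i)\<close>, as an identity of entire functions.\<close>

definition exp_coeff :: "nat \<Rightarrow> 'c::complete_valued_field set \<Rightarrow> nat \<Rightarrow> 'c" where
  "exp_coeff q \<Lambda> = (THE a. \<forall>z. (\<lambda>i. a i * z ^ (q ^ i)) sums exp_lattice \<Lambda> z)"

definition para_Eisenstein ::
  "('f::{field,finite} fls \<Rightarrow> 'c::complete_valued_field) \<Rightarrow> nat \<Rightarrow> 'c ^ 'n::finite \<Rightarrow> 'c" where
  "para_Eisenstein \<iota> k \<omega> = exp_coeff CARD('f) (period_lattice \<iota> \<omega>) k"

end

theory Submission
  imports Defs
begin

text \<open>
  Write \<open>e(X) = \<Sum>\<^sub>k \<alpha>\<^sub>k X^(q^k)\<close> and \<open>e(T X) = T \<Sum>\<^sub>j \<phi>\<^sub>j e(X)^(q^j)\<close>, where \<open>\<phi>\<^sub>0 = 1\<close> and \<open>\<phi>\<^sub>j = 0\<close> for \<open>j > r\<close>. This means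
  \<open>(T^(q^m - 1) - 1) \<alpha>\<^sub>m = \<Sum>\<^sub>j \<phi>\<^sub>j \<alpha>\<^sub>m\<^sub>-\<^sub>j^(q^j)\<close>, summed over \<open>1 \<le> j \<le> min m r\<close>. As \<open>q^j\<close>-th powers have derivative zero,
  the partial derivatives of \<open>\<alpha>\<^sub>m\<close> satisfy the same relation with \<open>\<phi>\<^sub>j\<close> replaced by its derivative. The
  \<open>r \<times> r\<close> matrix formed by the \<open>\<phi>\<^sub>j\<close> and their \<open>r - 1\<close> partial derivatives is invertible: a linear relation
  between its rows carries over to the power series \<open>e(X) - X\<close> and \<open>\<partial>\<^sub>i e(X)\<close>, whose values at a period
  \<open>\<lambda> = \<Sum> a\<^sub>i \<omega>\<^sub>i\<close> are \<open>- \<lambda>\<close> and, by differentiating \<open>e(\<lambda>) = 0\<close>, \<open>- a\<^sub>i\<close>. Hence, if \<open>\<alpha>\<^sub>k\<close> and all its derivatives vanish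
  at \<open>\<omega>\<close>, then so do \<open>\<alpha>\<^sub>k\<^sub>-\<^sub>1, \<dots>, \<alpha>\<^sub>k\<^sub>-\<^sub>r\<close>. This contradicts \<open>\<alpha>\<^sub>0 = 1\<close> if \<open>k \<le> r\<close>; otherwise all later coefficients
  vanish too, and \<open>e\<close> is a polynomial with infinitely many zeros.
\<close>

subsection \<open>Ultrametric fields\<close>

text \<open>The functional equation comes from finite levels. The periods with coefficients of
  degree below \<open>N\<close> form a finite space over the field of constants, whose exponential
  is a polynomial, and the space for \<open>N + 1\<close> is \<open>T\<close> times the space for
  \<open>N\<close> enlarged by the \<open>r\<close> vectors \<open>\<omega>_j / T\<close>.
  Composition of exponentials gives the relation at level \<open>N\<close>, and \<open>N\<close>
  tends to infinity coefficientwise. The \<open>\<phi>_j\<close> are defined by solving the relation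
  for them in terms of the \<alpha>'s: this makes them differentiable and compatible with limits,
  and leaves only their vanishing beyond \<open>r\<close> to prove. Differentiating series term by
  term needs more than pointwise convergence. The coefficients of \<open>e\<close> are therefore
  written as sums over finite sets of vectors of polynomials, an index set independent of
  \<open>\<omega>\<close>, and the lower bound for linear forms holds with one constant on a whole
  polydisc. All terms are then power series on a common polydisc with explicit bounds tending to
  zero. In the matrix argument the periods \<open>1\<close> and \<open>\<omega>_i\<close> are enough
  to force a relation between the rows to be trivial.\<close>

lemma absval_nonneg [simp]: "0 \<le> absval (x :: 'c::complete_valued_field)"
  by (metis dist_absval diff_zero zero_le_dist)

lemma absval_eq_0_iff [simp]: "absval x = 0 \<longleftrightarrow> x = (0 :: 'c::complete_valued_field)"
  by (metis dist_absval diff_zero dist_eq_0_iff)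

lemma absval_0 [simp]: "absval (0 :: 'c::complete_valued_field) = 0"
  by simp

lemma absval_pos_iff [simp]: "0 < absval x \<longleftrightarrow> x \<noteq> (0 :: 'c::complete_valued_field)"
  by (metis absval_eq_0_iff absval_nonneg order_less_le)

lemma absval_1 [simp]: "absval (1 :: 'c::complete_valued_field) = 1"
  by (metis absval_eq_0_iff absval_mult mult_cancel_right1 mult_1 zero_neq_one)

lemma absval_minus [simp]: "absval (- x) = absval (x :: 'c::complete_valued_field)"
  by (metis dist_absval dist_commute diff_zero diff_0)

lemma absval_minus_commute: "absval (x - y) = absval (y - x :: 'c::complete_valued_field)"
  by (metis dist_absval dist_commute)

lemma absval_power: "absval (x ^ n) = absval (x :: 'c::complete_valued_field) ^ n"
  by (induction n) (auto simp: absval_mult)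

lemma absval_inverse: "absval (inverse x) = inverse (absval (x :: 'c::complete_valued_field))"
proof (cases "x = 0")
  case False
  then have "absval x * absval (inverse x) = 1"
    by (simp flip: absval_mult)
  then show ?thesis
    by (metis inverse_unique)
qed auto

lemma absval_divide: "absval (x / y) = absval x / absval (y :: 'c::complete_valued_field)"
  by (simp add: divide_inverse absval_mult absval_inverse)

lemma absval_prod: "absval (prod f A) = (\<Prod>i\<in>A. absval (f i :: 'c::complete_valued_field))"
  by (induction A rule: infinite_finite_induct) (auto simp: absval_mult)

lemma absval_add_le:
  fixes x y :: "'c::complete_valued_field"
  assumes "absval x \<le> b" "absval y \<le> b"
  shows "absval (x + y) \<le> b"
  using absval_ultrametric[of x y] assms by simp

lemma absval_diff_le:
  fixes x y :: "'c::complete_valued_field"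
  assumes "absval x \<le> b" "absval y \<le> b"
  shows "absval (x - y) \<le> b"
  using absval_add_le[of x b "- y"] assms by simp

lemma absval_add_less:
  fixes x y :: "'c::complete_valued_field"
  assumes "absval x < b" "absval y < b"
  shows "absval (x + y) < b"
  using absval_ultrametric[of x y] assms by simp

text \<open>Since \<open>x\<close> is \<open>x + y\<close> minus \<open>y\<close>, its absolute
  value is at most the larger of theirs, and \<open>y\<close> is too small to be the larger
  one.\<close>

lemma absval_add_eq:
  fixes x y :: "'c::complete_valued_field"
  assumes "absval y < absval x"
  shows "absval (x + y) = absval x"
proof (rule antisym)
  show "absval (x + y) \<le> absval x"
    using assms by (intro absval_add_le) auto
  have "absval x \<le> max (absval (x + y)) (absval y)"
    using absval_ultrametric[of "x + y" "- y"] by simp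
  then show "absval x \<le> absval (x + y)"
    using assms by (simp split: if_splits add: max_def)
qed

lemma absval_sum_le:
  fixes f :: "'i \<Rightarrow> 'c::complete_valued_field"
  assumes "\<And>i. i \<in> A \<Longrightarrow> absval (f i) \<le> b" "0 \<le> b"
  shows "absval (sum f A) \<le> b"
  using assms
  by (induction A rule: infinite_finite_induct) (auto intro!: absval_add_le)

lemma tendsto_absval_iff:
  fixes f :: "'i \<Rightarrow> 'c::complete_valued_field"
  shows "(f \<longlongrightarrow> l) F \<longleftrightarrow> (\<forall>e>0. \<forall>\<^sub>F x in F. absval (f x - l) < e)"
  by (simp add: tendsto_iff dist_absval)

section \<open>Continuity of the field operations\<close>

instance complete_valued_field \<subseteq> topological_ab_group_add
proof
  fix a b :: 'a
  show "((\<lambda>x. fst x + snd x) \<longlongrightarrow> a + b) (nhds a \<times>\<^sub>F nhds b)"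
    unfolding tendsto_absval_iff
  proof safe
    fix e :: real
    assume "0 < e"
    then have "\<forall>\<^sub>F x in nhds a. absval (x - a) < e" "\<forall>\<^sub>F x in nhds b. absval (x - b) < e"
      using filterlim_ident[of "nhds a"] filterlim_ident[of "nhds b"] by (simp_all add: tendsto_absval_iff)
    then have "\<forall>\<^sub>F x in nhds a \<times>\<^sub>F nhds b. absval (fst x - a) < e \<and> absval (snd x - b) < e"
      unfolding eventually_prod_filter by auto
    then show "\<forall>\<^sub>F x in nhds a \<times>\<^sub>F nhds b. absval (fst x + snd x - (a + b)) < e"
      by (rule eventually_mono)
         (metis (no_types, opaque_lifting) absval_add_less add_diff_add)
  qed
  show "(uminus \<longlongrightarrow> - a) (nhds a)"
  proof -
    have "absval (- x - - a) = absval (x - a)" for x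
      using absval_minus_commute[of a x] by simp
    then show ?thesis
      using filterlim_ident[of "nhds a"] by (simp add: tendsto_absval_iff)
  qed
qed

instance complete_valued_field \<subseteq> topological_semigroup_mult
proof
  fix a b :: 'a
  show "((\<lambda>x. fst x * snd x) \<longlongrightarrow> a * b) (nhds a \<times>\<^sub>F nhds b)"
    unfolding tendsto_absval_iff
  proof safe
    fix e :: real
    assume e: "0 < e"
    \<comment> \<open>The difference of the products is the product of the two errors plus two cross
      terms. The part \<open>d \<le> 1\<close> controls the former, the quotient the latter; by the
      ultrametric inequality it suffices that each is below \<open>e\<close>.\<close>
    define d where "d = min 1 (e / (1 + absval a + absval b))"
    have d: "0 < d" "d \<le> 1" "d * (1 + absval a + absval b) \<le> e"
    proof -
      have p: "0 < 1 + absval a + absval b"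
        using absval_nonneg[of a] absval_nonneg[of b] by linarith
      then show "0 < d" "d \<le> 1"
        using e by (auto simp: d_def)
      have "d \<le> e / (1 + absval a + absval b)"
        by (simp add: d_def)
      then show "d * (1 + absval a + absval b) \<le> e"
        using p by (simp add: field_simps)
    qed
    have "\<forall>\<^sub>F x in nhds a. absval (x - a) < d" "\<forall>\<^sub>F x in nhds b. absval (x - b) < d"
      using filterlim_ident[of "nhds a"] filterlim_ident[of "nhds b"] d(1) by (simp_all add: tendsto_absval_iff)
    then have "\<forall>\<^sub>F x in nhds a \<times>\<^sub>F nhds b. absval (fst x - a) < d \<and> absval (snd x - b) < d"
      unfolding eventually_prod_filter by auto
    then show "\<forall>\<^sub>F x in nhds a \<times>\<^sub>F nhds b. absval (fst x * snd x - a * b) < e"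
    proof (rule eventually_mono)
      fix x :: "'a \<times> 'a"
      assume x: "absval (fst x - a) < d \<and> absval (snd x - b) < d"
      have dp: "d * (1 + absval a + absval b) = d + d * absval a + d * absval b"
        by (simp add: algebra_simps)
      have nn: "0 \<le> d * absval a" "0 \<le> d * absval b"
        using d(1) by auto
      have "absval (fst x - a) * absval (snd x - b) < d * 1"
        using x d by (intro mult_strict_mono') auto
      then have 1: "absval ((fst x - a) * (snd x - b)) < e"
        using d(3) nn unfolding dp by (simp add: absval_mult)
      have "absval (snd x - b) * absval a \<le> d * absval a" "absval (fst x - a) * absval b \<le> d * absval b"
        using x by (auto intro!: mult_right_mono)
      then have "absval (snd x - b) * absval a < e" "absval (fst x - a) * absval b < e"
        using d(1,3) nn dp by linarith+
      then have 2: "absval (a * (snd x - b)) < e" and 3: "absval (b * (fst x - a)) < e"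
        by (simp_all add: absval_mult mult.commute)
      have "fst x * snd x - a * b = (fst x - a) * (snd x - b) + (a * (snd x - b) + b * (fst x - a))"
        by (simp add: algebra_simps)
      then show "absval (fst x * snd x - a * b) < e"
        using 1 2 3 by (simp add: absval_add_less)
    qed
  qed
qed

instance complete_valued_field \<subseteq> uniform_topological_group_add
proof
  show "filterlim (\<lambda>((a::'a, b), (c, d)). (a + c, b + d)) uniformity (uniformity \<times>\<^sub>F uniformity)"
    unfolding filterlim_def le_filter_def eventually_filtermap case_prod_unfold
  proof safe
    fix P :: "'a \<times> 'a \<Rightarrow> bool"
    assume "eventually P uniformity"
    then obtain e where e: "e > 0" "\<And>x y. dist x y < e \<Longrightarrow> P (x, y)"
      by (auto simp: eventually_uniformity_metric)
    define Q where "Q = (\<lambda>(x::'a, y). dist x y < e)"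
    have Q: "eventually Q uniformity"
      unfolding eventually_uniformity_metric Q_def using e(1) by auto
    have "P (a + c, b + d)" if "Q (a, b)" "Q (c, d)" for a b c d
      using that by (intro e) (simp add: Q_def dist_absval add_diff_add absval_add_less)
    then show "\<forall>\<^sub>F x in uniformity \<times>\<^sub>F uniformity. P (fst (fst x) + fst (snd x), snd (fst x) + snd (snd x))"
      unfolding eventually_prod_filter by (intro exI[of _ Q] conjI Q) auto
  qed
  show "filterlim (\<lambda>(a::'a, b). (- a, - b)) uniformity uniformity"
    unfolding filterlim_def le_filter_def eventually_filtermap
  proof safe
    fix P :: "'a \<times> 'a \<Rightarrow> bool"
    assume "eventually P uniformity"
    then obtain e where e: "e > 0" "\<And>x y. dist x y < e \<Longrightarrow> P (x, y)"
      by (auto simp: eventually_uniformity_metric)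
    show "\<forall>\<^sub>F x in uniformity. P (case x of (a, b) \<Rightarrow> (- a, - b))"
      unfolding eventually_uniformity_metric
      by (intro exI[of _ e])
         (auto intro!: e simp: dist_absval absval_minus_commute)
  qed
qed

lemma closed_absval_le: "closed {y :: 'c::complete_valued_field. absval y \<le> r}"
proof -
  have "{y. absval y \<le> r} = cball (0 :: 'c) r"
    by (auto simp: dist_absval)
  then show ?thesis by simp
qed

lemma tendsto_absval_le:
  fixes f :: "'i \<Rightarrow> 'c::complete_valued_field"
  assumes "(f \<longlongrightarrow> l) F" "\<forall>\<^sub>F x in F. absval (f x) \<le> b" "F \<noteq> bot"
  shows "absval l \<le> b"
  using Lim_in_closed_set[OF closed_absval_le, of f b F l] assms by simp

subsection \<open>Infinite sums in ultrametric fields\<close>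

text \<open>Convergence to zero along the cofinite filter. In a complete ultrametric field this
  already gives unconditional summability, so it takes the place of absolute convergence.\<close>

definition null_family :: "'i set \<Rightarrow> ('i \<Rightarrow> real) \<Rightarrow> bool" where
  "null_family I b \<longleftrightarrow> (\<forall>e>0. finite {i\<in>I. e \<le> b i})"

lemma null_family_finite: "finite I \<Longrightarrow> null_family I b"
  by (simp add: null_family_def)

lemma null_family_mono:
  assumes "null_family I b" "\<And>i. i \<in> J \<Longrightarrow> a i \<le> b i" "J \<subseteq> I"
  shows "null_family J a"
  unfolding null_family_def
proof safe
  fix e :: real
  assume "0 < e"
  then have "finite {i\<in>I. e \<le> b i}"
    using assms(1) by (auto simp: null_family_def)
  then show "finite {i\<in>J. e \<le> a i}"
    by (rule rev_finite_subset) (use assms in force)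
qed

lemma null_family_cmult:
  assumes "null_family I b" "0 \<le> C"
  shows "null_family I (\<lambda>i. C * b i)"
proof (cases "C = 0")
  case False
  then have "0 < C"
    using assms(2) by simp
  then have "{i\<in>I. e \<le> C * b i} = {i\<in>I. e / C \<le> b i}" for e
    by (auto simp: field_simps)
  with \<open>0 < C\<close> show ?thesis
    using assms(1) by (simp add: null_family_def)
qed (simp add: null_family_def)

lemma null_family_bounded:
  assumes "null_family I b"
  obtains B where "0 < B" "\<And>i. i \<in> I \<Longrightarrow> b i \<le> B"
proof
  define F where "F = {i\<in>I. 1 \<le> b i}"
  have F: "finite F"
    using assms by (auto simp: null_family_def F_def)
  show "0 < Max (insert 1 (b ` F))"
    using F by (intro less_le_trans[OF zero_less_one Max_ge]) auto
  show "b i \<le> Max (insert 1 (b ` F))" if "i \<in> I" for i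
  proof (cases "i \<in> F")
    case True
    then show ?thesis using F by (intro Max_ge) auto
  next
    case False
    then have "b i \<le> 1" using that by (auto simp: F_def)
    also have "\<dots> \<le> Max (insert 1 (b ` F))" using F by (intro Max_ge) auto
    finally show ?thesis .
  qed
qed

text \<open>Both families are bounded, so a product can reach \<open>e\<close> only if each factor
  exceeds a fixed positive number, which leaves a finite box of index pairs.\<close>

lemma null_family_Times:
  assumes "null_family I a" "null_family J b"
    and "\<And>i. i \<in> I \<Longrightarrow> 0 \<le> a i" "\<And>j. j \<in> J \<Longrightarrow> 0 \<le> b j"
  shows "null_family (I \<times> J) (\<lambda>(i, j). a i * b j)"
  unfolding null_family_def
proof safe
  fix e :: real
  assume e: "0 < e"
  obtain A where A: "0 < A" "\<And>i. i \<in> I \<Longrightarrow> a i \<le> A"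
    using null_family_bounded[OF assms(1)] by blast
  obtain B where B: "0 < B" "\<And>j. j \<in> J \<Longrightarrow> b j \<le> B"
    using null_family_bounded[OF assms(2)] by blast
  have "finite ({i\<in>I. e / B \<le> a i} \<times> {j\<in>J. e / A \<le> b j})"
    using assms(1,2) e A B by (auto simp: null_family_def)
  moreover have "e / B \<le> a i" "e / A \<le> b j" if "i \<in> I" "j \<in> J" "e \<le> a i * b j" for i j
  proof -
    have "a i * b j \<le> a i * B" "a i * b j \<le> A * b j"
      using that A B assms by (auto intro!: mult_mono)
    then show "e / B \<le> a i" "e / A \<le> b j"
      using that A B by (auto simp: field_simps)
  qed
  ultimately show "finite {p \<in> I \<times> J. e \<le> (case p of (i, j) \<Rightarrow> a i * b j)}"
    by (elim rev_finite_subset) auto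
qed

lemma null_family_geometric:
  assumes "0 \<le> x" "x < (1::real)"
  shows "null_family UNIV (\<lambda>n. x ^ n)"
  unfolding null_family_def
proof safe
  fix e :: real
  assume "0 < e"
  then have "\<forall>\<^sub>F n in sequentially. x ^ n < e"
    using order_tendstoD(2)[OF LIMSEQ_power_zero[of x], of e] assms by simp
  then obtain N where "\<And>n. N \<le> n \<Longrightarrow> x ^ n < e"
    by (auto simp: eventually_sequentially)
  then have "{n\<in>UNIV. e \<le> x ^ n} \<subseteq> {..<N}"
    by (auto simp: not_le[symmetric])
  then show "finite {n\<in>UNIV. e \<le> x ^ n}"
    by (rule finite_subset) simp
qed

lemma finite_bounded_multiindices: "finite {m :: 'n::finite \<Rightarrow> nat. (\<Sum>i\<in>UNIV. m i) < N}"
proof -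
  have "{m :: 'n \<Rightarrow> nat. (\<Sum>i\<in>UNIV. m i) < N} \<subseteq> {m. \<forall>i. (i \<in> UNIV \<longrightarrow> m i \<in> {..N}) \<and> (i \<notin> UNIV \<longrightarrow> m i = 0)}"
  proof
    fix m :: "'n \<Rightarrow> nat"
    assume m: "m \<in> {m. (\<Sum>i\<in>UNIV. m i) < N}"
    have "m i \<le> (\<Sum>i\<in>UNIV. m i)" for i
      by (intro member_le_sum) auto
    then have "m i \<le> N" for i
      using m by (metis mem_Collect_eq order_trans less_imp_le)
    then show "m \<in> {m. \<forall>i. (i \<in> UNIV \<longrightarrow> m i \<in> {..N}) \<and> (i \<notin> UNIV \<longrightarrow> m i = 0)}"
      by simp
  qed
  then show ?thesis
    by (rule finite_subset) (intro finite_set_of_finite_funs; simp)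
qed

lemma null_family_geometric_multi:
  assumes "0 \<le> x" "x < (1::real)"
  shows "null_family UNIV (\<lambda>m :: 'n::finite \<Rightarrow> nat. x ^ (\<Sum>i\<in>UNIV. m i))"
  unfolding null_family_def
proof safe
  fix e :: real
  assume "0 < e"
  then have "\<forall>\<^sub>F n in sequentially. x ^ n < e"
    using order_tendstoD(2)[OF LIMSEQ_power_zero[of x], of e] assms by simp
  then obtain N where "\<And>n. N \<le> n \<Longrightarrow> x ^ n < e"
    by (auto simp: eventually_sequentially)
  then have "{m\<in>UNIV. e \<le> x ^ (\<Sum>i\<in>UNIV. m i)} \<subseteq> {m :: 'n \<Rightarrow> nat. (\<Sum>i\<in>UNIV. m i) < N}"
    by (auto simp: not_le[symmetric])
  then show "finite {m\<in>UNIV. e \<le> x ^ (\<Sum>i\<in>UNIV. (m :: 'n \<Rightarrow> nat) i)}"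
    by (rule finite_subset) (rule finite_bounded_multiindices)
qed

text \<open>Beyond the finite set \<open>F\<close> of indices with terms of size at least
  \<open>e / 2\<close>, any further finite sum has size at most \<open>e / 2\<close>. Hence the net
  of partial sums is Cauchy, and completeness applies.\<close>

lemma ultrametric_summable_on:
  fixes f :: "'i \<Rightarrow> 'c::complete_valued_field"
  assumes "null_family I (\<lambda>i. absval (f i))"
  shows "f summable_on I"
proof -
  have "cauchy_filter (filtermap (sum f) (finite_subsets_at_top I))"
    unfolding cauchy_filter_metric_filtermap
  proof safe
    fix e :: real
    assume e: "0 < e"
    define F where "F = {i\<in>I. e / 2 \<le> absval (f i)}"
    have F: "finite F" "F \<subseteq> I"
      using assms half_gt_zero[OF e] unfolding null_family_def F_def by blast+
    define P where "P = (\<lambda>S. F \<subseteq> S \<and> finite S \<and> S \<subseteq> I)"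
    have "absval (sum f S - sum f F) \<le> e / 2" if "P S" for S
    proof -
      have "sum f S - sum f F = sum f (S - F)"
        using that F by (simp add: P_def sum_diff)
      then show ?thesis
        unfolding \<open>sum f S - sum f F = sum f (S - F)\<close>
        using that e by (intro absval_sum_le) (auto simp: P_def F_def not_le less_imp_le)
    qed
    then have "dist (sum f S) (sum f S') < e" if "P S" "P S'" for S S'
      using absval_diff_le[of "sum f S - sum f F" "e / 2" "sum f S' - sum f F"] that e
      by (fastforce simp: dist_absval)
    moreover have "eventually P (finite_subsets_at_top I)"
      using F unfolding eventually_finite_subsets_at_top P_def by blast
    ultimately show "\<exists>P. eventually P (finite_subsets_at_top I) \<and>
        (\<forall>x y. P x \<and> P y \<longrightarrow> dist (sum f x) (sum f y) < e)"
      by blast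
  qed
  then have "convergent_filter (filtermap (sum f) (finite_subsets_at_top I))"
    by (rule cauchy_filter_convergent)
  then show ?thesis
    by (simp add: convergent_filter_iff summable_on_def has_sum_def filterlim_def)
qed

lemma ultrametric_has_sum_infsum:
  fixes f :: "'i \<Rightarrow> 'c::complete_valued_field"
  assumes "null_family I b" "\<And>i. i \<in> I \<Longrightarrow> absval (f i) \<le> b i"
  shows "(f has_sum infsum f I) I"
  using ultrametric_summable_on[OF null_family_mono[OF assms(1)], of I f] assms(2)
  by simp

lemma absval_has_sum_le:
  fixes f :: "'i \<Rightarrow> 'c::complete_valued_field"
  assumes "(f has_sum s) I" "\<And>i. i \<in> I \<Longrightarrow> absval (f i) \<le> b" "0 \<le> b"
  shows "absval s \<le> b"
proof (rule tendsto_absval_le)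
  show "(sum f \<longlongrightarrow> s) (finite_subsets_at_top I)"
    using assms(1) by (simp add: has_sum_def)
  show "\<forall>\<^sub>F S in finite_subsets_at_top I. absval (sum f S) \<le> b"
    using assms(2,3) by (intro eventually_finite_subsets_at_top_weakI absval_sum_le) auto
qed simp

text \<open>The sum over the product set exists by nullity; evaluating it by rows and by columns
  gives the common value \<open>s\<close>.\<close>

lemma ultrametric_sum_swap:
  fixes f :: "'i \<Rightarrow> 'j \<Rightarrow> 'c::complete_valued_field"
  assumes "null_family (I \<times> J) (\<lambda>(i, j). absval (f i j))"
    and "\<And>i. i \<in> I \<Longrightarrow> (f i has_sum g i) J" "\<And>j. j \<in> J \<Longrightarrow> ((\<lambda>i. f i j) has_sum h j) I"
  obtains s where "(g has_sum s) I" "(h has_sum s) J"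
proof -
  define s where "s = infsum (\<lambda>(i, j). f i j) (I \<times> J)"
  have s: "((\<lambda>(i, j). f i j) has_sum s) (I \<times> J)"
    unfolding s_def using assms(1)
    by (intro has_sum_infsum ultrametric_summable_on) (simp add: case_prod_unfold)
  then have "((\<lambda>(j, i). f i j) has_sum s) (J \<times> I)"
    by (subst (asm) has_sum_swap) (simp add: case_prod_unfold)
  then have "(h has_sum s) J"
    by (rule has_sum_Sigma') (use assms(3) in simp)
  moreover from s have "(g has_sum s) I"
    by (rule has_sum_Sigma') (use assms(2) in simp)
  ultimately show ?thesis
    using that by blast
qed

lemma ultrametric_geometric_sum:
  fixes y :: "'c::complete_valued_field"
  assumes "absval y < 1"
  shows "((\<lambda>n. y ^ n) has_sum (1 / (1 - y))) UNIV"
proof -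
  have sum: "((\<lambda>n. y ^ n) has_sum infsum (\<lambda>n. y ^ n) UNIV) UNIV"
    by (rule ultrametric_has_sum_infsum[OF null_family_geometric[of "absval y"]])
       (use assms in \<open>auto simp: absval_power\<close>)
  have "(\<lambda>n. y ^ n) \<longlonglongrightarrow> 0"
    using LIMSEQ_power_zero[of "absval y"] assms
    by (simp add: tendsto_absval_iff absval_power order_tendsto_iff)
  then have "(\<lambda>n. (1 - y ^ n) * (1 / (1 - y))) \<longlonglongrightarrow> (1 - 0) * (1 / (1 - y))"
    by (intro tendsto_intros)
  moreover have "y \<noteq> 1"
    using assms by auto
  then have "(\<Sum>k<n. y ^ k) = (1 - y ^ n) * (1 / (1 - y))" for n
    by (simp add: sum_gp_strict)
  ultimately have "(\<lambda>n. y ^ n) sums (1 / (1 - y))"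
    by (simp add: sums_def)
  then have "infsum (\<lambda>n. y ^ n) UNIV = 1 / (1 - y)"
    using has_sum_imp_sums[OF sum] by (metis sums_unique2)
  with sum show ?thesis
    by simp
qed

subsection \<open>Power series on polydiscs\<close>

definition polydisc :: "'c::complete_valued_field ^ 'n::finite \<Rightarrow> real \<Rightarrow> ('c ^ 'n) set" where
  "polydisc \<omega> \<rho> = {x. \<forall>i. absval (x $ i - \<omega> $ i) < \<rho>}"

text \<open>The number \<open>b\<close> bounds the Gauss norm of the series on the open polydisc. It
  is an explicit parameter so that infinite families of series can be controlled by
  \<open>null_family\<close> of their bounds.\<close>

definition power_series_on :: "'c::complete_valued_field ^ 'n::finite \<Rightarrow> real \<Rightarrow> real
    \<Rightarrow> (('n \<Rightarrow> nat) \<Rightarrow> 'c) \<Rightarrow> ('c ^ 'n \<Rightarrow> 'c) \<Rightarrow> bool" where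
  "power_series_on \<omega> \<rho> b c f \<longleftrightarrow> (\<forall>m. absval (c m) * \<rho> ^ sum m UNIV \<le> b) \<and>
     (\<forall>x\<in>polydisc \<omega> \<rho>. ((\<lambda>m. c m * monomial_at \<omega> m x) has_sum f x) UNIV)"

definition bounded_analytic :: "'c::complete_valued_field ^ 'n::finite \<Rightarrow> real \<Rightarrow> real
    \<Rightarrow> ('c ^ 'n \<Rightarrow> 'c) \<Rightarrow> bool" where
  "bounded_analytic \<omega> \<rho> b f \<longleftrightarrow> (\<exists>c. power_series_on \<omega> \<rho> b c f)"

lemma center_in_polydisc [simp]: "0 < \<rho> \<Longrightarrow> \<omega> \<in> polydisc \<omega> \<rho>"
  by (simp add: polydisc_def)

lemma bounded_analytic_imp_analytic_germ:
  "0 < \<rho> \<Longrightarrow> bounded_analytic \<omega> \<rho> b f \<Longrightarrow> analytic_germ \<omega> f"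
  unfolding bounded_analytic_def power_series_on_def analytic_germ_def polydisc_def by blast

lemma power_series_on_nonneg: "power_series_on \<omega> \<rho> b c f \<Longrightarrow> 0 \<le> b"
  unfolding power_series_on_def
  by (drule conjunct1, drule spec[of _ "\<lambda>_. 0"]) (simp, metis absval_nonneg order_trans)

lemma bounded_analytic_nonneg: "bounded_analytic \<omega> \<rho> b f \<Longrightarrow> 0 \<le> b"
  by (auto simp: bounded_analytic_def dest: power_series_on_nonneg)

lemma bounded_analytic_mono: "bounded_analytic \<omega> \<rho> b f \<Longrightarrow> b \<le> b' \<Longrightarrow> bounded_analytic \<omega> \<rho> b' f"
  unfolding bounded_analytic_def power_series_on_def by (meson order_trans)

lemma bounded_analytic_cong:
  "bounded_analytic \<omega> \<rho> b f \<Longrightarrow> (\<And>x. x \<in> polydisc \<omega> \<rho> \<Longrightarrow> f x = g x) \<Longrightarrow> bounded_analytic \<omega> \<rho> b g"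
  unfolding bounded_analytic_def power_series_on_def by metis

text \<open>A point of the open polydisc lies in a closed polydisc of radius
  \<open>\<theta> * \<rho>\<close> with \<open>\<theta> < 1\<close>. This gain turns bounded
  coefficients into geometrically decaying terms.\<close>

lemma absval_monomial_le:
  fixes x \<omega> :: "'c::complete_valued_field ^ 'n::finite"
  assumes "0 < \<rho>" "x \<in> polydisc \<omega> \<rho>"
  obtains \<theta> where "0 \<le> \<theta>" "\<theta> < 1" "\<And>m. absval (monomial_at \<omega> m x) \<le> (\<theta> * \<rho>) ^ sum m UNIV"
proof
  define \<theta> where "\<theta> = (MAX i. absval (x $ i - \<omega> $ i)) / \<rho>"
  have le: "absval (x $ i - \<omega> $ i) \<le> \<theta> * \<rho>" for i
    using assms(1) by (simp add: \<theta>_def)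
  show "0 \<le> \<theta>"
    using le[of undefined] assms(1) by (meson absval_nonneg order_trans zero_le_mult_iff not_less)
  show "\<theta> < 1"
    using assms by (simp add: \<theta>_def polydisc_def)
  show "absval (monomial_at \<omega> m x) \<le> (\<theta> * \<rho>) ^ sum m UNIV" for m
    unfolding monomial_at_def absval_prod power_sum absval_power
    by (intro prod_mono conjI power_mono le) auto
qed

lemma power_series_term_le:
  assumes "power_series_on \<omega> \<rho> b c f" "0 < \<rho>" "x \<in> polydisc \<omega> \<rho>"
  obtains \<theta> where "0 \<le> \<theta>" "\<theta> < 1"
    "\<And>m. absval (c m * monomial_at \<omega> m x) \<le> b * \<theta> ^ sum m UNIV"
proof -
  obtain \<theta> where \<theta>: "0 \<le> \<theta>" "\<theta> < 1" "\<And>m. absval (monomial_at \<omega> m x) \<le> (\<theta> * \<rho>) ^ sum m UNIV"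
    using absval_monomial_le[OF assms(2,3)] by blast
  have "absval (c m * monomial_at \<omega> m x) \<le> b * \<theta> ^ sum m UNIV" for m
  proof -
    have "absval (c m * monomial_at \<omega> m x) \<le> absval (c m) * (\<theta> * \<rho>) ^ sum m UNIV"
      using \<theta>(3) by (simp add: absval_mult mult_left_mono)
    also have "\<dots> = (absval (c m) * \<rho> ^ sum m UNIV) * \<theta> ^ sum m UNIV"
      by (simp add: power_mult_distrib)
    also have "\<dots> \<le> b * \<theta> ^ sum m UNIV"
      using assms(1) \<theta>(1) by (intro mult_right_mono) (auto simp: power_series_on_def)
    finally show ?thesis .
  qed
  with \<theta>(1,2) that show ?thesis by blast
qed

lemma power_series_absval_le:
  assumes "power_series_on \<omega> \<rho> b c f" "0 < \<rho>" "x \<in> polydisc \<omega> \<rho>"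
  shows "absval (f x) \<le> b"
proof -
  obtain \<theta> where \<theta>: "0 \<le> \<theta>" "\<theta> < 1"
    "\<And>m. absval (c m * monomial_at \<omega> m x) \<le> b * \<theta> ^ sum m UNIV"
    using power_series_term_le[OF assms] by blast
  have "b * \<theta> ^ sum m UNIV \<le> b * 1" for m
    using \<theta>(1,2) power_series_on_nonneg[OF assms(1)] by (intro mult_left_mono power_le_one) auto
  then have "absval (c m * monomial_at \<omega> m x) \<le> b" for m
    using \<theta>(3)[of m] by (metis mult.right_neutral order_trans)
  then show ?thesis
    using assms by (intro absval_has_sum_le[where s = "f x" and I = UNIV]) (auto simp: power_series_on_def power_series_on_nonneg[OF assms(1)])
qed

text \<open>The bounds \<open>b s\<close> and the geometric decay of the monomials make the double
  family of terms null, so the sum over \<open>s\<close> may be taken coefficient by coefficient.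
  The second claim is what later justifies differentiation term by term.\<close>

lemma power_series_on_infsum:
  fixes \<omega> :: "'c::complete_valued_field ^ 'n::finite" and C :: "'s \<Rightarrow> ('n \<Rightarrow> nat) \<Rightarrow> 'c"
  assumes \<rho>: "0 < \<rho>" and b: "null_family I b"
    and f: "\<And>s. s \<in> I \<Longrightarrow> power_series_on \<omega> \<rho> (b s) (C s) (f s)"
    and B: "\<And>s. s \<in> I \<Longrightarrow> b s \<le> B" "0 \<le> B"
  shows "power_series_on \<omega> \<rho> B (\<lambda>m. infsum (\<lambda>s. C s m) I) (\<lambda>x. infsum (\<lambda>s. f s x) I)"
    and "\<And>m. ((\<lambda>s. C s m) has_sum infsum (\<lambda>s. C s m) I) I"
proof -
  have Cle: "absval (C s m) \<le> b s / \<rho> ^ sum m UNIV" if "s \<in> I" for s m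
    using f[OF that] \<rho> by (simp add: power_series_on_def pos_le_divide_eq)
  have "null_family I (\<lambda>s. inverse (\<rho> ^ sum m UNIV) * b s)" for m
    using \<rho> by (intro null_family_cmult b) auto
  then have "null_family I (\<lambda>s. b s / \<rho> ^ sum m UNIV)" for m
    by (simp add: field_simps)
  then show C: "((\<lambda>s. C s m) has_sum infsum (\<lambda>s. C s m) I) I" for m
    using Cle by (rule ultrametric_has_sum_infsum)
  show "power_series_on \<omega> \<rho> B (\<lambda>m. infsum (\<lambda>s. C s m) I) (\<lambda>x. infsum (\<lambda>s. f s x) I)"
    unfolding power_series_on_def
  proof safe
    fix m :: "'n \<Rightarrow> nat"
    have "b s / \<rho> ^ sum m UNIV \<le> B / \<rho> ^ sum m UNIV" if "s \<in> I" for s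
      using B(1)[OF that] \<rho> by (intro divide_right_mono) auto
    then have "absval (C s m) \<le> B / \<rho> ^ sum m UNIV" if "s \<in> I" for s
      using Cle that by (meson order_trans)
    then have "absval (infsum (\<lambda>s. C s m) I) \<le> B / \<rho> ^ sum m UNIV"
      using \<rho> B(2) by (intro absval_has_sum_le[OF C]) auto
    then show "absval (infsum (\<lambda>s. C s m) I) * \<rho> ^ sum m UNIV \<le> B"
      using \<rho> by (simp add: pos_le_divide_eq)
  next
    fix x
    assume x: "x \<in> polydisc \<omega> \<rho>"
    obtain \<theta> where \<theta>: "0 \<le> \<theta>" "\<theta> < 1" "\<And>m. absval (monomial_at \<omega> m x) \<le> (\<theta> * \<rho>) ^ sum m UNIV"
      using absval_monomial_le[OF \<rho> x] by blast
    have "absval (C s m * monomial_at \<omega> m x) \<le> b s * \<theta> ^ sum m UNIV" if "s \<in> I" for s m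
    proof -
      have "absval (C s m * monomial_at \<omega> m x) \<le> (b s / \<rho> ^ sum m UNIV) * (\<theta> * \<rho>) ^ sum m UNIV"
        unfolding absval_mult using \<theta>(3) Cle[OF that] \<rho> power_series_on_nonneg[OF f[OF that]]
        by (intro mult_mono) auto
      then show ?thesis
        using \<rho> by (simp add: power_mult_distrib)
    qed
    then have "null_family (I \<times> UNIV) (\<lambda>(s, m). absval (C s m * monomial_at \<omega> m x))"
      using \<theta> f
      by (intro null_family_mono[OF null_family_Times[OF b null_family_geometric_multi[OF \<theta>(1,2)]]])
         (auto intro: power_series_on_nonneg[OF f])
    then obtain t where t: "((\<lambda>s. f s x) has_sum t) I"
        "((\<lambda>m. infsum (\<lambda>s. C s m) I * monomial_at \<omega> m x) has_sum t) UNIV"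
    proof (rule ultrametric_sum_swap)
      show "((\<lambda>m. C s m * monomial_at \<omega> m x) has_sum f s x) UNIV" if "s \<in> I" for s
        using f[OF that] x by (simp add: power_series_on_def)
      show "((\<lambda>s. C s m * monomial_at \<omega> m x) has_sum infsum (\<lambda>s. C s m) I * monomial_at \<omega> m x) I" for m
        by (intro has_sum_cmult_left C)
    qed
    then show "((\<lambda>m. infsum (\<lambda>s. C s m) I * monomial_at \<omega> m x) has_sum infsum (\<lambda>s. f s x) I) UNIV"
      by (simp add: infsumI)
  qed
qed

lemma bounded_analytic_absval_le:
  "bounded_analytic \<omega> \<rho> b f \<Longrightarrow> 0 < \<rho> \<Longrightarrow> x \<in> polydisc \<omega> \<rho> \<Longrightarrow> absval (f x) \<le> b"
  by (auto simp: bounded_analytic_def intro: power_series_absval_le)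

lemma bounded_analytic_infsum:
  assumes "0 < \<rho>" "null_family I b" "\<And>s. s \<in> I \<Longrightarrow> bounded_analytic \<omega> \<rho> (b s) (f s)"
    and "\<And>s. s \<in> I \<Longrightarrow> b s \<le> B" "0 \<le> B"
  shows "bounded_analytic \<omega> \<rho> B (\<lambda>x. infsum (\<lambda>s. f s x) I)"
proof -
  obtain C where "\<And>s. s \<in> I \<Longrightarrow> power_series_on \<omega> \<rho> (b s) (C s) (f s)"
    using assms(3) unfolding bounded_analytic_def by metis
  then show ?thesis
    using power_series_on_infsum(1)[OF assms(1,2) _ assms(4,5)] unfolding bounded_analytic_def by blast
qed

lemma bounded_analytic_sum:
  assumes "0 < \<rho>" "finite I" "\<And>s. s \<in> I \<Longrightarrow> bounded_analytic \<omega> \<rho> B (f s)" "0 \<le> B"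
  shows "bounded_analytic \<omega> \<rho> B (\<lambda>x. \<Sum>s\<in>I. f s x)"
  using bounded_analytic_infsum[OF assms(1) null_family_finite[OF assms(2)] assms(3) _ assms(4)] assms(2)
  by simp

lemma bounded_analytic_monomial:
  "bounded_analytic \<omega> \<rho> (absval a * \<rho> ^ sum m UNIV) (\<lambda>x. a * monomial_at \<omega> m x)" if "0 < \<rho>"
  unfolding bounded_analytic_def power_series_on_def
  using that by (intro exI[of _ "\<lambda>k. if k = m then a else 0"])
     (auto intro!: has_sum_finite_neutralI[of "{m}"] split: if_splits)

lemma bounded_analytic_const: "0 < \<rho> \<Longrightarrow> bounded_analytic \<omega> \<rho> (absval a) (\<lambda>x. a)"
  using bounded_analytic_monomial[of \<rho> \<omega> a "\<lambda>_. 0"] by (simp add: monomial_at_def)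

definition unit_index :: "'n \<Rightarrow> 'n \<Rightarrow> nat" where
  "unit_index i = (\<lambda>j. if j = i then 1 else 0)"

lemma sum_unit_index: "sum (unit_index i) (UNIV :: 'n::finite set) = 1"
  by (simp add: unit_index_def)

lemma monomial_at_unit_index [simp]: "monomial_at \<omega> (unit_index i) x = x $ i - \<omega> $ i"
proof -
  have "monomial_at \<omega> (unit_index i) x = (\<Prod>j\<in>UNIV. if j = i then x $ j - \<omega> $ j else 1)"
    unfolding monomial_at_def unit_index_def by (intro prod.cong) auto
  then show ?thesis by simp
qed

lemma bounded_analytic_coord:
  "0 < \<rho> \<Longrightarrow> bounded_analytic \<omega> \<rho> (absval a * \<rho>) (\<lambda>x. a * (x $ i - \<omega> $ i))"
  using bounded_analytic_monomial[of \<rho> \<omega> a "unit_index i"] sum_unit_index[of i] by simp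

lemma monomial_at_add:
  "monomial_at \<omega> (\<lambda>i. m i + k i) x = monomial_at \<omega> m x * monomial_at \<omega> k x"
  by (simp add: monomial_at_def power_add prod.distrib)

lemma bounded_analytic_mult:
  fixes \<omega> :: "'c::complete_valued_field ^ 'n::finite"
  assumes \<rho>: "0 < \<rho>" and "bounded_analytic \<omega> \<rho> b f" "bounded_analytic \<omega> \<rho> b' g"
  shows "bounded_analytic \<omega> \<rho> (b * b') (\<lambda>x. f x * g x)"
proof -
  obtain c d where c: "power_series_on \<omega> \<rho> b c f" and d: "power_series_on \<omega> \<rho> b' d g"
    using assms(2,3) unfolding bounded_analytic_def by blast
  \<comment> \<open>Indices of the Cauchy product: for \<open>p\<close> componentwise below
    \<open>m\<close> the subtraction \<open>m i - p i\<close> is not truncated.\<close>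
  define below where "below = (\<lambda>m :: 'n \<Rightarrow> nat. {p. \<forall>i. p i \<le> m i})"
  define e where "e = (\<lambda>m. \<Sum>p\<in>below m. c p * d (\<lambda>i. m i - p i))"
  have fin: "finite (below m)" for m
  proof -
    have "below m \<subseteq> {p. sum p UNIV < Suc (sum m UNIV)}"
      by (auto simp: below_def less_Suc_eq_le intro: sum_mono)
    then show ?thesis
      using finite_bounded_multiindices finite_subset by blast
  qed
  have "absval (e m) * \<rho> ^ sum m UNIV \<le> b * b'" for m
  proof -
    have "absval (c p * d (\<lambda>i. m i - p i)) \<le> b * b' / \<rho> ^ sum m UNIV" if "p \<in> below m" for p
    proof -
      have "sum m UNIV = sum p UNIV + (\<Sum>i\<in>UNIV. m i - p i)"
        using that by (simp add: below_def flip: sum.distrib)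
      then have "absval (c p * d (\<lambda>i. m i - p i)) * \<rho> ^ sum m UNIV
        = (absval (c p) * \<rho> ^ sum p UNIV) * (absval (d (\<lambda>i. m i - p i)) * \<rho> ^ (\<Sum>i\<in>UNIV. m i - p i))"
        by (simp add: absval_mult power_add)
      also have "\<dots> \<le> b * b'"
        using c d \<rho> power_series_on_nonneg[OF c]
        by (intro mult_mono) (auto simp: power_series_on_def)
      finally show ?thesis
        using \<rho> by (simp add: pos_le_divide_eq)
    qed
    then have "absval (e m) \<le> b * b' / \<rho> ^ sum m UNIV"
      unfolding e_def using \<rho> power_series_on_nonneg[OF c] power_series_on_nonneg[OF d]
      by (intro absval_sum_le) auto
    then show ?thesis
      using \<rho> by (simp add: pos_le_divide_eq)
  qed
  moreover have "((\<lambda>m. e m * monomial_at \<omega> m x) has_sum f x * g x) UNIV" if x: "x \<in> polydisc \<omega> \<rho>" for x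
  proof -
    let ?F = "\<lambda>m. c m * monomial_at \<omega> m x" and ?G = "\<lambda>m. d m * monomial_at \<omega> m x"
    obtain \<theta> where \<theta>: "0 \<le> \<theta>" "\<theta> < 1" "\<And>m. absval (?F m) \<le> b * \<theta> ^ sum m UNIV"
      using power_series_term_le[OF c \<rho> x] by blast
    obtain \<eta> where \<eta>: "0 \<le> \<eta>" "\<eta> < 1" "\<And>m. absval (?G m) \<le> b' * \<eta> ^ sum m UNIV"
      using power_series_term_le[OF d \<rho> x] by blast
    have nF: "null_family UNIV (\<lambda>m. absval (?F m))"
      by (rule null_family_mono[OF null_family_cmult[OF null_family_geometric_multi[OF \<theta>(1,2)]]])
         (use \<theta>(3) power_series_on_nonneg[OF c] in auto)
    have nG: "null_family UNIV (\<lambda>m. absval (?G m))"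
      by (rule null_family_mono[OF null_family_cmult[OF null_family_geometric_multi[OF \<eta>(1,2)]]])
         (use \<eta>(3) power_series_on_nonneg[OF d] in auto)
    have F: "(?F has_sum f x) UNIV" and G: "(?G has_sum g x) UNIV"
      using c d x by (auto simp: power_series_on_def)
    have "(\<lambda>(m, k). ?F m * ?G k) summable_on (UNIV \<times> UNIV)"
      using null_family_Times[OF nF nG]
      by (intro ultrametric_summable_on) (simp add: absval_mult case_prod_unfold)
    then have "((\<lambda>(m, k). ?F m * ?G k) has_sum f x * g x) (UNIV \<times> UNIV)"
      by (rule has_sum_SigmaI[rotated 2, where g = "\<lambda>m. ?F m * g x"])
         (auto intro: has_sum_cmult_right[OF G] has_sum_cmult_left[OF F])
    \<comment> \<open>Pairs of exponents \<open>(p, k)\<close> are regrouped by their sum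
      \<open>m = p + k\<close>.\<close>
    moreover have "bij_betw (\<lambda>(m, p). (p, \<lambda>i. m i - p i)) (Sigma UNIV below) (UNIV \<times> UNIV)"
      by (rule bij_betwI[of _ _ _ "\<lambda>(p, k). (\<lambda>i. p i + k i, p)"]) (auto simp: below_def)
    ultimately have "((\<lambda>(m, p). ?F p * ?G (\<lambda>i. m i - p i)) has_sum f x * g x) (Sigma UNIV below)"
      by (simp add: case_prod_unfold has_sum_reindex_bij_betw[where f = "\<lambda>z. ?F (fst z) * ?G (snd z)", symmetric])
    then show ?thesis
    proof (rule has_sum_Sigma')
      fix m :: "'n \<Rightarrow> nat"
      have eq: "?F p * ?G (\<lambda>i. m i - p i) = c p * d (\<lambda>i. m i - p i) * monomial_at \<omega> m x" if "p \<in> below m" for p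
      proof -
        have "monomial_at \<omega> m x = monomial_at \<omega> p x * monomial_at \<omega> (\<lambda>i. m i - p i) x"
          using that by (simp add: below_def flip: monomial_at_add)
        then show ?thesis by simp
      qed
      show "((\<lambda>p. case (m, p) of (m, p) \<Rightarrow> ?F p * ?G (\<lambda>i. m i - p i)) has_sum e m * monomial_at \<omega> m x) (below m)"
        unfolding e_def sum_distrib_right prod.case
        by (intro has_sum_finiteI[OF fin] sum.cong refl eq[symmetric])
    qed
  qed
  ultimately show ?thesis
    unfolding bounded_analytic_def power_series_on_def by blast
qed

lemma bounded_analytic_power:
  "0 < \<rho> \<Longrightarrow> bounded_analytic \<omega> \<rho> b f \<Longrightarrow> bounded_analytic \<omega> \<rho> (b ^ n) (\<lambda>x. f x ^ n)"
proof (induction n)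
  case 0
  then show ?case using bounded_analytic_const[of \<rho> \<omega> 1] by simp
next
  case (Suc n)
  then show ?case using bounded_analytic_mult[of \<rho> \<omega> b f] by simp
qed

lemma bounded_analytic_prod:
  assumes "0 < \<rho>" "\<And>s. s \<in> I \<Longrightarrow> bounded_analytic \<omega> \<rho> (b s) (f s)"
  shows "bounded_analytic \<omega> \<rho> (\<Prod>s\<in>I. b s) (\<lambda>x. \<Prod>s\<in>I. f s x)"
  using assms
proof (induction I rule: infinite_finite_induct)
  case (insert i I)
  then show ?case using bounded_analytic_mult[of \<rho> \<omega> "b i" "f i"] by simp
qed (use bounded_analytic_const[of \<rho> \<omega> 1] in auto)

text \<open>Geometric series in \<open>- u / a\<close>, whose powers have bounds
  \<open>\<theta> ^ n\<close> tending to zero. The first term \<open>1 / a\<close> dominates and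
  gives the bound.\<close>

lemma bounded_analytic_inverse:
  assumes \<rho>: "0 < \<rho>" and u: "bounded_analytic \<omega> \<rho> (\<theta> * absval a) u" and \<theta>: "\<theta> < 1" and a: "a \<noteq> 0"
  shows "bounded_analytic \<omega> \<rho> (1 / absval a) (\<lambda>x. 1 / (a + u x))"
proof -
  have "0 \<le> \<theta> * absval a"
    using bounded_analytic_nonneg[OF u] .
  then have \<theta>0: "0 \<le> \<theta>"
    using a by (metis absval_pos_iff zero_le_mult_iff less_le_not_le)
  define f where "f = (\<lambda>n x. (1 / a) * ((- 1 / a) * u x) ^ n)"
  have "bounded_analytic \<omega> \<rho> (absval (- 1 / a) * (\<theta> * absval a)) (\<lambda>x. (- 1 / a) * u x)"
    by (intro bounded_analytic_mult bounded_analytic_const \<rho> u)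
  then have "bounded_analytic \<omega> \<rho> \<theta> (\<lambda>x. (- 1 / a) * u x)"
    using a by (simp add: absval_divide)
  then have "bounded_analytic \<omega> \<rho> (absval (1 / a) * \<theta> ^ n) (f n)" for n
    unfolding f_def by (intro bounded_analytic_mult bounded_analytic_const bounded_analytic_power \<rho>)
  moreover have "absval (1 / a) * \<theta> ^ n \<le> 1 / absval a" for n
    using mult_left_mono[of "\<theta> ^ n" 1 "absval (1 / a)"] \<theta> \<theta>0
    by (simp add: absval_divide power_le_one)
  moreover have "null_family UNIV (\<lambda>n. absval (1 / a) * \<theta> ^ n)"
    using \<theta> \<theta>0 by (intro null_family_cmult null_family_geometric) auto
  ultimately have "bounded_analytic \<omega> \<rho> (1 / absval a) (\<lambda>x. infsum (\<lambda>n. f n x) UNIV)"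
    using \<rho> by (intro bounded_analytic_infsum) auto
  then show ?thesis
  proof (rule bounded_analytic_cong)
    fix x
    assume x: "x \<in> polydisc \<omega> \<rho>"
    have ux: "absval (u x) \<le> \<theta> * absval a"
      using bounded_analytic_absval_le[OF u \<rho> x] .
    also have "\<theta> * absval a < 1 * absval a"
      using a \<theta> by (intro mult_strict_right_mono) auto
    finally have lt: "absval (u x) < absval a"
      by simp
    then have "absval ((- 1 / a) * u x) < 1"
      using a by (simp add: absval_mult absval_divide)
    from has_sum_cmult_right[OF ultrametric_geometric_sum[OF this], of "1 / a"]
    have "infsum (\<lambda>n. f n x) UNIV = (1 / a) * (1 / (1 - (- 1 / a) * u x))"
      unfolding f_def by (rule infsumI)
    also have "\<dots> = 1 / (a + u x)"
    proof -
      have "a + u x \<noteq> 0"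
        using lt by (metis absval_minus add_eq_0_iff order_less_irrefl)
      then show ?thesis using a by (simp add: field_simps)
    qed
    finally show "infsum (\<lambda>n. f n x) UNIV = 1 / (a + u x)" .
  qed
qed

subsection \<open>Partial derivatives\<close>

text \<open>Relational form of \<open>partial_deriv\<close>, whose \<open>Lim\<close> carries
  information only once the limit is known to exist.\<close>

definition has_partial_deriv ::
  "'n::finite \<Rightarrow> ('c::complete_valued_field ^ 'n \<Rightarrow> 'c) \<Rightarrow> 'c ^ 'n \<Rightarrow> 'c \<Rightarrow> bool" where
  "has_partial_deriv i f \<omega> d \<longleftrightarrow> ((\<lambda>t. (f (\<omega> + axis i t) - f \<omega>) / t) \<longlongrightarrow> d) (at 0)"

text \<open>Along the \<open>i\<close>-th axis only pure powers of \<open>t\<close> survive. After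
  the constant and the linear term are removed every exponent is at least 2, and by the ultrametric
  inequality the remainder is no larger than the bound \<open>b * (absval t / \<rho>)^2\<close> for
  its terms.\<close>

lemma power_series_has_partial_deriv:
  fixes \<omega> :: "'c::complete_valued_field ^ 'n::finite"
  assumes \<rho>: "0 < \<rho>" and f: "power_series_on \<omega> \<rho> b c f"
  shows "has_partial_deriv i f \<omega> (c (unit_index i))"
proof -
  define u where "u = unit_index i"
  define z where "z = (\<lambda>_::'n. 0::nat)"
  have b: "0 \<le> b" using power_series_on_nonneg[OF f] .
  have uz: "u \<noteq> z"
    by (auto simp: u_def z_def unit_index_def fun_eq_iff)
  have mon: "monomial_at \<omega> m (\<omega> + axis i t) = (if \<forall>j. j \<noteq> i \<longrightarrow> m j = 0 then t ^ m i else 0)" for m t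
  proof -
    have "monomial_at \<omega> m (\<omega> + axis i t) = (\<Prod>j\<in>UNIV. axis i t $ j ^ m j)"
      by (simp add: monomial_at_def)
    also have "\<dots> = t ^ m i * (\<Prod>j\<in>UNIV - {i}. 0 ^ m j)"
      by (subst prod.remove[of _ i]) (auto simp: axis_def intro!: prod.cong)
    finally show ?thesis
      by (auto simp: prod_zero_iff)
  qed
  have rem: "absval (f (\<omega> + axis i t) - f \<omega> - c u * t) \<le> b * (absval t / \<rho>)^2" if t: "absval t < \<rho>" for t
  proof -
    have x: "\<omega> + axis i t \<in> polydisc \<omega> \<rho>"
      using t \<rho> by (auto simp: polydisc_def axis_def)
    have f0: "f \<omega> = c z"
    proof -
      have "((\<lambda>m. c m * monomial_at \<omega> m \<omega>) has_sum f \<omega>) UNIV"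
        using f \<rho> by (simp add: power_series_on_def)
      moreover have "((\<lambda>m. c m * monomial_at \<omega> m \<omega>) has_sum c z) UNIV"
        by (rule has_sum_finite_neutralI[of "{z}"])
           (auto simp: monomial_at_def z_def prod_zero_iff fun_eq_iff)
      ultimately show ?thesis
        by (rule has_sum_unique)
    qed
    \<comment> \<open>The series with the terms at \<open>z\<close> and \<open>u\<close> cancelled,
      by adding a finitely supported family.\<close>
    define R where "R = (\<lambda>m. c m * monomial_at \<omega> m (\<omega> + axis i t) + (if m \<in> {z, u} then - (c m * monomial_at \<omega> m (\<omega> + axis i t)) else 0))"
    have "(R has_sum (f (\<omega> + axis i t) + (\<Sum>m\<in>{z, u}. - (c m * monomial_at \<omega> m (\<omega> + axis i t))))) UNIV"
      unfolding R_def
    proof (rule has_sum_add)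
      show "((\<lambda>m. c m * monomial_at \<omega> m (\<omega> + axis i t)) has_sum f (\<omega> + axis i t)) UNIV"
        using f x by (simp add: power_series_on_def)
      show "((\<lambda>m. if m \<in> {z, u} then - (c m * monomial_at \<omega> m (\<omega> + axis i t)) else 0) has_sum
         (\<Sum>m\<in>{z, u}. - (c m * monomial_at \<omega> m (\<omega> + axis i t)))) UNIV"
        by (rule has_sum_finite_neutralI[of "{z, u}"]) auto
    qed
    moreover have "(\<Sum>m\<in>{z, u}. - (c m * monomial_at \<omega> m (\<omega> + axis i t))) = - f \<omega> - c u * t"
      using uz f0 by (simp add: u_def z_def monomial_at_def[of \<omega> "\<lambda>_. 0"] axis_def)
    ultimately have "(R has_sum (f (\<omega> + axis i t) - f \<omega> - c u * t)) UNIV"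
      by (simp add: algebra_simps)
    then show ?thesis
    proof (rule absval_has_sum_le)
      fix m
      show "absval (R m) \<le> b * (absval t / \<rho>)^2"
      proof (cases "m \<notin> {z, u} \<and> (\<forall>j. j \<noteq> i \<longrightarrow> m j = 0)")
        case True
        have "2 \<le> m i"
        proof (rule ccontr)
          assume "\<not> 2 \<le> m i"
          then have "m i = 0 \<or> m i = 1" by linarith
          then have "m = z \<or> m = u"
          proof
            assume "m i = 0"
            then have "m j = z j" for j
              using True by (cases "j = i") (auto simp: z_def)
            then show ?thesis by blast
          next
            assume "m i = 1"
            then have "m j = u j" for j
              using True by (cases "j = i") (auto simp: u_def unit_index_def)
            then show ?thesis by blast
          qed
          then show False using True by auto
        qed
        have "sum m UNIV = m i"
          using True by (subst sum.remove[of _ i]) auto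
        then have "absval (c m) * \<rho> ^ m i \<le> b"
          using f by (metis power_series_on_def)
        have "absval (R m) = absval (c m) * absval t ^ m i"
          using True by (auto simp: R_def mon absval_mult absval_power)
        also have "\<dots> = (absval (c m) * \<rho> ^ m i) * (absval t / \<rho>) ^ m i"
          using \<rho> by (simp add: power_divide)
        also have "\<dots> \<le> b * (absval t / \<rho>) ^ 2"
          using t \<rho> \<open>2 \<le> m i\<close> \<open>absval (c m) * \<rho> ^ m i \<le> b\<close> b
          by (intro mult_mono power_decreasing) auto
        finally show ?thesis .
      next
        case False
        then have "R m = 0"
          unfolding R_def mon by auto
        then show ?thesis using b by simp
      qed
    qed (use b in simp)
  qed
  have "\<forall>\<^sub>F t in at 0. absval ((f (\<omega> + axis i t) - f \<omega>) / t - c u) < e" if e: "0 < e" for e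
  proof -
    \<comment> \<open>The remainder divided by \<open>t\<close> has size at most
      \<open>b * absval t / \<rho>^2\<close>; the denominator \<open>b + 1\<close> also covers
      \<open>b = 0\<close>.\<close>
    define d where "d = min \<rho> (e * \<rho>^2 / (b + 1))"
    have "0 < d" using \<rho> e b by (auto simp: d_def)
    have "absval ((f (\<omega> + axis i t) - f \<omega>) / t - c u) < e" if t: "t \<noteq> 0" "absval t < d" for t
    proof -
      have "(f (\<omega> + axis i t) - f \<omega>) / t - c u = (f (\<omega> + axis i t) - f \<omega> - c u * t) / t"
        using t by (simp add: field_simps)
      then have "absval ((f (\<omega> + axis i t) - f \<omega>) / t - c u) \<le> b * (absval t / \<rho>)^2 / absval t"
        using rem[of t] t by (simp add: absval_divide d_def divide_right_mono)
      also have "\<dots> = b * absval t / \<rho>^2"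
        using t(1) by (simp add: power2_eq_square)
      also have "\<dots> < e"
      proof -
        have "absval t < e * \<rho>^2 / (b + 1)"
          using t by (simp add: d_def)
        then have "absval t * (b + 1) < e * \<rho>^2"
          using b by (simp add: pos_less_divide_eq)
        moreover have "b * absval t \<le> absval t * (b + 1)"
          by (simp add: algebra_simps)
        ultimately have "b * absval t < e * \<rho>^2"
          by linarith
        then show ?thesis
          using \<rho> by (simp add: pos_divide_less_eq)
      qed
      finally show ?thesis .
    qed
    then show ?thesis
      unfolding eventually_at using \<open>0 < d\<close> by (intro exI[of _ d]) (auto simp: dist_absval)
  qed
  then show ?thesis
    by (simp add: has_partial_deriv_def tendsto_absval_iff u_def)
qed

lemma bounded_analytic_has_partial_deriv:
  "0 < \<rho> \<Longrightarrow> bounded_analytic \<omega> \<rho> b f \<Longrightarrow> \<exists>d. has_partial_deriv i f \<omega> d"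
  unfolding bounded_analytic_def using power_series_has_partial_deriv by blast

subsection \<open>Laurent series over a finite field\<close>

lemma card_field_gt_1: "1 < CARD('f::{field,finite})"
proof -
  have "card {0, 1 :: 'f} \<le> CARD('f)"
    by (intro card_mono) auto
  then show ?thesis by simp
qed

text \<open>Multiplication by a nonzero \<open>x\<close> permutes the nonzero elements; comparing
  the products over them gives \<open>x ^ (q - 1) = 1\<close>.\<close>

lemma power_card_field_eq:
  fixes x :: "'f::{field,finite}"
  shows "x ^ CARD('f) = x"
proof (cases "x = 0")
  case True
  then show ?thesis using card_field_gt_1[where 'f = 'f] by simp
next
  case False
  let ?U = "UNIV - {0 :: 'f}"
  have "bij_betw ((*) x) ?U ?U"
    by (rule bij_betwI[of _ _ _ "\<lambda>y. y / x"]) (use False in auto)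
  then have "(\<Prod>y\<in>?U. x * y) = \<Prod>?U"
    by (rule prod.reindex_bij_betw)
  then have "x ^ card ?U * \<Prod>?U = 1 * \<Prod>?U"
    unfolding prod.distrib prod_constant mult_1 .
  moreover have "\<Prod>?U \<noteq> 0"
    by (subst prod_zero_iff) auto
  ultimately have "x ^ card ?U = 1"
    by (rule mult_right_cancel[THEN iffD1, rotated])
  moreover have "CARD('f) = Suc (card ?U)"
    by (rule card.remove) auto
  ultimately show ?thesis
    by (simp only: power_Suc mult_1_right)
qed

text \<open>The polynomial \<open>(1 + X)^q - X^q - 1\<close> has degree below \<open>q\<close> but
  vanishes at all \<open>q\<close> elements of the field. This yields additivity of the
  \<open>q\<close>-th power without writing \<open>q\<close> as a power of the
  characteristic.\<close>

lemma of_nat_binomial_card_field: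
  assumes "0 < j" "j < CARD('f)"
  shows "of_nat (CARD('f) choose j) = (0 :: 'f::{field,finite})"
proof -
  define q where "q = CARD('f)"
  define p :: "'f poly" where "p = [:1, 1:] ^ q - monom 1 q - 1"
  have "1 < q"
    using card_field_gt_1[where 'f = 'f] by (simp add: q_def)
  have cf: "coeff p i = (if i = 0 \<or> i = q then 0 else of_nat (q choose i))" for i
  proof (cases "i \<le> q")
    case True
    then show ?thesis
      using \<open>1 < q\<close> by (auto simp: p_def coeff_linear_poly_power)
  next
    case False
    have "degree ([:1, 1 :: 'f:] ^ q) \<le> q"
      using degree_power_le[of "[:1, 1 :: 'f:]" q] by simp
    then have "coeff ([:1, 1 :: 'f:] ^ q) i = 0"
      using False by (intro coeff_eq_0) simp
    with False show ?thesis
      by (simp add: p_def binomial_eq_0)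
  qed
  have "p = 0"
  proof (rule ccontr)
    assume "p \<noteq> 0"
    have "degree p \<le> q - 1"
        using \<open>1 < q\<close> by (intro degree_le) (auto simp: cf binomial_eq_0)
    moreover have "{x. poly p x = 0} = UNIV"
      by (auto simp: p_def q_def poly_monom power_card_field_eq)
    then have "q \<le> degree p"
      using card_poly_roots_bound[OF \<open>p \<noteq> 0\<close>] by (simp add: q_def)
    ultimately show False using \<open>1 < q\<close> by simp
  qed
  then show ?thesis
    using cf[of j] assms by (simp add: q_def)
qed

section \<open>Absolute value and completeness of the Laurent series field\<close>

lemma absval_K_nonneg [simp]: "0 \<le> absval_K x"
  by (simp add: absval_K_def)

lemma absval_K_eq_0_iff [simp]: "absval_K x = 0 \<longleftrightarrow> x = 0"
  by (simp add: absval_K_def power_int_eq_0_iff)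

lemma absval_K_0 [simp]: "absval_K 0 = 0"
  by simp

lemma absval_K_const: "s \<noteq> 0 \<Longrightarrow> absval_K (fls_const s) = 1"
  by (simp add: absval_K_def)

lemma absval_K_X_inv: "absval_K (fls_X_inv :: 'f::{field,finite} fls) = real CARD('f)"
  by (simp add: absval_K_def)

lemma absval_K_less_imp_nth_eq_0:
  fixes x :: "'f::{field,finite} fls"
  assumes "absval_K x < 1 / real CARD('f) ^ k" "i \<le> int k"
  shows "fls_nth x i = 0"
proof (cases "x = 0")
  case False
  then have "real CARD('f) powi (- fls_subdegree x) < real CARD('f) powi (- int k)"
    using assms(1) by (simp add: absval_K_def power_int_minus_divide)
  then have "- fls_subdegree x < - int k"
    using card_field_gt_1[where 'f = 'f] using power_int_increasing[of "- int k" "- fls_subdegree x" "real CARD('f)"] by (auto simp: not_less[symmetric])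
  then show ?thesis
    using assms(2) by (intro fls_eq0_below_subdegree) simp
qed simp

lemma absval_K_le_if_nth_eq_0:
  fixes x :: "'f::{field,finite} fls"
  assumes "\<And>i. i \<le> int k \<Longrightarrow> fls_nth x i = 0"
  shows "absval_K x \<le> 1 / real CARD('f) ^ k"
proof (cases "x = 0")
  case False
  then have "int k \<le> fls_subdegree x"
    using assms by (intro fls_subdegree_geI) auto
  then have "real CARD('f) powi (- fls_subdegree x) \<le> real CARD('f) powi (- int k)"
    using card_field_gt_1[where 'f = 'f] by (intro power_int_increasing) auto
  then show ?thesis
    using False by (simp add: absval_K_def power_int_minus_divide)
qed simp

text \<open>Closeness in absolute value means agreement of all coefficients up to some index, so
  each coefficient of a Cauchy sequence is eventually constant.\<close>

lemma K_complete:
  fixes X :: "nat \<Rightarrow> 'f::{field,finite} fls"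
  assumes cauchy: "\<And>e. 0 < e \<Longrightarrow> \<exists>N. \<forall>n\<ge>N. \<forall>m\<ge>N. absval_K (X n - X m) < e"
  obtains x where "(\<lambda>n. absval_K (X n - x)) \<longlonglongrightarrow> 0"
proof -
  let ?q = "real CARD('f)"
  have q: "1 < ?q"
    using card_field_gt_1[where 'f = 'f] by simp
  have "\<exists>N. \<forall>n\<ge>N. \<forall>m\<ge>N. \<forall>i\<le>int k. fls_nth (X n) i = fls_nth (X m) i" for k
  proof -
    obtain N where "\<forall>n\<ge>N. \<forall>m\<ge>N. absval_K (X n - X m) < 1 / ?q ^ k"
      using cauchy[of "1 / ?q ^ k"] q by auto
    then have "fls_nth (X n - X m) i = 0" if "N \<le> n" "N \<le> m" "i \<le> int k" for n m i
      using absval_K_less_imp_nth_eq_0 that by blast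
    then show ?thesis by auto
  qed
  then obtain N where N: "\<And>k n m i. N k \<le> n \<Longrightarrow> N k \<le> m \<Longrightarrow> i \<le> int k \<Longrightarrow> fls_nth (X n) i = fls_nth (X m) i"
    by metis
  \<comment> \<open>For \<open>i < 0\<close> the value \<open>nat i\<close> is 0, so all negative
    coefficients are read off the single series \<open>X (N 0)\<close>. This bounds the support of
    \<open>f\<close> from below, as a Laurent series requires.\<close>
  define f where "f = (\<lambda>i. fls_nth (X (N (nat i))) i)"
  have f: "f i = fls_nth (X n) i" if "N k \<le> n" "i \<le> int k" for i k n
  proof -
    define m where "m = max n (N (nat i))"
    have "f i = fls_nth (X m) i"
      unfolding f_def by (rule N[of "nat i"]) (auto simp: m_def)
    also have "\<dots> = fls_nth (X n) i"
      using that by (intro N[of k]) (auto simp: m_def)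
    finally show ?thesis .
  qed
  have "\<forall>i < min 0 (fls_subdegree (X (N 0))). f i = 0"
    using f[of 0 "N 0"] by simp
  then have nth: "fls_nth (Abs_fls f) i = f i" for i
    by (rule nth_Abs_fls_lower_bound)
  have "(\<lambda>n. absval_K (X n - Abs_fls f)) \<longlonglongrightarrow> 0"
  proof (rule LIMSEQ_I)
    fix e :: real
    assume "0 < e"
    then obtain k where "(1 / ?q) ^ k < e"
      using real_arch_pow_inv[of e "1 / ?q"] q by auto
    then have "1 / ?q ^ k < e"
      by (simp add: power_divide)
    have "absval_K (X n - Abs_fls f) < e" if "N k \<le> n" for n
    proof -
      have "absval_K (X n - Abs_fls f) \<le> 1 / ?q ^ k"
        using f[OF that] by (intro absval_K_le_if_nth_eq_0) (simp add: nth)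
      with \<open>1 / ?q ^ k < e\<close> show ?thesis by simp
    qed
    then show "\<exists>n0. \<forall>n\<ge>n0. norm (absval_K (X n - Abs_fls f) - 0) < e"
      by auto
  qed
  then show ?thesis using that by blast
qed

section \<open>Vectors of polynomials as coordinates of periods\<close>

lemma A_to_K_0 [simp]: "A_to_K 0 = 0"
  by (simp add: A_to_K_def)

lemma A_to_K_pCons: "A_to_K (pCons s a) = fls_const s + fls_X_inv * A_to_K a"
  by (simp add: A_to_K_def map_poly_pCons)

lemma A_to_K_1 [simp]: "A_to_K 1 = 1"
  by (simp add: one_pCons A_to_K_pCons)

lemma A_to_K_diff: "A_to_K (a - b) = A_to_K a - A_to_K b"
proof (induction a b rule: poly_induct2)
  case (pCons s a t b)
  have "fls_const (s - t) = fls_const s - fls_const t"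
    by (rule fls_eqI) simp
  with pCons show ?case
    by (simp add: A_to_K_pCons right_diff_distrib)
qed simp

text \<open>A period is addressed by its coefficient vector \<open>a\<close>, so that it becomes a
  function of \<open>\<omega>\<close> and sums over the lattice have a fixed index set.\<close>

definition lattice_elt ::
  "('f::{field,finite} fls \<Rightarrow> 'c::complete_valued_field) \<Rightarrow> ('n::finite option \<Rightarrow> 'f poly) \<Rightarrow> 'c ^ 'n \<Rightarrow> 'c" where
  "lattice_elt \<iota> a \<omega> = K_form \<iota> (\<lambda>j. A_to_K (a j)) \<omega>"

definition height :: "('n::finite option \<Rightarrow> 'f::{field,finite} poly) \<Rightarrow> real" where
  "height a = (MAX j. absval_K (A_to_K (a j)))"

definition bounded_degree :: "nat \<Rightarrow> ('n::finite option \<Rightarrow> 'f::{field,finite} poly) set" where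
  "bounded_degree N = {a. \<forall>j. a j = 0 \<or> degree (a j) < N}"

abbreviation nonzero_vectors :: "('n::finite option \<Rightarrow> 'f::{field,finite} poly) set" where
  "nonzero_vectors \<equiv> {a. \<exists>j. a j \<noteq> 0}"

lemma absval_K_le_height: "absval_K (A_to_K (a j)) \<le> height a"
  unfolding height_def by (rule Max_ge) auto

lemma bounded_degree_0: "bounded_degree 0 = {\<lambda>_. 0}"
  by (auto simp: bounded_degree_def)

text \<open>Splitting off the constant coefficients: level \<open>N + 1\<close> is the constant
  vectors plus \<open>T\<close> times level \<open>N\<close>. The recursion of
  \<open>lattice_basis\<close> mirrors this.\<close>

lemma bounded_degree_Suc:
  "bij_betw (\<lambda>(s, a) j. pCons (s j) (a j)) (UNIV \<times> bounded_degree N)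
     (bounded_degree (Suc N) :: ('n::finite option \<Rightarrow> 'f::{field,finite} poly) set)"
proof (rule bij_betw_imageI)
  show "inj_on (\<lambda>(s, a) j. pCons (s j) (a j)) (UNIV \<times> bounded_degree N)"
    by (auto simp: inj_on_def fun_eq_iff)
  show "(\<lambda>(s, a) j. pCons (s j) (a j)) ` (UNIV \<times> bounded_degree N) =
      (bounded_degree (Suc N) :: ('n option \<Rightarrow> 'f poly) set)" (is "?f ` ?A = ?B")
  proof (rule equalityI)
    have "degree (pCons (s j) (a j)) < Suc N" if "a \<in> bounded_degree N" for j and s :: "'n option \<Rightarrow> 'f" and a
      using that by (cases "a j = 0") (auto simp: bounded_degree_def)
    then show "?f ` ?A \<subseteq> ?B"
      by (auto simp: bounded_degree_def)
    show "?B \<subseteq> ?f ` ?A"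
    proof
      fix b :: "'n option \<Rightarrow> 'f poly"
      assume b: "b \<in> bounded_degree (Suc N)"
      define s where "s = (\<lambda>j. coeff (b j) 0)"
      define a where "a = (\<lambda>j. poly_shift 1 (b j))"
      have eq: "b j = pCons (s j) (a j)" for j
        by (rule poly_eqI) (auto simp: s_def a_def coeff_pCons coeff_poly_shift split: nat.splits)
      have "a j = 0 \<or> degree (a j) < N" for j
        using b[unfolded bounded_degree_def, simplified, rule_format, of j] unfolding eq[of j]
        by (cases "a j = 0") auto
      then have "a \<in> bounded_degree N"
        by (simp add: bounded_degree_def)
      then show "b \<in> ?f ` ?A"
        using eq by (intro image_eqI[of _ _ "(s, a)"]) auto
    qed
  qed
qed

lemma finite_bounded_degree [simp]:
  "finite (bounded_degree N :: ('n::finite option \<Rightarrow> 'f::{field,finite} poly) set)"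
proof (induction N)
  case (Suc N)
  have "finite (UNIV \<times> bounded_degree N :: (('n option \<Rightarrow> 'f) \<times> ('n option \<Rightarrow> 'f poly)) set)"
    using Suc by simp
  then show ?case
    using bij_betw_finite[OF bounded_degree_Suc] by blast
qed (simp add: bounded_degree_0)

lemma card_bounded_degree:
  "card (bounded_degree N :: ('n::finite option \<Rightarrow> 'f::{field,finite} poly) set) = CARD('f) ^ (CARD('n option) * N)"
proof (induction N)
  case (Suc N)
  show ?case
    using bij_betw_same_card[OF bounded_degree_Suc[where 'n = 'n and 'f = 'f and N = N]] Suc
    by (simp add: card_cartesian_product card_fun power_add)
qed (simp add: bounded_degree_0)

lemma bounded_degree_mono: "M \<le> N \<Longrightarrow> bounded_degree M \<subseteq> bounded_degree N"
  unfolding bounded_degree_def by (blast intro: order_less_le_trans)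

lemma finite_subset_bounded_degree:
  assumes "finite S"
  shows "\<exists>N. S \<subseteq> bounded_degree N"
  using assms
proof induction
  case (insert a S)
  then obtain N where N: "S \<subseteq> bounded_degree N" by blast
  define M where "M = Suc (MAX j. degree (a j))"
  have "degree (a j) < M" for j
    unfolding M_def less_Suc_eq_le by (rule Max_ge) auto
  then have "a \<in> bounded_degree M"
    by (simp add: bounded_degree_def)
  then have "insert a S \<subseteq> bounded_degree (max M N)"
    using N bounded_degree_mono[of M "max M N"] bounded_degree_mono[of N "max M N"] by auto
  then show ?case by blast
qed simp

subsection \<open>The completed algebraic closure\<close>

text \<open>Quantitative membership in \<open>Omega\<close>. The constant \<open>c\<close> survives
  on the polydisc of radius \<open>c\<close> and can be chosen uniformly on each
  \<open>Omega_aff\<close>, which is what all estimates rely on.\<close>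

definition K_form_bounded_below ::
  "('f::{field,finite} fls \<Rightarrow> 'c::complete_valued_field) \<Rightarrow> real \<Rightarrow> 'c ^ 'n::finite \<Rightarrow> bool" where
  "K_form_bounded_below \<iota> c \<omega> \<longleftrightarrow> (\<forall>l. c * (MAX j. absval_K (l j)) \<le> absval (K_form \<iota> l \<omega>))"

context completed_algebraic_closure
begin

definition \<tau> :: 'c where "\<tau> = \<iota> fls_X_inv"

definition cst :: "'f \<Rightarrow> 'c" where "cst s = \<iota> (fls_const s)"

lemma q_gt_1: "1 < CARD('f)"
  by (rule card_field_gt_1)

lemma hom_0 [simp]: "\<iota> 0 = 0"
  using hom_add[of 0 0] by (metis add_0 add_right_cancel)

lemma hom_minus: "\<iota> (- x) = - \<iota> x"
  using hom_add[of x "- x"] by (simp add: minus_unique)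

lemma hom_diff: "\<iota> (x - y) = \<iota> x - \<iota> y"
  using hom_add[of x "- y"] by (simp add: hom_minus)

lemma hom_eq_0_iff [simp]: "\<iota> x = 0 \<longleftrightarrow> x = 0"
  by (metis absval_hom absval_eq_0_iff absval_K_eq_0_iff)

lemma hom_of_nat: "\<iota> (of_nat n) = of_nat n"
  by (induction n) (auto simp: hom_add hom_one)

lemma hom_inverse: "\<iota> (inverse x) = inverse (\<iota> x)"
proof (cases "x = 0")
  case False
  then have "\<iota> x * \<iota> (inverse x) = 1"
    by (simp add: hom_one flip: hom_mult)
  then show ?thesis
    by (metis inverse_unique)
qed simp

lemma absval_K_mult: "absval_K (x * y) = absval_K x * absval_K (y :: 'f fls)"
  by (simp flip: absval_hom add: hom_mult absval_mult)

lemma absval_\<tau>: "absval \<tau> = real CARD('f)"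
  by (simp add: \<tau>_def absval_hom absval_K_X_inv)

lemma \<tau>_nonzero [simp]: "\<tau> \<noteq> 0"
  by (simp add: \<tau>_def)

lemma \<tau>_power_neq_1: "0 < m \<Longrightarrow> \<tau> ^ m \<noteq> 1"
proof
  assume "0 < m" "\<tau> ^ m = 1"
  then have "real CARD('f) ^ m = 1"
    by (metis absval_1 absval_\<tau> absval_power)
  moreover have "1 < real CARD('f) ^ m"
    using \<open>0 < m\<close> q_gt_1 by (intro one_less_power) auto
  ultimately show False by simp
qed

lemma cst_0 [simp]: "cst 0 = 0"
  by (simp add: cst_def)

lemma cst_power_q: "cst s ^ CARD('f) = cst s"
proof -
  have "\<iota> x ^ n = \<iota> (x ^ n)" for x n
    by (induction n) (auto simp: hom_one hom_mult)
  then show ?thesis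
    by (simp add: cst_def power_card_field_eq flip: fls_const_power)
qed

lemma frobenius_add: "(x + y :: 'c) ^ CARD('f) = x ^ CARD('f) + y ^ CARD('f)"
proof -
  have zero: "of_nat (CARD('f) choose j) = (0 :: 'c)" if "0 < j" "j < CARD('f)" for j
  proof -
    have "of_nat (CARD('f) choose j) = (0 :: 'f fls)"
      using of_nat_binomial_card_field[OF that] by (simp add: fls_of_nat)
    then show ?thesis
      using hom_of_nat[of "CARD('f) choose j"] by simp
  qed
  have "(x + y) ^ CARD('f) = (\<Sum>j\<le>CARD('f). of_nat (CARD('f) choose j) * x ^ j * y ^ (CARD('f) - j))"
    by (rule binomial_ring)
  also have "\<dots> = (\<Sum>j\<in>{0, CARD('f)}. of_nat (CARD('f) choose j) * x ^ j * y ^ (CARD('f) - j))"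
    by (rule sum.mono_neutral_right) (auto simp: zero)
  finally show ?thesis
    using q_gt_1 by (simp add: add.commute)
qed

lemma frobenius_power_add: "(x + y :: 'c) ^ (CARD('f) ^ j) = x ^ (CARD('f) ^ j) + y ^ (CARD('f) ^ j)"
  by (induction j) (auto simp: power_mult frobenius_add mult.commute[of "CARD('f)"])

lemma frobenius_power_diff: "(x - y :: 'c) ^ (CARD('f) ^ j) = x ^ (CARD('f) ^ j) - y ^ (CARD('f) ^ j)"
  using frobenius_power_add[where x = "x - y" and y = y and j = j] by simp

lemma absval_A_to_K: "a \<noteq> 0 \<Longrightarrow> absval_K (A_to_K a :: 'f fls) = real CARD('f) ^ degree a"
proof (induction a)
  case (pCons s a)
  show ?case
  proof (cases "a = 0")
    case True
    then show ?thesis using pCons by (simp add: A_to_K_pCons absval_K_const)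
  next
    case False
    let ?x = "\<iota> (fls_X_inv * A_to_K a)"
    have x: "absval ?x = real CARD('f) * real CARD('f) ^ degree a"
      using False pCons by (simp add: hom_mult absval_mult absval_hom absval_K_X_inv)
    have "1 * 1 < real CARD('f) * real CARD('f) ^ degree a"
      using q_gt_1 by (intro mult_less_le_imp_less) (auto intro: one_le_power)
    moreover have "absval (\<iota> (fls_const s)) \<le> 1"
      by (cases "s = 0") (auto simp: absval_hom absval_K_const)
    ultimately have "absval (\<iota> (fls_const s)) < absval ?x"
      unfolding x by simp
    then have "absval (?x + \<iota> (fls_const s)) = absval ?x"
      by (rule absval_add_eq)
    then have "absval_K (A_to_K (pCons s a)) = absval ?x"
      by (simp add: A_to_K_pCons hom_add add.commute flip: absval_hom)
    with x False show ?thesis by simp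
  qed
qed simp

lemma A_to_K_eq_iff: "A_to_K a = (A_to_K b :: 'f fls) \<longleftrightarrow> a = b"
proof
  assume "A_to_K a = (A_to_K b :: 'f fls)"
  then have "absval_K (A_to_K (a - b) :: 'f fls) = 0"
    by (simp add: A_to_K_diff)
  then show "a = b"
    using absval_A_to_K[of "a - b"] q_gt_1 by (cases "a - b = 0") auto
qed simp

lemma height_ge_1:
  fixes a :: "'n::finite option \<Rightarrow> 'f poly"
  assumes "a \<in> nonzero_vectors"
  shows "1 \<le> height a"
proof -
  obtain j where "a j \<noteq> 0" using assms by auto
  then have "1 \<le> absval_K (A_to_K (a j))"
    using q_gt_1 by (simp add: absval_A_to_K one_le_power)
  also have "\<dots> \<le> height a"
    by (rule absval_K_le_height)
  finally show ?thesis .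
qed

lemma finite_height_le: "finite {a :: 'n::finite option \<Rightarrow> 'f poly. height a \<le> B}"
proof -
  obtain N where N: "B < real CARD('f) ^ N"
    using real_arch_pow[of "real CARD('f)" B] q_gt_1 by auto
  have "{a :: 'n option \<Rightarrow> 'f poly. height a \<le> B} \<subseteq> bounded_degree N"
  proof safe
    fix a :: "'n option \<Rightarrow> 'f poly"
    assume a: "height a \<le> B"
    have "degree (a j) < N" if "a j \<noteq> 0" for j
    proof -
      have "real CARD('f) ^ degree (a j) < real CARD('f) ^ N"
        using absval_K_le_height[of a j] absval_A_to_K[OF that] a N by simp
      then show ?thesis
        using q_gt_1 by simp
    qed
    then show "a \<in> bounded_degree N"
      by (auto simp: bounded_degree_def)
  qed
  then show ?thesis
    by (rule finite_subset) simp
qed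

section \<open>Linear forms and periods\<close>

lemma K_form_diff: "K_form \<iota> (\<lambda>j. l j - l' j) \<omega> = K_form \<iota> l \<omega> - K_form \<iota> l' \<omega>"
  by (simp add: K_form_def hom_diff left_diff_distrib sum_subtractf)

lemma lattice_elt_pCons:
  "lattice_elt \<iota> (\<lambda>j. pCons (s j) (a j)) \<omega> = (\<Sum>j\<in>UNIV. cst (s j) * hcoord \<omega> j) + \<tau> * lattice_elt \<iota> a \<omega>"
  by (simp add: lattice_elt_def K_form_def A_to_K_pCons hom_add hom_mult distrib_right sum.distrib
      sum_distrib_left mult.assoc cst_def \<tau>_def)

lemma lattice_elt_0 [simp]: "lattice_elt \<iota> (\<lambda>_. 0) \<omega> = 0"
  by (simp add: lattice_elt_def K_form_def)

lemma lattice_elt_eq_iff: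
  assumes "\<omega> \<in> Omega \<iota>"
  shows "lattice_elt \<iota> a \<omega> = lattice_elt \<iota> b \<omega> \<longleftrightarrow> a = b"
proof
  assume "lattice_elt \<iota> a \<omega> = lattice_elt \<iota> b \<omega>"
  then have "K_form \<iota> (\<lambda>j. A_to_K (a j) - A_to_K (b j)) \<omega> = 0"
    by (simp add: K_form_diff lattice_elt_def)
  then have "A_to_K (a j) - A_to_K (b j) = 0" for j
    using assms unfolding Omega_def by blast
  then show "a = b"
    by (simp add: A_to_K_eq_iff fun_eq_iff)
qed simp

lemma lattice_elt_eq_0_iff:
  assumes "\<omega> \<in> Omega \<iota>"
  shows "lattice_elt \<iota> a \<omega> = 0 \<longleftrightarrow> a \<notin> nonzero_vectors"
  using lattice_elt_eq_iff[OF assms, of a "\<lambda>_. 0"] by (auto simp: fun_eq_iff)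

text \<open>
  On finite-dimensional \<open>K\<^sub>\<infinity>\<close>-subspaces all norms are equivalent, since \<open>K\<^sub>\<infinity>\<close> is complete.
\<close>

lemma independent_lower_bound:
  fixes w :: "'j \<Rightarrow> 'c"
  assumes "finite J" "\<And>l. (\<Sum>j\<in>J. \<iota> (l j) * w j) = 0 \<Longrightarrow> (\<forall>j\<in>J. l j = 0)"
  shows "\<exists>c>0. \<forall>l. \<forall>j\<in>J. c * absval_K (l j) \<le> absval (\<Sum>j\<in>J. \<iota> (l j) * w j)"
  using assms
proof induction
  case empty
  then show ?case by (intro exI[of _ 1]) auto
next
  case (insert i J)
  have indep: "\<forall>j\<in>J. l j = 0" if "(\<Sum>j\<in>J. \<iota> (l j) * w j) = 0" for l
  proof -
    have "(\<Sum>j\<in>insert i J. \<iota> ((l(i := 0)) j) * w j) = (\<Sum>j\<in>J. \<iota> (l j) * w j)"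
      using insert.hyps by (auto intro!: sum.cong)
    then have "\<forall>j\<in>insert i J. (l(i := 0)) j = 0"
      using that by (intro insert.prems) simp
    then show ?thesis
      using insert.hyps by (auto split: if_splits)
  qed
  have "\<exists>c>0. \<forall>l. \<forall>j\<in>J. c * absval_K (l j) \<le> absval (\<Sum>j\<in>J. \<iota> (l j) * w j)"
    by (rule insert.IH) (rule indep)
  then obtain c where c: "0 < c" "\<And>l j. j \<in> J \<Longrightarrow> c * absval_K (l j) \<le> absval (\<Sum>j\<in>J. \<iota> (l j) * w j)"
    by blast
  \<comment> \<open>The distance from \<open>w i\<close> to the span of the other vectors is
    positive. Otherwise approximating combinations have Cauchy coefficients by the induction
    hypothesis, and their limits give a relation with coefficient 1 at \<open>i\<close>.\<close>
  have "\<exists>d>0. \<forall>l. d \<le> absval (w i + (\<Sum>j\<in>J. \<iota> (l j) * w j))"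
  proof (rule ccontr)
    assume *: "\<not> ?thesis"
    have "\<exists>l. absval (w i + (\<Sum>j\<in>J. \<iota> (l j) * w j)) < 1 / real (Suc n)" for n
    proof -
      have "0 < 1 / real (Suc n)" by simp
      then show ?thesis using * by (meson not_le)
    qed
    then obtain L where L: "\<And>n. absval (w i + (\<Sum>j\<in>J. \<iota> (L n j) * w j)) < 1 / real (Suc n)"
      by metis
    have "\<exists>x. (\<lambda>n. absval_K (L n j - x)) \<longlonglongrightarrow> 0" if j: "j \<in> J" for j
    proof -
      have "\<exists>N. \<forall>n\<ge>N. \<forall>m\<ge>N. absval_K (L n j - L m j) < e" if "0 < e" for e
      proof -
        obtain N where N: "1 / real (Suc N) < c * e"
          using nat_approx_posE[of "c * e"] \<open>0 < c\<close> \<open>0 < e\<close> by auto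
        have "absval_K (L n j - L m j) < e" if nm: "N \<le> n" "N \<le> m" for n m
        proof -
          have less: "absval (w i + (\<Sum>j\<in>J. \<iota> (L k j) * w j)) \<le> 1 / real (Suc N)" if "N \<le> k" for k
          proof -
            have "1 / real (Suc k) \<le> 1 / real (Suc N)"
              using that by (simp add: frac_le)
            with L[of k] show ?thesis by linarith
          qed
          have "c * absval_K (L n j - L m j) \<le> absval (\<Sum>j\<in>J. \<iota> (L n j - L m j) * w j)"
            using c(2)[OF j, of "\<lambda>j. L n j - L m j"] by simp
          also have "(\<Sum>j\<in>J. \<iota> (L n j - L m j) * w j)
            = (w i + (\<Sum>j\<in>J. \<iota> (L n j) * w j)) - (w i + (\<Sum>j\<in>J. \<iota> (L m j) * w j))"
            by (simp add: hom_diff left_diff_distrib sum_subtractf)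
          also have "absval \<dots> \<le> 1 / real (Suc N)"
            by (intro absval_diff_le less nm)
          finally have "c * absval_K (L n j - L m j) < c * e"
            using N by linarith
          then show ?thesis
            using \<open>0 < c\<close> by simp
        qed
        then show ?thesis by blast
      qed
      then show ?thesis
        using K_complete[of "\<lambda>n. L n j"] by metis
    qed
    then obtain x where x: "\<And>j. j \<in> J \<Longrightarrow> (\<lambda>n. absval_K (L n j - x j)) \<longlonglongrightarrow> 0"
      by metis
    have "(\<lambda>n. \<iota> (L n j)) \<longlonglongrightarrow> \<iota> (x j)" if "j \<in> J" for j
      using x[OF that] by (simp add: tendsto_absval_iff absval_hom order_tendsto_iff flip: hom_diff)
    then have "(\<lambda>n. w i + (\<Sum>j\<in>J. \<iota> (L n j) * w j)) \<longlonglongrightarrow> w i + (\<Sum>j\<in>J. \<iota> (x j) * w j)"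
      by (intro tendsto_intros) auto
    moreover have "(\<lambda>n. w i + (\<Sum>j\<in>J. \<iota> (L n j) * w j)) \<longlonglongrightarrow> 0"
      unfolding tendsto_absval_iff
    proof safe
      fix e :: real
      assume "0 < e"
      then have "\<forall>\<^sub>F n in sequentially. 1 / real (Suc n) < e"
        using order_tendstoD(2)[OF LIMSEQ_inverse_real_of_nat] by (simp add: inverse_eq_divide)
      then show "\<forall>\<^sub>F n in sequentially. absval (w i + (\<Sum>j\<in>J. \<iota> (L n j) * w j) - 0) < e"
        by (rule eventually_mono) (metis L diff_zero order.strict_trans)
    qed
    ultimately have "w i + (\<Sum>j\<in>J. \<iota> (x j) * w j) = 0"
      by (rule LIMSEQ_unique)
    moreover have "(\<Sum>j\<in>J. \<iota> ((x(i := 1)) j) * w j) = (\<Sum>j\<in>J. \<iota> (x j) * w j)"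
      by (rule sum.cong) (use insert.hyps in auto)
    ultimately have "(\<Sum>j\<in>insert i J. \<iota> ((x(i := 1)) j) * w j) = 0"
      using insert.hyps by (simp add: hom_one)
    then have "\<forall>j\<in>insert i J. (x(i := 1)) j = 0"
      by (rule insert.prems)
    then show False by simp
  qed
  then obtain d where d: "0 < d" "\<And>l. d \<le> absval (w i + (\<Sum>j\<in>J. \<iota> (l j) * w j))"
    by blast
  have di: "d * absval_K (l i) \<le> absval (\<Sum>j\<in>insert i J. \<iota> (l j) * w j)" for l
  proof (cases "l i = 0")
    case False
    have "(\<Sum>j\<in>insert i J. \<iota> (l j) * w j) = \<iota> (l i) * (w i + (\<Sum>j\<in>J. \<iota> (l j / l i) * w j))"
      using insert.hyps False
      by (simp add: distrib_left sum_distrib_left mult.assoc[symmetric] flip: hom_mult)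
    then show ?thesis
      using mult_left_mono[OF d(2)[of "\<lambda>j. l j / l i"], of "absval_K (l i)"]
      by (simp add: absval_mult absval_hom mult.commute[of d])
  qed simp
  \<comment> \<open>With this \<open>M\<close> the \<open>i\<close>-th summand is at most
    \<open>M\<close> times the whole sum, by \<open>di\<close>; since \<open>M\<close> is at least
    1, so is the whole sum itself, and hence also the sum over \<open>J\<close>.\<close>
  define M where "M = max 1 (absval (w i) / d)"
  have M: "1 \<le> M" "absval (w i) \<le> M * d"
    using d(1) by (auto simp: M_def pos_divide_le_eq[symmetric])
  have cj: "(c / M) * absval_K (l j) \<le> absval (\<Sum>j\<in>insert i J. \<iota> (l j) * w j)" if "j \<in> J" for l j
  proof -
    let ?s = "\<Sum>j\<in>insert i J. \<iota> (l j) * w j"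
    have "absval (\<iota> (l i) * w i) \<le> absval_K (l i) * (M * d)"
      using M by (simp add: absval_mult absval_hom mult_left_mono)
    also have "\<dots> \<le> M * absval ?s"
      using di[of l] M by (simp add: mult.left_commute mult.commute[of "absval_K (l i)"])
    finally have 1: "absval (\<iota> (l i) * w i) \<le> M * absval ?s" .
    have 2: "absval ?s \<le> M * absval ?s"
      using mult_right_mono[OF M(1) absval_nonneg[of ?s]] by simp
    have "c * absval_K (l j) \<le> absval (\<Sum>j\<in>J. \<iota> (l j) * w j)"
      by (rule c(2)[OF that])
    also have "(\<Sum>j\<in>J. \<iota> (l j) * w j) = ?s - \<iota> (l i) * w i"
      using insert.hyps by simp
    also have "absval \<dots> \<le> M * absval ?s"
      using 1 2 by (rule absval_diff_le[rotated])
    finally show ?thesis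
      using M by (simp add: field_simps)
  qed
  show ?case
  proof (intro exI[of _ "min d (c / M)"] conjI allI ballI)
    show "0 < min d (c / M)" using d c M by auto
    fix l j
    assume "j \<in> insert i J"
    then consider "j = i" | "j \<in> J" by auto
    then show "min d (c / M) * absval_K (l j) \<le> absval (\<Sum>j\<in>insert i J. \<iota> (l j) * w j)"
    proof cases
      case 1
      have "min d (c / M) * absval_K (l j) \<le> d * absval_K (l j)"
        by (intro mult_right_mono) auto
      then show ?thesis using di[of l] 1 by simp
    next
      case 2
      have "min d (c / M) * absval_K (l j) \<le> (c / M) * absval_K (l j)"
        by (intro mult_right_mono) auto
      then show ?thesis using cj[OF 2, of l] by simp
    qed
  qed
qed

section \<open>Uniform lower bounds on \<open>Omega\<close> and on its affinoid pieces\<close>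

lemma Omega_imp_bounded_below:
  fixes \<omega> :: "'c ^ 'n::finite"
  assumes "\<omega> \<in> Omega \<iota>"
  obtains c where "0 < c" "K_form_bounded_below \<iota> c \<omega>"
proof -
  obtain c where c: "0 < c" "\<And>l j. c * absval_K (l j) \<le> absval (K_form \<iota> l \<omega>)"
    using independent_lower_bound[of UNIV "hcoord \<omega>"] assms
    unfolding K_form_def Omega_def by auto
  have "c * (MAX j. absval_K (l j)) \<le> absval (K_form \<iota> l \<omega>)" for l :: "'n option \<Rightarrow> 'f fls"
  proof -
    have "(MAX j. absval_K (l j)) \<in> range (\<lambda>j. absval_K (l j))"
      by (rule Max_in) auto
    then obtain j where "(MAX j. absval_K (l j)) = absval_K (l j)"
      by (rule imageE)
    then show ?thesis using c(2)[of l j] by simp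
  qed
  with c(1) that show ?thesis
    unfolding K_form_bounded_below_def by blast
qed

lemma bounded_below_imp_Omega:
  fixes \<omega> :: "'c ^ 'n::finite"
  assumes "0 < c" "K_form_bounded_below \<iota> c \<omega>"
  shows "\<omega> \<in> Omega \<iota>"
proof -
  have "l j = 0" if "K_form \<iota> l \<omega> = 0" for l :: "'n option \<Rightarrow> 'f fls" and j
  proof -
    have "c * (MAX j. absval_K (l j)) \<le> 0"
      using assms(2) that unfolding K_form_bounded_below_def by (metis absval_0)
    then have "(MAX j. absval_K (l j)) \<le> 0"
      using assms(1) by (simp add: mult_le_0_iff)
    moreover have "absval_K (l j) \<le> (MAX j. absval_K (l j))"
      by (rule Max_ge) auto
    ultimately have "absval_K (l j) = 0"
      using absval_K_nonneg[of "l j"] by linarith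
    then show ?thesis by simp
  qed
  then show ?thesis by (auto simp: Omega_def)
qed

text \<open>Moving \<open>\<omega>\<close> by less than \<open>c\<close> changes a form by strictly
  less than its guaranteed size, so its absolute value stays the same. In particular
  \<open>Omega\<close> contains the whole polydisc.\<close>

lemma bounded_below_polydisc:
  fixes \<omega> :: "'c ^ 'n::finite"
  assumes "0 < c" "K_form_bounded_below \<iota> c \<omega>" "x \<in> polydisc \<omega> c"
  shows "K_form_bounded_below \<iota> c x"
  unfolding K_form_bounded_below_def
proof
  fix l :: "'n option \<Rightarrow> 'f fls"
  let ?m = "MAX j. absval_K (l j)"
  have le: "absval_K (l j) \<le> ?m" for j
    by (rule Max_ge) auto
  have K: "c * ?m \<le> absval (K_form \<iota> l \<omega>)"
    using assms(2) by (simp add: K_form_bounded_below_def)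
  show "c * ?m \<le> absval (K_form \<iota> l x)"
  proof (cases "?m \<le> 0")
    case True
    then have "c * ?m \<le> 0" using assms(1) by (simp add: mult_le_0_iff)
    then show ?thesis using absval_nonneg[of "K_form \<iota> l x"] by linarith
  next
    case False
    define d where "d = (\<Sum>j\<in>UNIV. \<iota> (l j) * (hcoord x j - hcoord \<omega> j))"
    have eq: "K_form \<iota> l x = K_form \<iota> l \<omega> + d"
      by (simp add: K_form_def d_def right_diff_distrib sum_subtractf)
    \<comment> \<open>A maximum of finitely many numbers below \<open>c\<close>, hence itself
      strictly below \<open>c\<close>; the normalized coordinate contributes 0.\<close>
    define m where "m = (MAX j. absval (hcoord x j - hcoord \<omega> j))"
    have m: "absval (hcoord x j - hcoord \<omega> j) \<le> m" for j
      unfolding m_def by (rule Max_ge) auto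
    have "absval (hcoord x j - hcoord \<omega> j) < c" for j
      using assms(1,3) by (cases j) (auto simp: hcoord_def polydisc_def)
    then have "m < c"
      by (simp add: m_def)
    have "absval d \<le> ?m * m"
      unfolding d_def
    proof (rule absval_sum_le)
      show "absval (\<iota> (l j) * (hcoord x j - hcoord \<omega> j)) \<le> ?m * m" for j
        unfolding absval_mult absval_hom using le[of j] m[of j] False
        by (intro mult_mono) (simp_all only: absval_nonneg not_le less_imp_le)
      have "0 \<le> m" using m[of None] by (metis absval_nonneg order_trans)
      moreover have "0 \<le> ?m" using False by linarith
      ultimately show "0 \<le> ?m * m" by (rule mult_nonneg_nonneg[rotated])
    qed
    also have "\<dots> < ?m * c"
      using False \<open>m < c\<close> by (intro mult_strict_left_mono) (simp_all only: not_le)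
    finally have "absval d < absval (K_form \<iota> l \<omega>)"
      using K by (simp add: mult.commute)
    then have "absval (K_form \<iota> l x) = absval (K_form \<iota> l \<omega>)"
      unfolding eq by (rule absval_add_eq)
    with K show ?thesis by simp
  qed
qed

text \<open>Dividing a form by its largest coefficient makes it unimodular, and the largest
  homogeneous coordinate has size at least 1 because the last one is 1. The constant does not depend
  on \<open>\<omega>\<close>.\<close>

lemma Omega_aff_bounded_below:
  fixes \<omega> :: "'c ^ 'n::finite"
  assumes "\<omega> \<in> Omega_aff \<iota> n"
  shows "K_form_bounded_below \<iota> (1 / real CARD('f) ^ n) \<omega>"
  unfolding K_form_bounded_below_def
proof
  fix l :: "'n option \<Rightarrow> 'f fls"
  let ?m = "MAX j. absval_K (l j)"
  have le: "absval_K (l j) \<le> ?m" for j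
    by (rule Max_ge) auto
  have "?m \<in> range (\<lambda>j. absval_K (l j))"
    by (rule Max_in) auto
  then obtain j0 where j0: "?m = absval_K (l j0)"
    by (rule imageE)
  show "1 / real CARD('f) ^ n * ?m \<le> absval (K_form \<iota> l \<omega>)"
  proof (cases "l j0 = 0")
    case True
    then show ?thesis using j0 by simp
  next
    case False
    define l' where "l' = (\<lambda>j. inverse (l j0) * l j)"
    have inv: "absval_K (inverse (l j0)) = inverse ?m"
      by (metis absval_hom absval_inverse hom_inverse j0)
    have pos: "0 < ?m"
      using False j0 by (metis absval_K_eq_0_iff absval_K_nonneg order_less_le)
    have "(MAX j. absval_K (l' j)) = 1"
    proof (rule Max_eqI)
      show "y \<le> 1" if "y \<in> range (\<lambda>j. absval_K (l' j))" for y
      proof -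
        obtain j where j: "y = absval_K (l' j)" using \<open>y \<in> _\<close> by auto
        have "inverse ?m * absval_K (l j) \<le> inverse ?m * ?m"
          using pos le by (intro mult_left_mono) auto
        then show ?thesis using pos by (simp add: j l'_def absval_K_mult inv)
      qed
      have "absval_K (l' j0) = 1"
        using False by (simp add: l'_def absval_K_def)
      then show "1 \<in> range (\<lambda>j. absval_K (l' j))"
        by (metis rangeI)
    qed simp
    then have "(MAX j. absval (hcoord \<omega> j)) / real CARD('f) ^ n \<le> absval (K_form \<iota> l' \<omega>)"
      using assms by (simp add: Omega_aff_def)
    moreover have "1 \<le> (MAX j. absval (hcoord \<omega> j))"
    proof -
      have "absval (hcoord \<omega> None) \<le> (MAX j. absval (hcoord \<omega> j))"
        by (rule Max_ge) auto
      then show ?thesis by (simp add: hcoord_def)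
    qed
    then have "1 / real CARD('f) ^ n \<le> (MAX j. absval (hcoord \<omega> j)) / real CARD('f) ^ n"
      by (intro divide_right_mono) auto
    moreover have "K_form \<iota> l' \<omega> = inverse (\<iota> (l j0)) * K_form \<iota> l \<omega>"
      by (simp add: K_form_def l'_def hom_mult hom_inverse sum_distrib_left mult.assoc)
    then have "absval (K_form \<iota> l' \<omega>) = inverse ?m * absval (K_form \<iota> l \<omega>)"
      by (simp add: absval_mult absval_inverse absval_hom j0)
    ultimately have "1 / real CARD('f) ^ n \<le> inverse ?m * absval (K_form \<iota> l \<omega>)"
      by linarith
    then have "1 / real CARD('f) ^ n * ?m \<le> inverse ?m * absval (K_form \<iota> l \<omega>) * ?m"
      using pos by (intro mult_right_mono) auto
    then show ?thesis using pos by (simp add: field_simps)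
  qed
qed

lemma lattice_elt_ge:
  assumes "K_form_bounded_below \<iota> c \<omega>"
  shows "c * height a \<le> absval (lattice_elt \<iota> a \<omega>)"
  using assms by (simp add: K_form_bounded_below_def lattice_elt_def height_def)

end

subsection \<open>Expansion of the lattice exponential\<close>

text \<open>\<open>M\<close>, the product of all factors that are at least 1, bounds every finite
  product. If some factor is below both 1 and \<open>e / M\<close>, the product is below
  \<open>e\<close>; so only subsets of the finite set \<open>G\<close> can reach
  \<open>e\<close>.\<close>

lemma null_family_prod:
  fixes b :: "'a \<Rightarrow> real"
  assumes b: "null_family L b" and nonneg: "\<And>a. a \<in> L \<Longrightarrow> 0 \<le> b a"
  shows "null_family (Fpow L) (\<lambda>S. \<Prod>a\<in>S. b a)"
  unfolding null_family_def
proof safe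
  fix e :: real
  assume e: "0 < e"
  define F where "F = {a\<in>L. 1 \<le> b a}"
  define M where "M = (\<Prod>a\<in>F. b a)"
  have F: "finite F" "F \<subseteq> L"
    using b by (auto simp: null_family_def F_def)
  have M: "1 \<le> M"
    unfolding M_def by (rule prod_ge_1) (simp add: F_def)
  define G where "G = {a\<in>L. min 1 (e / M) \<le> b a}"
  have "0 < min 1 (e / M)"
    using e M by auto
  then have G: "finite G"
    using b by (auto simp: null_family_def G_def)
  have "S \<subseteq> G" if S: "S \<in> Fpow L" "e \<le> (\<Prod>a\<in>S. b a)" for S
  proof
    fix a
    assume a: "a \<in> S"
    show "a \<in> G"
    proof (rule ccontr)
      assume "a \<notin> G"
      with a S have ba: "a \<in> L" "b a < 1" "b a < e / M" "finite S" "S \<subseteq> L"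
        by (auto simp: G_def Fpow_def)
      then have "a \<notin> F" by (simp add: F_def)
      have "(\<Prod>a\<in>S. b a) = b a * (\<Prod>a\<in>S - {a}. b a)"
        using a ba by (simp add: prod.remove)
      also have "(\<Prod>a\<in>S - {a}. b a) = (\<Prod>a\<in>(S - {a}) \<inter> F. b a) * (\<Prod>a\<in>(S - {a}) - F. b a)"
        using ba by (subst prod.union_disjoint[symmetric]) (auto intro: prod.cong)
      also have "\<dots> \<le> M * 1"
      proof (intro mult_mono)
        show "(\<Prod>a\<in>(S - {a}) \<inter> F. b a) \<le> M"
          unfolding M_def by (rule prod_mono2) (use F in \<open>auto simp: F_def\<close>)
        show "(\<Prod>a\<in>(S - {a}) - F. b a) \<le> 1"
          by (rule prod_le_1) (use ba nonneg in \<open>auto simp: F_def\<close>)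
        show "0 \<le> (\<Prod>a\<in>(S - {a}) - F. b a)"
          by (rule prod_nonneg) (use ba nonneg in auto)
      qed (use M in auto)
      finally have "(\<Prod>a\<in>S. b a) \<le> b a * M"
        using nonneg[OF ba(1)] by (simp add: mult_left_mono)
      also have "\<dots> < e"
        using ba(3) M by (simp add: pos_less_divide_eq)
      finally show False using S by simp
    qed
  qed
  then have "{S \<in> Fpow L. e \<le> (\<Prod>a\<in>S. b a)} \<subseteq> Pow G"
    by auto
  then show "finite {S \<in> Fpow L. e \<le> (\<Prod>a\<in>S. b a)}"
    using G by (metis finite_Pow_iff finite_subset)
qed

text \<open>Index set for the \<open>n\<close>-th elementary symmetric function of the numbers
  \<open>- 1 / \<lambda>\<close>, with \<open>\<lambda>\<close> running through the nonzero
  periods.\<close>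

definition vector_sets :: "nat \<Rightarrow> ('n::finite option \<Rightarrow> 'f::{field,finite} poly) set set" where
  "vector_sets n = {S \<in> Fpow nonzero_vectors. card S = n}"

text \<open>The coefficient of \<open>X\<^bsup>n+1\<^esup>\<close> in the exponential function of the period lattice.\<close>

definition exp_coefficient ::
  "('f::{field,finite} fls \<Rightarrow> 'c::complete_valued_field) \<Rightarrow> nat \<Rightarrow> 'c ^ 'n::finite \<Rightarrow> 'c" where
  "exp_coefficient \<iota> n \<omega> = (\<Sum>\<^sub>\<infinity>S\<in>vector_sets n. \<Prod>a\<in>S. - 1 / lattice_elt \<iota> a \<omega>)"

text \<open>A partial product over \<open>T\<close> expands into a sum over \<open>Pow T\<close>.
  This cofinality turns summability over all finite subsets into convergence of the infinite
  product.\<close>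

lemma filterlim_Pow_finite_subsets_at_top:
  "filterlim Pow (finite_subsets_at_top (Fpow L)) (finite_subsets_at_top L)"
  unfolding filterlim_iff eventually_finite_subsets_at_top
proof safe
  fix P and X :: "'a set set"
  assume X: "finite X" "X \<subseteq> Fpow L" "\<forall>Y. finite Y \<and> X \<subseteq> Y \<and> Y \<subseteq> Fpow L \<longrightarrow> P Y"
  have "finite (\<Union>X)" "\<Union>X \<subseteq> L"
    using X(1,2) by (auto simp: Fpow_def)
  moreover have "P (Pow Y)" if Y: "finite Y" "\<Union>X \<subseteq> Y" "Y \<subseteq> L" for Y
  proof -
    have "Pow Y \<subseteq> Fpow L"
      using Y(3) by (auto simp: Fpow_def dest: finite_subset[OF _ Y(1)])
    moreover have "X \<subseteq> Pow Y" using Y(2) by blast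
    ultimately show ?thesis
      using X(3)[rule_format, of "Pow Y"] Y(1) by simp
  qed
  ultimately show "\<exists>X. finite X \<and> X \<subseteq> L \<and> (\<forall>Y. finite Y \<and> X \<subseteq> Y \<and> Y \<subseteq> L \<longrightarrow> P (Pow Y))"
    by (intro exI[of _ "\<Union>X"]) simp
qed

context completed_algebraic_closure
begin

text \<open>Bound for the inverse of the period with coefficients \<open>a\<close>. It depends on
  the point only through \<open>c\<close> and so serves a whole polydisc or affinoid at
  once.\<close>

definition weight :: "real \<Rightarrow> ('n::finite option \<Rightarrow> 'f poly) \<Rightarrow> real" where
  "weight c a = 1 / (c * height a)"

lemma weight_nonneg:
  fixes a :: "'n::finite option \<Rightarrow> 'f poly"
  assumes "0 < c" "a \<in> nonzero_vectors"
  shows "0 \<le> weight c a"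
  using assms(1) height_ge_1[OF assms(2)] unfolding weight_def
  by (intro divide_nonneg_nonneg mult_nonneg_nonneg) linarith+

lemma null_family_weight:
  assumes "0 < c" "0 < R"
  shows "null_family nonzero_vectors (\<lambda>a :: 'n::finite option \<Rightarrow> 'f poly. R * weight c a)"
  unfolding null_family_def
proof safe
  fix e :: real
  assume e: "0 < e"
  have "{a \<in> nonzero_vectors. e \<le> R * weight c a} \<subseteq> {a :: 'n option \<Rightarrow> 'f poly. height a \<le> R / (c * e)}"
  proof
    fix a :: "'n option \<Rightarrow> 'f poly"
    assume a: "a \<in> {a \<in> nonzero_vectors. e \<le> R * weight c a}"
    then have "1 \<le> height a"
      using height_ge_1 by blast
    with a assms e show "a \<in> {a. height a \<le> R / (c * e)}"
      by (simp add: weight_def field_simps)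
  qed
  then show "finite {a :: 'n option \<Rightarrow> 'f poly \<in> nonzero_vectors. e \<le> R * weight c a}"
    by (rule finite_subset) (rule finite_height_le)
qed

lemma null_family_weight_prod:
  assumes "0 < c" "0 < R"
  shows "null_family (Fpow nonzero_vectors) (\<lambda>S :: ('n::finite option \<Rightarrow> 'f poly) set. \<Prod>a\<in>S. R * weight c a)"
  using assms by (intro null_family_prod null_family_weight mult_nonneg_nonneg weight_nonneg) auto

lemma absval_inverse_lattice_elt_le:
  fixes \<omega> :: "'c ^ 'n::finite"
  assumes "0 < c" "K_form_bounded_below \<iota> c \<omega>" "a \<in> nonzero_vectors"
  shows "absval (1 / lattice_elt \<iota> a \<omega>) \<le> weight c a"
proof -
  have "0 < c * height a"
    using assms(1) height_ge_1[OF assms(3)] by (intro mult_pos_pos) linarith+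
  then show ?thesis
    using lattice_elt_ge[OF assms(2), of a] by (simp add: weight_def absval_divide frac_le)
qed

text \<open>Within radius \<open>c / 2\<close> the period moves by at most half its size at the
  centre. Halving the radius supplies the ratio \<open>\<theta> = 1 / 2\<close> for the geometric
  series.\<close>

lemma bounded_analytic_inverse_lattice_elt:
  fixes \<omega> :: "'c ^ 'n::finite"
  assumes "0 < c" "K_form_bounded_below \<iota> c \<omega>" "a \<in> nonzero_vectors"
  shows "bounded_analytic \<omega> (c / 2) (weight c a) (\<lambda>x. - 1 / lattice_elt \<iota> a x)"
proof -
  define u where "u = (\<lambda>x. \<Sum>i\<in>UNIV. \<iota> (A_to_K (a (Some i))) * (x $ i - \<omega> $ i))"
  have ge: "c * height a \<le> absval (lattice_elt \<iota> a \<omega>)"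
    by (rule lattice_elt_ge[OF assms(2)])
  have pos: "0 < c * height a"
    using assms(1) height_ge_1[OF assms(3)] by (intro mult_pos_pos) linarith+
  have c2: "0 < c / 2" using assms(1) by simp
  have eq: "lattice_elt \<iota> a x = lattice_elt \<iota> a \<omega> + u x" for x
  proof -
    have "lattice_elt \<iota> a x - lattice_elt \<iota> a \<omega> = (\<Sum>j\<in>UNIV. \<iota> (A_to_K (a j)) * (hcoord x j - hcoord \<omega> j))"
      by (simp add: lattice_elt_def K_form_def right_diff_distrib sum_subtractf)
    also have "\<dots> = u x"
      by (simp add: UNIV_option_conv sum.reindex hcoord_def u_def)
    finally show ?thesis by (simp add: algebra_simps)
  qed
  have "bounded_analytic \<omega> (c / 2) ((1 / 2) * absval (lattice_elt \<iota> a \<omega>)) u"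
    unfolding u_def
  proof (rule bounded_analytic_sum[OF c2])
    fix i
    have "absval (\<iota> (A_to_K (a (Some i)))) * (c / 2) \<le> height a * (c / 2)"
      unfolding absval_hom using c2 absval_K_le_height by (intro mult_right_mono) auto
    also have "\<dots> \<le> (1 / 2) * absval (lattice_elt \<iota> a \<omega>)"
      using ge by (simp add: mult.commute)
    finally show "bounded_analytic \<omega> (c / 2) ((1 / 2) * absval (lattice_elt \<iota> a \<omega>))
        (\<lambda>x. \<iota> (A_to_K (a (Some i))) * (x $ i - \<omega> $ i))"
      using bounded_analytic_coord[OF c2] bounded_analytic_mono by blast
  qed auto
  then have "bounded_analytic \<omega> (c / 2) (1 / absval (lattice_elt \<iota> a \<omega>)) (\<lambda>x. 1 / (lattice_elt \<iota> a \<omega> + u x))"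
    by (rule bounded_analytic_inverse[OF c2]) (use ge pos in auto)
  from bounded_analytic_mult[OF c2 bounded_analytic_const[OF c2, of \<omega> "- 1"] this]
  have "bounded_analytic \<omega> (c / 2) (1 / absval (lattice_elt \<iota> a \<omega>)) (\<lambda>x. - 1 / lattice_elt \<iota> a x)"
    by (simp add: eq[symmetric])
  moreover have "1 / absval (lattice_elt \<iota> a \<omega>) \<le> weight c a"
    unfolding weight_def using ge pos by (intro frac_le) auto
  ultimately show ?thesis
    using bounded_analytic_mono by blast
qed

lemma bounded_analytic_exp_coefficient_term:
  fixes \<omega> :: "'c ^ 'n::finite"
  assumes "0 < c" "K_form_bounded_below \<iota> c \<omega>" "S \<in> vector_sets n"
  shows "bounded_analytic \<omega> (c / 2) (\<Prod>a\<in>S. weight c a) (\<lambda>x. \<Prod>a\<in>S. - 1 / lattice_elt \<iota> a x)"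
  using assms by (intro bounded_analytic_prod bounded_analytic_inverse_lattice_elt)
    (auto simp: vector_sets_def Fpow_def)

lemma null_family_vector_sets:
  assumes "0 < c"
  shows "null_family (vector_sets n) (\<lambda>S :: ('n::finite option \<Rightarrow> 'f poly) set. \<Prod>a\<in>S. weight c a)"
  using null_family_weight_prod[OF assms zero_less_one]
  by (rule null_family_mono) (auto simp: vector_sets_def)

text \<open>Scaling each of the \<open>n\<close> factors by \<open>R\<close> leaves a null, hence
  bounded, family. As \<open>R\<close> is arbitrary, this is the decay that makes the exponential
  entire.\<close>

lemma weight_prod_bound:
  assumes "0 < c" "0 < R"
  obtains M where "0 < M"
    "\<And>n (S :: ('n::finite option \<Rightarrow> 'f poly) set). S \<in> vector_sets n \<Longrightarrow> (\<Prod>a\<in>S. weight c a) \<le> M / R ^ n"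
proof -
  obtain M where M: "0 < M" "\<And>S :: ('n option \<Rightarrow> 'f poly) set. S \<in> Fpow nonzero_vectors \<Longrightarrow> (\<Prod>a\<in>S. R * weight c a) \<le> M"
    using null_family_bounded[OF null_family_weight_prod[OF assms, where 'n = 'n]] by metis
  show ?thesis
  proof
    fix n and S :: "('n option \<Rightarrow> 'f poly) set"
    assume S: "S \<in> vector_sets n"
    then have "R ^ n * (\<Prod>a\<in>S. weight c a) \<le> M"
      using M(2)[of S] by (simp add: vector_sets_def prod.distrib)
    then show "(\<Prod>a\<in>S. weight c a) \<le> M / R ^ n"
      using assms(2) by (simp add: field_simps)
  qed (rule M(1))
qed

lemma bounded_analytic_exp_coefficient:
  fixes \<omega> :: "'c ^ 'n::finite"
  assumes "0 < c" "K_form_bounded_below \<iota> c \<omega>" "0 < R"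
  obtains M where "0 < M" "\<And>n. bounded_analytic \<omega> (c / 2) (M / R ^ n) (exp_coefficient \<iota> n)"
proof -
  obtain M where M: "0 < M"
    "\<And>n (S :: ('n::finite option \<Rightarrow> 'f poly) set). S \<in> vector_sets n \<Longrightarrow> (\<Prod>a\<in>S. weight c a) \<le> M / R ^ n"
    using weight_prod_bound[OF assms(1,3)] by blast
  have "bounded_analytic \<omega> (c / 2) (M / R ^ n) (exp_coefficient \<iota> n)" for n
    unfolding exp_coefficient_def[abs_def]
  proof (rule bounded_analytic_infsum)
    show "null_family (vector_sets n) (\<lambda>S :: ('n option \<Rightarrow> 'f poly) set. \<Prod>a\<in>S. weight c a)"
      by (rule null_family_vector_sets[OF assms(1)])
  qed (use assms M bounded_analytic_exp_coefficient_term in auto)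
  with M(1) that show ?thesis by blast
qed

lemma exp_coefficient_has_sum:
  fixes \<omega> :: "'c ^ 'n::finite"
  assumes "0 < c" "K_form_bounded_below \<iota> c \<omega>"
  shows "((\<lambda>S. \<Prod>a\<in>S. - 1 / lattice_elt \<iota> a \<omega>) has_sum exp_coefficient \<iota> n \<omega>) (vector_sets n)"
  unfolding exp_coefficient_def
proof (rule ultrametric_has_sum_infsum[OF null_family_vector_sets[OF assms(1)]])
  fix S :: "('n option \<Rightarrow> 'f poly) set"
  assume "S \<in> vector_sets n"
  then show "absval (\<Prod>a\<in>S. - 1 / lattice_elt \<iota> a \<omega>) \<le> (\<Prod>a\<in>S. weight c a)"
    using bounded_analytic_absval_le[OF bounded_analytic_exp_coefficient_term[OF assms]] assms(1) by simp
qed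

lemma exp_coefficient_0:
  fixes \<omega> :: "'c ^ 'n::finite"
  shows "exp_coefficient \<iota> 0 \<omega> = 1"
proof -
  have "vector_sets 0 = {{} :: ('n option \<Rightarrow> 'f poly) set}"
    by (auto simp: vector_sets_def Fpow_def)
  then show ?thesis by (simp add: exp_coefficient_def)
qed

section \<open>From the infinite product to the power series\<close>

lemma period_lattice_eq:
  fixes \<omega> :: "'c ^ 'n::finite"
  assumes "\<omega> \<in> Omega \<iota>"
  shows "period_lattice \<iota> \<omega> - {0} = (\<lambda>a. lattice_elt \<iota> a \<omega>) ` nonzero_vectors"
proof -
  have "period_lattice \<iota> \<omega> = range (\<lambda>a. lattice_elt \<iota> a \<omega>)"
    by (simp add: period_lattice_def lattice_elt_def)
  then show ?thesis
    using lattice_elt_eq_0_iff[OF assms] by (auto simp del: mem_Collect_eq)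
qed

lemma exp_lattice_sums:
  fixes \<omega> :: "'c ^ 'n::finite"
  assumes "\<omega> \<in> Omega \<iota>"
  shows "(\<lambda>n. exp_coefficient \<iota> n \<omega> * z ^ Suc n) sums exp_lattice (period_lattice \<iota> \<omega>) z"
proof -
  obtain c where c: "0 < c" "K_form_bounded_below \<iota> c \<omega>"
    using Omega_imp_bounded_below[OF assms] .
  let ?L = "nonzero_vectors :: ('n option \<Rightarrow> 'f poly) set"
  define f where "f = (\<lambda>S. \<Prod>a\<in>S. - z / lattice_elt \<iota> a \<omega>)"
  \<comment> \<open>The 1 keeps \<open>R\<close> positive when \<open>z = 0\<close>.\<close>
  define R where "R = max 1 (absval z)"
  define s where "s = infsum f (Fpow ?L)"
  have R: "0 < R" "absval z \<le> R" by (auto simp: R_def)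
  have s: "(f has_sum s) (Fpow ?L)"
    unfolding s_def
  proof (rule ultrametric_has_sum_infsum[OF null_family_weight_prod[OF c(1) R(1)]])
    fix S assume S: "S \<in> Fpow ?L"
    show "absval (f S) \<le> (\<Prod>a\<in>S. R * weight c a)"
      unfolding f_def absval_prod
    proof (intro prod_mono conjI)
      fix a assume "a \<in> S"
      then have "absval (1 / lattice_elt \<iota> a \<omega>) \<le> weight c a"
        using S by (intro absval_inverse_lattice_elt_le c) (auto simp: Fpow_def)
      then have "absval z * absval (1 / lattice_elt \<iota> a \<omega>) \<le> R * weight c a"
        using R by (intro mult_mono) auto
      then show "absval (- z / lattice_elt \<iota> a \<omega>) \<le> R * weight c a"
        by (simp add: absval_divide)
    qed simp
  qed
  have "((\<lambda>T. sum f (Pow T)) \<longlongrightarrow> s) (finite_subsets_at_top ?L)"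
    using s unfolding has_sum_def
    by (rule filterlim_compose[OF _ filterlim_Pow_finite_subsets_at_top])
  then have "((\<lambda>T. \<Prod>a\<in>T. 1 - z / lattice_elt \<iota> a \<omega>) \<longlongrightarrow> s) (finite_subsets_at_top ?L)"
  proof (rule Lim_transform_eventually)
    show "\<forall>\<^sub>F T in finite_subsets_at_top ?L. sum f (Pow T) = (\<Prod>a\<in>T. 1 - z / lattice_elt \<iota> a \<omega>)"
    proof (rule eventually_finite_subsets_at_top_weakI)
      fix T :: "('n option \<Rightarrow> 'f poly) set"
      assume "finite T"
      then show "sum f (Pow T) = (\<Prod>a\<in>T. 1 - z / lattice_elt \<iota> a \<omega>)"
        using prod_add[of T "\<lambda>a. - z / lattice_elt \<iota> a \<omega>" "\<lambda>_. 1"] by (simp add: f_def)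
    qed
  qed
  moreover have inj: "inj_on (\<lambda>a. lattice_elt \<iota> a \<omega>) X" for X
    using lattice_elt_eq_iff[OF assms] by (auto simp: inj_on_def)
  ultimately have "((\<lambda>S. \<Prod>l\<in>S. 1 - z / l) \<longlongrightarrow> s) (finite_subsets_at_top (period_lattice \<iota> \<omega> - {0}))"
    unfolding period_lattice_eq[OF assms] filtermap_image_finite_subsets_at_top[OF inj, symmetric] filterlim_filtermap
    by (simp add: prod.reindex[OF inj])
  then have "Lim (finite_subsets_at_top (period_lattice \<iota> \<omega> - {0})) (\<lambda>S. \<Prod>l\<in>S. 1 - z / l) = s"
    by (intro tendsto_Lim) auto
  then have exp: "exp_lattice (period_lattice \<iota> \<omega>) z = z * s"
    by (simp add: exp_lattice_def)
  \<comment> \<open>Grouping the finite sets by cardinality collects the terms with the same power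
    of \<open>z\<close>.\<close>
  have "bij_betw snd (Sigma UNIV vector_sets) (Fpow ?L)"
    by (rule bij_betwI[of _ _ _ "\<lambda>S. (card S, S)"]) (auto simp: vector_sets_def)
  then have "((\<lambda>p. f (snd p)) has_sum s) (Sigma UNIV vector_sets)"
    using s by (simp add: has_sum_reindex_bij_betw)
  then have "((\<lambda>n. z ^ n * exp_coefficient \<iota> n \<omega>) has_sum s) UNIV"
  proof (rule has_sum_Sigma')
    fix n
    have "f S = z ^ n * (\<Prod>a\<in>S. - 1 / lattice_elt \<iota> a \<omega>)" if "S \<in> vector_sets n" for S
    proof -
      have "f S = (\<Prod>a\<in>S. z * (- 1 / lattice_elt \<iota> a \<omega>))"
        unfolding f_def by (intro prod.cong) auto
      also have "\<dots> = z ^ card S * (\<Prod>a\<in>S. - 1 / lattice_elt \<iota> a \<omega>)"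
        by (simp only: prod.distrib prod_constant)
      finally show ?thesis using that by (simp add: vector_sets_def)
    qed
    moreover have "((\<lambda>S. z ^ n * (\<Prod>a\<in>S. - 1 / lattice_elt \<iota> a \<omega>)) has_sum z ^ n * exp_coefficient \<iota> n \<omega>) (vector_sets n)"
      by (intro has_sum_cmult_right exp_coefficient_has_sum[OF c])
    ultimately show "((\<lambda>S. f (snd (n, S))) has_sum z ^ n * exp_coefficient \<iota> n \<omega>) (vector_sets n)"
      by (simp cong: has_sum_cong)
  qed
  then have "((\<lambda>n. z * (z ^ n * exp_coefficient \<iota> n \<omega>)) has_sum z * s) UNIV"
    by (rule has_sum_cmult_right)
  then have "(\<lambda>n. z * (z ^ n * exp_coefficient \<iota> n \<omega>)) sums (z * s)"
    by (rule has_sum_imp_sums)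
  then show ?thesis
    unfolding exp by (simp add: mult_ac)
qed

text \<open>Every partial product that includes the period itself has a factor zero.\<close>

lemma exp_lattice_period:
  fixes \<omega> :: "'c ^ 'n::finite"
  assumes "\<omega> \<in> Omega \<iota>" "a \<in> nonzero_vectors"
  shows "exp_lattice (period_lattice \<iota> \<omega>) (lattice_elt \<iota> a \<omega>) = 0"
proof -
  let ?l = "lattice_elt \<iota> a \<omega>"
  have l: "?l \<in> period_lattice \<iota> \<omega> - {0}"
    using assms period_lattice_eq[OF assms(1)] by blast
  have "\<forall>\<^sub>F S in finite_subsets_at_top (period_lattice \<iota> \<omega> - {0}). 0 = (\<Prod>l\<in>S. 1 - ?l / l)"
    unfolding eventually_finite_subsets_at_top
  proof (intro exI[of _ "{?l}"] conjI allI impI)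
    fix S assume S: "finite S \<and> {?l} \<subseteq> S \<and> S \<subseteq> period_lattice \<iota> \<omega> - {0}"
    have "1 - ?l / ?l = 0" using l by simp
    then show "0 = (\<Prod>l\<in>S. 1 - ?l / l)"
      using S by (intro prod_zero[symmetric]) auto
  qed (use l in auto)
  then have "((\<lambda>S. \<Prod>l\<in>S. 1 - ?l / l) \<longlongrightarrow> 0) (finite_subsets_at_top (period_lattice \<iota> \<omega> - {0}))"
    by (rule Lim_transform_eventually[OF tendsto_const])
  then have "Lim (finite_subsets_at_top (period_lattice \<iota> \<omega> - {0})) (\<lambda>S. \<Prod>l\<in>S. 1 - ?l / l) = 0"
    by (intro tendsto_Lim) auto
  then show ?thesis by (simp add: exp_lattice_def)
qed

text \<open>A finite family of finite sets involves only finitely many vectors, all of which lie in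
  one level. The levels are therefore cofinal, and polynomial identities proved at each level pass
  to the limit.\<close>

lemma exp_coefficient_limit:
  fixes \<omega> :: "'c ^ 'n::finite"
  assumes "\<omega> \<in> Omega \<iota>"
  shows "(\<lambda>N. \<Sum>S | S \<subseteq> bounded_degree N \<inter> nonzero_vectors \<and> card S = n. \<Prod>a\<in>S. - 1 / lattice_elt \<iota> a \<omega>)
    \<longlonglongrightarrow> exp_coefficient \<iota> n \<omega>"
proof -
  let ?V = "\<lambda>N. bounded_degree N \<inter> nonzero_vectors :: ('n option \<Rightarrow> 'f poly) set"
  obtain c where c: "0 < c" "K_form_bounded_below \<iota> c \<omega>"
    using Omega_imp_bounded_below[OF assms] .
  have "filterlim (\<lambda>N. {S. S \<subseteq> ?V N \<and> card S = n}) (finite_subsets_at_top (vector_sets n)) sequentially"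
    unfolding filterlim_iff eventually_finite_subsets_at_top
  proof safe
    fix P and X :: "('n option \<Rightarrow> 'f poly) set set"
    assume X: "finite X" "X \<subseteq> vector_sets n" "\<forall>Y. finite Y \<and> X \<subseteq> Y \<and> Y \<subseteq> vector_sets n \<longrightarrow> P Y"
    have "finite (\<Union>X)"
      using X(1,2) by (auto simp: vector_sets_def Fpow_def)
    then obtain N where N: "\<Union>X \<subseteq> bounded_degree N"
      using finite_subset_bounded_degree by blast
    have "P {S. S \<subseteq> ?V M \<and> card S = n}" if "N \<le> M" for M
    proof (intro X(3)[rule_format] conjI)
      have fin: "finite (?V M)" by simp
      then show "finite {S. S \<subseteq> ?V M \<and> card S = n}"
        by (rule rev_finite_subset[OF finite_Pow_iff[THEN iffD2]]) auto
      show "{S. S \<subseteq> ?V M \<and> card S = n} \<subseteq> vector_sets n"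
        using finite_subset[OF _ fin] unfolding vector_sets_def Fpow_def by blast
      have "\<Union>X \<subseteq> bounded_degree M"
        using N bounded_degree_mono[OF that] by (rule order_trans)
      moreover have "S \<subseteq> nonzero_vectors \<and> card S = n" if "S \<in> X" for S
        using X(2) that unfolding vector_sets_def Fpow_def by blast
      ultimately show "X \<subseteq> {S. S \<subseteq> ?V M \<and> card S = n}"
        by blast
    qed
    then show "\<forall>\<^sub>F N in sequentially. P {S. S \<subseteq> ?V N \<and> card S = n}"
      unfolding eventually_sequentially by blast
  qed
  with exp_coefficient_has_sum[OF c, of n] show ?thesis
    unfolding has_sum_def by (rule filterlim_compose)
qed

end

subsection \<open>Exponentials of finite subspaces\<close>

text \<open>
  For \<open>vs\<close> linearly independent over \<open>\<F>\<close>, \<open>subspace_exp CARD('f) vs\<close> is the exponential function of the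
  \<open>\<F>\<close>-span of \<open>vs\<close>; the recursion adds one basis vector at a time. \<open>subspace_coeff\<close> are its coefficients.
\<close>

fun subspace_exp :: "nat \<Rightarrow> 'c::field list \<Rightarrow> 'c \<Rightarrow> 'c" where
  "subspace_exp q [] x = x"
| "subspace_exp q (v # vs) x = subspace_exp q vs x - subspace_exp q vs x ^ q / subspace_exp q vs v ^ (q - 1)"

fun subspace_coeff :: "nat \<Rightarrow> 'c::field list \<Rightarrow> nat \<Rightarrow> 'c" where
  "subspace_coeff q [] i = (if i = 0 then 1 else 0)"
| "subspace_coeff q (v # vs) 0 = subspace_coeff q vs 0"
| "subspace_coeff q (v # vs) (Suc i) =
     subspace_coeff q vs (Suc i) - subspace_coeff q vs i ^ q / subspace_exp q vs v ^ (q - 1)"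

lemma subspace_coeff_0 [simp]: "subspace_coeff q vs 0 = 1"
  by (induction vs) auto

lemma subspace_coeff_eq_0: "1 < q \<Longrightarrow> length vs < i \<Longrightarrow> subspace_coeff q vs i = 0"
proof (induction vs arbitrary: i)
  case (Cons v vs)
  then show ?case by (cases i) auto
qed auto

text \<open>The exponential of a sum of spaces is that of the image of the first under the
  exponential of the second, composed with the latter. The tail of the list is applied
  first.\<close>

lemma subspace_exp_append:
  "subspace_exp q (us @ vs) x = subspace_exp q (map (subspace_exp q vs) us) (subspace_exp q vs x)"
  by (induction us arbitrary: x) auto

lemma subspace_exp_0: "0 < q \<Longrightarrow> subspace_exp q vs 0 = 0"
  by (induction vs) auto

lemma subspace_exp_member:
  assumes "1 < q" "u \<in> set vs"
  shows "subspace_exp q vs u = 0"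
  using assms(2)
proof (induction vs)
  case (Cons v vs)
  show ?case
  proof (cases "u = v")
    case True
    \<comment> \<open>For \<open>x = 0\<close> this holds by the convention for division by
      zero.\<close>
    have "x ^ q / x ^ (q - 1) = x" for x :: 'a
      using assms(1) by (cases "x = 0") (auto simp flip: power_diff)
    then show ?thesis using True by simp
  next
    case False
    then show ?thesis using Cons assms(1) by simp
  qed
qed simp

lemma subspace_exp_scale:
  assumes "1 < q" "c \<noteq> 0"
  shows "subspace_exp q (map ((*) c) vs) (c * x) = c * subspace_exp q vs x"
proof (induction vs arbitrary: x)
  case (Cons v vs)
  have "c ^ q / c ^ (q - 1) = c"
    using assms by (auto simp flip: power_diff)
  then have "(c * y) ^ q / (c * z) ^ (q - 1) = c * (y ^ q / z ^ (q - 1))" for y z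
    by (simp add: power_mult_distrib times_divide_times_eq[symmetric] del: times_divide_times_eq)
  with Cons show ?case by (simp add: right_diff_distrib)
qed simp

text \<open>Coefficient form of the homogeneity of the exponential: scaling space and argument by
  \<open>c\<close> multiplies the value by \<open>c\<close>.\<close>

lemma subspace_coeff_scale:
  assumes "1 < q" "c \<noteq> 0"
  shows "subspace_coeff q (map ((*) c) vs) i * c ^ (q ^ i) = c * subspace_coeff q vs i"
proof (induction vs arbitrary: i)
  case (Cons v vs)
  show ?case
  proof (cases i)
    case (Suc k)
    let ?a = "subspace_coeff q (map ((*) c) vs)" and ?b = "subspace_coeff q vs" and ?e = "subspace_exp q vs v ^ (q - 1)"
    have cc: "c ^ q / c ^ (q - 1) = c"
      using assms by (auto simp flip: power_diff)
    have "?a k ^ q / (c * subspace_exp q vs v) ^ (q - 1) * c ^ (q ^ Suc k) = (?a k * c ^ (q ^ k)) ^ q / (c * subspace_exp q vs v) ^ (q - 1)"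
      by (simp add: power_mult_distrib power_mult[symmetric] mult.commute[of q])
    also have "\<dots> = (c ^ q / c ^ (q - 1)) * (?b k ^ q / ?e)"
      unfolding Cons by (simp add: power_mult_distrib times_divide_times_eq)
    finally have key: "?a k ^ q / (c * subspace_exp q vs v) ^ (q - 1) * c ^ (q ^ Suc k) = c * (?b k ^ q / ?e)"
      unfolding cc .
    show ?thesis
      unfolding Suc list.map subspace_coeff.simps subspace_exp_scale[OF assms] left_diff_distrib
        right_diff_distrib key Cons ..
  qed simp
qed simp

lemma coeff_prod_linear:
  fixes u :: "'a \<Rightarrow> 'c::comm_ring_1"
  assumes "finite A"
  shows "coeff (\<Prod>a\<in>A. [:1, u a:]) n = (\<Sum>S | S \<subseteq> A \<and> card S = n. \<Prod>a\<in>S. u a)"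
proof -
  have mon: "(\<Prod>a\<in>S. monom (u a) 1) = monom (\<Prod>a\<in>S. u a) (card S)" if "finite S" for S
    using that by induction (auto simp: mult_monom)
  have "(\<Prod>a\<in>A. [:1, u a:]) = (\<Prod>a\<in>A. monom (u a) 1 + 1)"
    by (intro prod.cong) (auto simp: monom_altdef one_pCons)
  also have "\<dots> = (\<Sum>S\<in>Pow A. \<Prod>a\<in>S. monom (u a) 1)"
    using prod_add[OF assms, of "\<lambda>a. monom (u a) 1" "\<lambda>_. 1"] by simp
  also have "\<dots> = (\<Sum>S\<in>Pow A. monom (\<Prod>a\<in>S. u a) (card S))"
    using assms by (intro sum.cong mon refl) (auto intro: finite_subset)
  finally have "coeff (\<Prod>a\<in>A. [:1, u a:]) n = (\<Sum>S\<in>Pow A. if card S = n then \<Prod>a\<in>S. u a else 0)"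
    by (simp add: coeff_sum)
  also have "\<dots> = (\<Sum>S\<in>{S \<in> Pow A. card S = n}. \<Prod>a\<in>S. u a)"
    by (rule sum.inter_filter[symmetric]) (use assms in simp)
  finally show ?thesis by (simp only: Pow_iff)
qed

text \<open>The recursive exponentials take lists, so the coordinate indices need some
  enumeration.\<close>

definition index_list :: "'n::finite option list" where
  "index_list = (SOME js. set js = UNIV \<and> distinct js)"

lemma set_index_list: "set (index_list :: 'n::finite option list) = UNIV"
  and length_index_list: "length (index_list :: 'n::finite option list) = CARD('n option)"
proof -
  have "\<exists>js :: 'n option list. set js = UNIV \<and> distinct js"
    using finite_distinct_list[of "UNIV :: 'n option set"] by simp
  then have "set (index_list :: 'n option list) = UNIV \<and> distinct (index_list :: 'n option list)"
    unfolding index_list_def by (rule someI_ex)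
  then show "set (index_list :: 'n option list) = UNIV" "length (index_list :: 'n option list) = CARD('n option)"
    by (auto simp flip: distinct_card)
qed

section \<open>Linearity over the constants and composition of finite exponentials\<close>

context completed_algebraic_closure
begin

lemma frobenius_power_sum: "(\<Sum>i\<in>I. f i :: 'c) ^ (CARD('f) ^ j) = (\<Sum>i\<in>I. f i ^ (CARD('f) ^ j))"
  by (induction I rule: infinite_finite_induct) (auto simp: frobenius_power_add q_gt_1)

lemma frobenius_sum: "(\<Sum>i\<in>I. f i :: 'c) ^ CARD('f) = (\<Sum>i\<in>I. f i ^ CARD('f))"
  using frobenius_power_sum[of f I 1] by simp

lemma subspace_exp_add:
  "subspace_exp CARD('f) vs (x + y :: 'c) = subspace_exp CARD('f) vs x + subspace_exp CARD('f) vs y"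
  by (induction vs) (auto simp: frobenius_add add_divide_distrib)

lemma subspace_exp_cst:
  "subspace_exp CARD('f) vs (cst s * x) = cst s * subspace_exp CARD('f) vs x"
  by (induction vs) (auto simp: power_mult_distrib cst_power_q right_diff_distrib)

lemma subspace_exp_sum_eq_0:
  assumes "\<And>i. i \<in> I \<Longrightarrow> subspace_exp CARD('f) vs (f i) = (0 :: 'c)"
  shows "subspace_exp CARD('f) vs (sum f I) = 0"
  using assms
  by (induction I rule: infinite_finite_induct) (auto simp: subspace_exp_add subspace_exp_0)

lemma subspace_exp_eq_sum:
  "subspace_exp CARD('f) vs (x :: 'c) = (\<Sum>i\<le>length vs. subspace_coeff CARD('f) vs i * x ^ (CARD('f) ^ i))"
proof (induction vs)
  case (Cons v vs)
  let ?q = "CARD('f)" and ?n = "length vs" and ?a = "subspace_coeff CARD('f) vs"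
  let ?d = "subspace_exp ?q vs v ^ (?q - 1)"
  have "subspace_exp ?q vs x = (\<Sum>i\<le>Suc ?n. ?a i * x ^ (?q ^ i))"
    using Cons q_gt_1 by (simp add: subspace_coeff_eq_0)
  also have "\<dots> = x + (\<Sum>i\<le>?n. ?a (Suc i) * x ^ (?q ^ Suc i))"
    by (subst sum.atMost_Suc_shift) simp
  finally have 1: "subspace_exp ?q vs x = x + (\<Sum>i\<le>?n. ?a (Suc i) * x ^ (?q ^ Suc i))" .
  have 2: "subspace_exp ?q vs x ^ ?q = (\<Sum>i\<le>?n. ?a i ^ ?q * x ^ (?q ^ Suc i))"
    unfolding Cons frobenius_sum
    by (simp add: power_mult_distrib power_mult[symmetric] mult.commute[of "?q"])
  have "subspace_exp ?q (v # vs) x = x + (\<Sum>i\<le>?n. ?a (Suc i) * x ^ (?q ^ Suc i)) - (\<Sum>i\<le>?n. ?a i ^ ?q * x ^ (?q ^ Suc i)) / ?d"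
    using 1 2 by simp
  also have "\<dots> = x + (\<Sum>i\<le>?n. (?a (Suc i) - ?a i ^ ?q / ?d) * x ^ (?q ^ Suc i))"
    by (simp add: sum_subtractf left_diff_distrib sum_divide_distrib)
  also have "\<dots> = (\<Sum>i\<le>Suc ?n. subspace_coeff ?q (v # vs) i * x ^ (?q ^ i))"
    by (subst sum.atMost_Suc_shift) simp
  finally show ?case by simp
qed simp

text \<open>Coefficients of a composition of additive polynomials: the product in the twisted
  polynomial ring, in which moving a scalar past the \<open>j\<close>-th power of Frobenius raises
  it to the power \<open>q ^ j\<close>.\<close>

lemma subspace_coeff_append:
  "subspace_coeff CARD('f) (us @ vs) m =
    (\<Sum>j\<le>m. subspace_coeff CARD('f) (map (subspace_exp CARD('f) vs) us) j * subspace_coeff CARD('f) vs (m - j) ^ (CARD('f) ^ j) :: 'c)"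
proof (induction us arbitrary: m)
  case Nil
  have "(\<Sum>j\<le>m. subspace_coeff CARD('f) [] j * subspace_coeff CARD('f) vs (m - j) ^ (CARD('f) ^ j))
     = (\<Sum>j\<in>{0}. subspace_coeff CARD('f) [] j * subspace_coeff CARD('f) vs (m - j) ^ (CARD('f) ^ j))"
    by (rule sum.mono_neutral_right) auto
  then show ?case by simp
next
  case (Cons u us)
  let ?q = "CARD('f)" and ?a = "subspace_coeff CARD('f) vs"
  let ?g = "subspace_coeff CARD('f) (map (subspace_exp CARD('f) vs) us)"
  let ?d = "subspace_exp ?q (us @ vs) u ^ (?q - 1)"
  show ?case
  proof (cases m)
    case (Suc k)
    have "subspace_coeff ?q ((u # us) @ vs) m =
      (\<Sum>j\<le>Suc k. ?g j * ?a (Suc k - j) ^ (?q ^ j)) - (\<Sum>j\<le>k. ?g j * ?a (k - j) ^ (?q ^ j)) ^ ?q / ?d"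
      using Cons by (simp add: Suc)
    also have "(\<Sum>j\<le>k. ?g j * ?a (k - j) ^ (?q ^ j)) ^ ?q = (\<Sum>j\<le>k. ?g j ^ ?q * ?a (k - j) ^ (?q ^ Suc j))"
      unfolding frobenius_sum by (simp add: power_mult_distrib power_mult[symmetric] mult.commute[of "?q"])
    also have "(\<Sum>j\<le>Suc k. ?g j * ?a (Suc k - j) ^ (?q ^ j)) - (\<Sum>j\<le>k. ?g j ^ ?q * ?a (k - j) ^ (?q ^ Suc j)) / ?d
      = ?a (Suc k) + (\<Sum>j\<le>k. (?g (Suc j) - ?g j ^ ?q / ?d) * ?a (k - j) ^ (?q ^ Suc j))"
      by (subst sum.atMost_Suc_shift) (simp add: left_diff_distrib sum_subtractf sum_divide_distrib)
    also have "\<dots> = (\<Sum>j\<le>m. subspace_coeff ?q (map (subspace_exp ?q vs) (u # us)) j * ?a (m - j) ^ (?q ^ j))"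
      unfolding Suc by (subst sum.atMost_Suc_shift) (simp add: subspace_exp_append)
    finally show ?thesis .
  qed simp
qed

text \<open>The vectors \<open>T^i \<omega>_j\<close> with \<open>i < N\<close>, a basis of level
  \<open>N\<close> over the field of constants when \<open>\<omega>\<close> lies in
  \<open>Omega\<close>.\<close>

primrec lattice_basis :: "'c ^ 'n::finite \<Rightarrow> nat \<Rightarrow> 'c list" where
  "lattice_basis \<omega> 0 = []"
| "lattice_basis \<omega> (Suc N) = map (hcoord \<omega>) index_list @ map ((*) \<tau>) (lattice_basis \<omega> N)"

declare lattice_basis.simps(2) [simp del]

lemma length_lattice_basis:
  "length (lattice_basis (\<omega> :: 'c ^ 'n::finite) N) = CARD('n option) * N"
  by (induction N) (auto simp: length_index_list lattice_basis.simps)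

text \<open>Writing \<open>a\<close> as a constant vector plus \<open>T b\<close>, the first part is
  a combination of basis vectors and the second is killed by the inner exponential, by homogeneity
  and induction.\<close>

lemma subspace_exp_lattice_elt:
  fixes \<omega> :: "'c ^ 'n::finite"
  assumes "a \<in> bounded_degree N"
  shows "subspace_exp CARD('f) (lattice_basis \<omega> N) (lattice_elt \<iota> a \<omega>) = 0"
  using assms
proof (induction N arbitrary: a)
  case 0
  then show ?case by (simp add: bounded_degree_0 subspace_exp_0)
next
  case (Suc N)
  have "a \<in> (\<lambda>(s, a) j. pCons (s j) (a j)) ` (UNIV \<times> bounded_degree N)"
    using Suc.prems bij_betw_imp_surj_on[OF bounded_degree_Suc] by blast
  then obtain s b where a: "a = (\<lambda>j. pCons (s j) (b j))" and b: "b \<in> bounded_degree N"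
    by auto
  let ?vs = "lattice_basis \<omega> (Suc N)"
  have "subspace_exp CARD('f) ?vs (hcoord \<omega> j) = 0" for j
    using q_gt_1 by (intro subspace_exp_member) (auto simp: set_index_list lattice_basis.simps)
  then have "subspace_exp CARD('f) ?vs (\<Sum>j\<in>UNIV. cst (s j) * hcoord \<omega> j) = 0"
    by (intro subspace_exp_sum_eq_0) (simp add: subspace_exp_cst)
  moreover have "subspace_exp CARD('f) ?vs (\<tau> * lattice_elt \<iota> b \<omega>) = 0"
    using Suc.IH[OF b] q_gt_1
    by (simp add: lattice_basis.simps subspace_exp_append subspace_exp_scale subspace_exp_0)
  ultimately show ?case
    by (simp add: a lattice_elt_pCons subspace_exp_add)
qed

text \<open>
  Both sides are the coefficients of polynomials of degree less than \<open>q ^ (r * N)\<close> which take the value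
  \<open>1\<close> at \<open>0\<close> and vanish at the nonzero elements of the finite subspace.
\<close>

lemma exp_coefficient_finite_level:
  fixes \<omega> :: "'c ^ 'n::finite"
  assumes \<omega>: "\<omega> \<in> Omega \<iota>"
  shows "(\<Sum>S | S \<subseteq> bounded_degree N \<inter> nonzero_vectors \<and> card S = n. \<Prod>a\<in>S. - 1 / lattice_elt \<iota> a \<omega>) =
    (\<Sum>i\<le>CARD('n option) * N. if n = CARD('f) ^ i - 1 then subspace_coeff CARD('f) (lattice_basis \<omega> N) i else 0)"
proof -
  let ?q = "CARD('f)" and ?L = "CARD('n option) * N" and ?vs = "lattice_basis \<omega> N"
  define A where "A = bounded_degree N \<inter> (nonzero_vectors :: ('n option \<Rightarrow> 'f poly) set)"
  define V where "V = (\<lambda>a. lattice_elt \<iota> a \<omega>) ` bounded_degree N"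
  have finA: "finite A" by (simp add: A_def)
  \<comment> \<open>The exponential divided by \<open>X\<close>, whence the exponents
    \<open>q^i - 1\<close>. Its degree falls just short of the number \<open>q^(r N)\<close> of
    points in \<open>V\<close>, which include 0.\<close>
  define P where "P = (\<Sum>i\<le>?L. monom (subspace_coeff ?q ?vs i) (?q ^ i - 1))"
  define Q where "Q = (\<Prod>a\<in>A. [:1, - 1 / lattice_elt \<iota> a \<omega>:])"
  have cardV: "card V = ?q ^ ?L"
    using lattice_elt_eq_iff[OF \<omega>] unfolding V_def
    by (subst card_image) (auto simp: inj_on_def card_bounded_degree)
  have zero: "(\<lambda>_. 0) \<in> (bounded_degree N :: ('n option \<Rightarrow> 'f poly) set)"
    by (simp add: bounded_degree_def)
  have cardA: "card A < ?q ^ ?L"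
  proof -
    have "A \<subset> bounded_degree N"
      using zero by (auto simp: A_def)
    then show ?thesis
      using psubset_card_mono[of "bounded_degree N" A] by (simp add: card_bounded_degree)
  qed
  have coeffQ: "coeff Q n = (\<Sum>S | S \<subseteq> A \<and> card S = n. \<Prod>a\<in>S. - 1 / lattice_elt \<iota> a \<omega>)" for n
    unfolding Q_def by (rule coeff_prod_linear[OF finA])
  have coeffP: "coeff P n = (\<Sum>i\<le>?L. if n = ?q ^ i - 1 then subspace_coeff ?q ?vs i else 0)" for n
    unfolding P_def by (simp add: coeff_sum) (simp add: eq_commute)
  have "coeff (P - Q) n = 0" if n: "?q ^ ?L - 1 < n" for n
  proof -
    have "?q ^ i - 1 \<noteq> n" if "i \<le> ?L" for i
    proof -
      have "?q ^ i \<le> ?q ^ ?L" using that q_gt_1 by (intro power_increasing) auto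
      then show ?thesis using n by linarith
    qed
    then have "coeff P n = 0" unfolding coeffP by (intro sum.neutral) auto
    moreover have "S \<subseteq> A \<Longrightarrow> card S \<noteq> n" for S
      using card_mono[OF finA, of S] cardA n by fastforce
    then have "coeff Q n = 0" unfolding coeffQ by (intro sum.neutral) auto
    ultimately show ?thesis by simp
  qed
  then have "degree (P - Q) \<le> ?q ^ ?L - 1"
    by (intro degree_le) auto
  moreover have "0 < ?q ^ ?L" using q_gt_1 by simp
  ultimately have deg: "degree (P - Q) < card V"
    unfolding cardV by linarith
  have roots: "poly (P - Q) v = 0" if "v \<in> V" for v
  proof -
    obtain a where a: "a \<in> bounded_degree N" "v = lattice_elt \<iota> a \<omega>"
      using \<open>v \<in> V\<close> by (auto simp: V_def)
    have Pv: "poly P v = (\<Sum>i\<le>?L. subspace_coeff ?q ?vs i * v ^ (?q ^ i - 1))"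
      by (simp add: P_def poly_sum poly_monom)
    show ?thesis
    proof (cases "v = 0")
      case True
      have "?q ^ i - 1 = 0 \<longleftrightarrow> i = 0" for i
        using one_less_power[OF q_gt_1, of i] by (cases "i = 0") auto
      note [simp] = this[simplified]
      have "poly P v = (\<Sum>i\<le>?L. if i = 0 then 1 else 0)"
        unfolding Pv by (intro sum.cong) (auto simp: True power_0_left)
      moreover have "poly Q v = 1"
        by (simp add: Q_def True poly_prod)
      ultimately show ?thesis by simp
    next
      case False
      then have "a \<in> A"
        using a lattice_elt_eq_0_iff[OF \<omega>, of a] by (simp add: A_def)
      moreover have "poly [:1, - 1 / lattice_elt \<iota> a \<omega>:] v = 0"
        using False a by simp
      ultimately have "poly Q v = 0"
        using finA unfolding Q_def poly_prod by (intro prod_zero) blast+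
      moreover have "v * poly P v = subspace_exp ?q ?vs v"
      proof -
        have "v * v ^ (?q ^ i - 1) = v ^ (?q ^ i)" for i
          using q_gt_1 by (simp flip: power_Suc)
        then have "v * (b * v ^ (?q ^ i - 1)) = b * v ^ (?q ^ i)" for b i
          by (metis mult.left_commute)
        then show ?thesis
          unfolding Pv subspace_exp_eq_sum length_lattice_basis sum_distrib_left
          by (intro sum.cong refl)
      qed
      then have "poly P v = 0"
        using subspace_exp_lattice_elt[OF a(1), of \<omega>] a(2) False by simp
      ultimately show ?thesis by simp
    qed
  qed
  have "P - Q = 0"
  proof (rule ccontr)
    assume nz: "P - Q \<noteq> 0"
    have "card V \<le> card {x. poly (P - Q) x = 0}"
      using roots by (intro card_mono poly_roots_finite[OF nz]) auto
    also have "\<dots> \<le> degree (P - Q)"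
      by (rule card_poly_roots_bound[OF nz])
    finally show False using deg by simp
  qed
  then have "coeff Q n = coeff P n" by simp
  then show ?thesis
    unfolding coeffP coeffQ A_def .
qed

text \<open>\<open>exp_coefficient\<close> numbers the coefficient of \<open>X^(n+1)\<close> by
  \<open>n\<close>, so the power \<open>q^k\<close> has index \<open>q^k - 1\<close>. Working with
  this sum avoids the definite description in \<open>para_Eisenstein\<close>.\<close>

definition \<alpha> :: "nat \<Rightarrow> 'c ^ 'n::finite \<Rightarrow> 'c" where
  "\<alpha> k = exp_coefficient \<iota> (CARD('f) ^ k - 1)"

lemma q_power_minus_1_eq_iff: "CARD('f) ^ i - 1 = CARD('f) ^ j - 1 \<longleftrightarrow> i = j"
proof
  assume "CARD('f) ^ i - 1 = CARD('f) ^ j - 1"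
  moreover have "0 < CARD('f) ^ i" "0 < CARD('f) ^ j"
    using q_gt_1 by auto
  ultimately have "CARD('f) ^ i = CARD('f) ^ j"
    by linarith
  then show "i = j"
    using q_gt_1 by (simp add: power_inject_exp)
qed simp

lemma subspace_coeff_limit:
  fixes \<omega> :: "'c ^ 'n::finite"
  assumes "\<omega> \<in> Omega \<iota>"
  shows "(\<lambda>N. subspace_coeff CARD('f) (lattice_basis \<omega> N) k) \<longlonglongrightarrow> \<alpha> k \<omega>"
proof -
  have "(\<Sum>i\<le>CARD('n option) * N. if CARD('f) ^ k - 1 = CARD('f) ^ i - 1 then subspace_coeff CARD('f) (lattice_basis \<omega> N) i else 0)
    = subspace_coeff CARD('f) (lattice_basis \<omega> N) k" for N
    using subspace_coeff_eq_0[OF q_gt_1, of "lattice_basis \<omega> N" k]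
    unfolding q_power_minus_1_eq_iff length_lattice_basis
    by (cases "k \<le> CARD('n option) * N") (simp_all add: not_le del: card_option)
  then show ?thesis
    using exp_coefficient_limit[OF assms, of "CARD('f) ^ k - 1", unfolded exp_coefficient_finite_level[OF assms]]
    unfolding \<alpha>_def by (simp only:)
qed

text \<open>The finite-level sums with this index are all zero, and so is their limit.\<close>

lemma exp_coefficient_eq_0:
  fixes \<omega> :: "'c ^ 'n::finite"
  assumes "\<omega> \<in> Omega \<iota>" "\<And>i. n \<noteq> CARD('f) ^ i - 1"
  shows "exp_coefficient \<iota> n \<omega> = 0"
  using exp_coefficient_limit[OF assms(1), of n, unfolded exp_coefficient_finite_level[OF assms(1)]]
  by (simp only: assms(2) if_False sum.neutral_const LIMSEQ_const_iff)

lemma \<alpha>_0 [simp]: "\<alpha> 0 \<omega> = 1"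
  by (simp add: \<alpha>_def exp_coefficient_0)

lemma exp_lattice_sums_\<alpha>:
  fixes \<omega> :: "'c ^ 'n::finite"
  assumes "\<omega> \<in> Omega \<iota>"
  shows "(\<lambda>k. \<alpha> k \<omega> * z ^ (CARD('f) ^ k)) sums exp_lattice (period_lattice \<iota> \<omega>) z"
proof -
  let ?g = "\<lambda>k. CARD('f) ^ k - 1"
  have "strict_mono ?g"
    using q_gt_1 by (intro strict_monoI diff_less_mono power_strict_increasing) auto
  moreover have "exp_coefficient \<iota> n \<omega> * z ^ Suc n = 0" if "n \<notin> range ?g" for n
  proof -
    have "\<And>i. n \<noteq> ?g i" using that by blast
    then show ?thesis by (simp add: exp_coefficient_eq_0[OF assms])
  qed
  ultimately have "(\<lambda>k. exp_coefficient \<iota> (?g k) \<omega> * z ^ Suc (?g k)) sums exp_lattice (period_lattice \<iota> \<omega>) z"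
    using exp_lattice_sums[OF assms, of z] sums_mono_reindex[of ?g "\<lambda>n. exp_coefficient \<iota> n \<omega> * z ^ Suc n"] by blast
  then show ?thesis
    using q_gt_1 by (simp add: \<alpha>_def)
qed

text \<open>If \<open>c k\<close> is the lowest nonzero coefficient, comparing it with the tail
  gives \<open>absval (c k) \<le> C * absval z\<close> for all small nonzero \<open>z\<close>, and
  \<open>z\<close> may run through the powers of \<open>1 / \<tau>\<close>. The bound
  \<open>C\<close> for the coefficients comes from convergence at \<open>z = 1\<close>.\<close>

lemma q_power_series_unique:
  fixes c :: "nat \<Rightarrow> 'c"
  assumes sums: "\<And>z. (\<lambda>i. c i * z ^ (CARD('f) ^ i)) sums 0"
  shows "c i = 0"
proof (rule ccontr)
  let ?q = "CARD('f)"
  assume "c i \<noteq> 0"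
  define k where "k = (LEAST i. c i \<noteq> 0)"
  have k: "c k \<noteq> 0" "\<And>i. i < k \<Longrightarrow> c i = 0"
    using LeastI[of "\<lambda>i. c i \<noteq> 0" i] \<open>c i \<noteq> 0\<close> not_less_Least unfolding k_def by blast+
  have "(\<lambda>n. \<Sum>i<n. c i) \<longlonglongrightarrow> 0"
    using sums[of 1] by (simp add: sums_def)
  then have "(\<lambda>n. (\<Sum>i<Suc n. c i) - (\<Sum>i<n. c i)) \<longlonglongrightarrow> 0 - 0"
    by (intro tendsto_diff LIMSEQ_Suc)
  then have "(\<lambda>n. absval (c n)) \<longlonglongrightarrow> 0"
    by (simp add: tendsto_absval_iff order_tendsto_iff) (metis absval_nonneg eventually_sequentially order_less_le_trans)
  then obtain C where C: "0 < C" "\<And>n. absval (c n) \<le> C"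
    using BseqE[OF convergent_imp_Bseq[OF convergentI]] by (metis abs_of_nonneg absval_nonneg real_norm_def)
  have le: "absval (c k) \<le> C * absval z" if z: "z \<noteq> 0" "absval z \<le> 1" for z :: 'c
  proof -
    let ?S = "\<lambda>n. (\<Sum>i<n. c i * z ^ (?q ^ i)) - c k * z ^ (?q ^ k)"
    have "?S \<longlonglongrightarrow> 0 - c k * z ^ (?q ^ k)"
      using sums[of z] by (intro tendsto_diff tendsto_const) (simp add: sums_def)
    then have "absval (0 - c k * z ^ (?q ^ k)) \<le> C * absval z ^ (?q ^ Suc k)"
    proof (rule tendsto_absval_le)
      have "absval (?S n) \<le> C * absval z ^ (?q ^ Suc k)" if "k < n" for n
      proof -
        have "?S n = (\<Sum>i\<in>{..<n} - {k}. c i * z ^ (?q ^ i))"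
          using that by (subst sum.remove[of _ k]) auto
        also have "absval \<dots> \<le> C * absval z ^ (?q ^ Suc k)"
        proof (rule absval_sum_le)
          fix i assume "i \<in> {..<n} - {k}"
          then consider "i < k" | "Suc k \<le> i" by fastforce
          then show "absval (c i * z ^ (?q ^ i)) \<le> C * absval z ^ (?q ^ Suc k)"
          proof cases
            case 1
            then show ?thesis using k C by simp
          next
            case 2
            then have "?q ^ Suc k \<le> ?q ^ i"
              using q_gt_1 by (intro power_increasing) auto
            then have "absval z ^ (?q ^ i) \<le> absval z ^ (?q ^ Suc k)"
              by (rule power_decreasing) (simp_all add: z(2))
            then show ?thesis
              using C unfolding absval_mult absval_power by (intro mult_mono) auto
          qed
        qed (use C in simp)
        finally show ?thesis .
      qed
      then show "\<forall>\<^sub>F n in sequentially. absval (?S n) \<le> C * absval z ^ (?q ^ Suc k)"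
        unfolding eventually_sequentially by (intro exI[of _ "Suc k"]) auto
    qed simp
    then have "absval (c k) * absval z ^ (?q ^ k) \<le> C * absval z ^ (?q ^ Suc k)"
      by (simp add: absval_mult absval_power)
    also have "\<dots> \<le> C * absval z ^ Suc (?q ^ k)"
    proof -
      have "?q ^ k < ?q ^ Suc k"
        using q_gt_1 by (intro power_strict_increasing) auto
      then have "Suc (?q ^ k) \<le> ?q ^ Suc k"
        by (rule Suc_leI)
      then have "absval z ^ (?q ^ Suc k) \<le> absval z ^ Suc (?q ^ k)"
        by (rule power_decreasing) (simp_all add: z(2))
      then show ?thesis
        using C(1) by (intro mult_left_mono) simp_all
    qed
    finally have "absval (c k) * absval z ^ (?q ^ k) \<le> (C * absval z) * absval z ^ (?q ^ k)"
      by (simp add: mult_ac)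
    then show ?thesis
      using z(1) by simp
  qed
  obtain n where n: "(1 / real ?q) ^ n < absval (c k) / C"
    using real_arch_pow_inv[of "absval (c k) / C" "1 / real ?q"] q_gt_1 k(1) C(1) by auto
  have az: "absval ((1 / \<tau>) ^ n) = (1 / real ?q) ^ n"
    by (simp add: absval_power absval_divide absval_\<tau>)
  have "absval (c k) \<le> C * (1 / real ?q) ^ n"
    using le[of "(1 / \<tau>) ^ n"] q_gt_1 unfolding az by (simp add: power_le_one)
  then show False
    using n C(1) by (simp add: pos_less_divide_eq mult.commute)
qed

text \<open>Existence and uniqueness of the expansion resolve the definite description, on
  \<open>Omega\<close>.\<close>

lemma para_Eisenstein_eq:
  fixes \<omega> :: "'c ^ 'n::finite"
  assumes "\<omega> \<in> Omega \<iota>"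
  shows "para_Eisenstein \<iota> k \<omega> = \<alpha> k \<omega>"
proof -
  let ?\<Lambda> = "period_lattice \<iota> \<omega>"
  have "(THE a. \<forall>z. (\<lambda>i. a i * z ^ (CARD('f) ^ i)) sums exp_lattice ?\<Lambda> z) = (\<lambda>k. \<alpha> k \<omega>)"
  proof (rule the_equality)
    fix a :: "nat \<Rightarrow> 'c"
    assume a: "\<forall>z. (\<lambda>i. a i * z ^ (CARD('f) ^ i)) sums exp_lattice ?\<Lambda> z"
    have "(\<lambda>i. (a i - \<alpha> i \<omega>) * z ^ (CARD('f) ^ i)) sums 0" for z
    proof -
      have "(\<lambda>n. (\<Sum>i<n. a i * z ^ (CARD('f) ^ i)) - (\<Sum>i<n. \<alpha> i \<omega> * z ^ (CARD('f) ^ i))) \<longlonglongrightarrow> exp_lattice ?\<Lambda> z - exp_lattice ?\<Lambda> z"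
        using a exp_lattice_sums_\<alpha>[OF assms, of z] unfolding sums_def by (intro tendsto_diff) auto
      then show ?thesis
        by (simp add: sums_def sum_subtractf left_diff_distrib)
    qed
    then have "a i - \<alpha> i \<omega> = 0" for i
      by (rule q_power_series_unique)
    then show "a = (\<lambda>k. \<alpha> k \<omega>)"
      by (simp add: fun_eq_iff)
  qed (use exp_lattice_sums_\<alpha>[OF assms] in blast)
  then show ?thesis
    by (simp add: para_Eisenstein_def exp_coeff_def)
qed

subsection \<open>The action of \<open>T\<close>\<close>

text \<open>
  The coefficients \<open>\<phi>\<^sub>j\<close> in \<open>e\<^sub>1(T X) = T \<Sum>\<^sub>j \<phi>\<^sub>j e\<^sub>2(X)^(q^j)\<close>, where \<open>e\<^sub>1\<close> and \<open>e\<^sub>2\<close> have the coefficients \<open>A\<close> and \<open>B\<close>;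
  at finite level, \<open>e\<^sub>1\<close> belongs to a larger subspace than \<open>e\<^sub>2\<close>.
\<close>

fun T_coeff :: "(nat \<Rightarrow> 'c) \<Rightarrow> (nat \<Rightarrow> 'c) \<Rightarrow> nat \<Rightarrow> 'c" where
  "T_coeff A B m = \<tau> ^ (CARD('f) ^ m - 1) * A m - (\<Sum>j<m. T_coeff A B j * B (m - j) ^ (CARD('f) ^ j))"

declare T_coeff.simps [simp del]

text \<open>Level \<open>N + 1\<close> is \<open>T\<close> times the span of level \<open>N\<close>
  and the \<open>\<omega>_j / T\<close>. Hence the recursion computes the coefficients of the
  exponential of a space with \<open>r\<close> generators, and these vanish beyond index
  \<open>r\<close>.\<close>

lemma T_coeff_finite_level:
  fixes \<omega> :: "'c ^ 'n::finite"
  assumes "CARD('n option) < m"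
  shows "T_coeff (subspace_coeff CARD('f) (lattice_basis \<omega> (Suc N))) (subspace_coeff CARD('f) (lattice_basis \<omega> N)) m = 0"
proof -
  let ?q = "CARD('f)"
  let ?A = "subspace_coeff ?q (lattice_basis \<omega> (Suc N))" and ?B = "subspace_coeff ?q (lattice_basis \<omega> N)"
  define us where "us = map (\<lambda>j. hcoord \<omega> j / \<tau>) index_list"
  define g where "g = subspace_coeff ?q (map (subspace_exp ?q (lattice_basis \<omega> N)) us)"
  have "map ((*) \<tau>) us = map (hcoord \<omega>) index_list"
    by (simp add: us_def)
  then have basis: "lattice_basis \<omega> (Suc N) = map ((*) \<tau>) (us @ lattice_basis \<omega> N)"
    by (simp add: lattice_basis.simps)
  have rec: "\<tau> ^ (?q ^ m - 1) * ?A m = (\<Sum>j\<le>m. g j * ?B (m - j) ^ (?q ^ j))" for m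
  proof -
    have "\<tau> ^ (?q ^ m) = \<tau> * \<tau> ^ (?q ^ m - 1)"
      using q_gt_1 by (simp flip: power_Suc)
    moreover have "?A m * \<tau> ^ (?q ^ m) = \<tau> * subspace_coeff ?q (us @ lattice_basis \<omega> N) m"
      unfolding basis by (rule subspace_coeff_scale[OF q_gt_1 \<tau>_nonzero])
    ultimately have "\<tau> * (\<tau> ^ (?q ^ m - 1) * ?A m) = \<tau> * subspace_coeff ?q (us @ lattice_basis \<omega> N) m"
      by (simp add: mult_ac)
    then have "\<tau> ^ (?q ^ m - 1) * ?A m = subspace_coeff ?q (us @ lattice_basis \<omega> N) m"
      by simp
    then show ?thesis
      by (simp add: subspace_coeff_append g_def)
  qed
  have "T_coeff ?A ?B m = g m" for m
  proof (induction m rule: less_induct)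
    case (less m)
    have "T_coeff ?A ?B m = (\<Sum>j\<le>m. g j * ?B (m - j) ^ (?q ^ j)) - (\<Sum>j<m. g j * ?B (m - j) ^ (?q ^ j))"
      by (simp only: T_coeff.simps[of _ _ m] rec) (simp add: less)
    also have "\<dots> = g m"
      by (simp add: lessThan_Suc_atMost[symmetric])
    finally show ?case .
  qed
  moreover have "g m = 0"
    unfolding g_def using assms by (intro subspace_coeff_eq_0 q_gt_1) (simp add: us_def length_index_list)
  ultimately show ?thesis by simp
qed

lemma T_coeff_tendsto:
  assumes "\<And>m. (\<lambda>N. A N m) \<longlonglongrightarrow> A' m" "\<And>m. (\<lambda>N. B N m) \<longlonglongrightarrow> B' m"
  shows "(\<lambda>N. T_coeff (A N) (B N) m) \<longlonglongrightarrow> T_coeff A' B' m"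
proof (induction m rule: less_induct)
  case (less m)
  have pow: "(\<lambda>N. B N i ^ n) \<longlonglongrightarrow> B' i ^ n" for i n
    by (induction n) (auto intro!: tendsto_mult assms)
  show ?case
    unfolding T_coeff.simps[of _ _ m]
    by (intro tendsto_diff tendsto_sum tendsto_mult tendsto_const assms pow less) auto
qed

text \<open>The coefficients at levels \<open>N + 1\<close> and \<open>N\<close> have the same
  limits, so the two arguments of \<open>T_coeff\<close> merge.\<close>

lemma T_coeff_\<alpha>_eq_0:
  fixes \<omega> :: "'c ^ 'n::finite"
  assumes "\<omega> \<in> Omega \<iota>" "CARD('n option) < m"
  shows "T_coeff (\<lambda>k. \<alpha> k \<omega>) (\<lambda>k. \<alpha> k \<omega>) m = 0"
proof -
  have "(\<lambda>N. T_coeff (subspace_coeff CARD('f) (lattice_basis \<omega> (Suc N))) (subspace_coeff CARD('f) (lattice_basis \<omega> N)) m)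
      \<longlonglongrightarrow> T_coeff (\<lambda>k. \<alpha> k \<omega>) (\<lambda>k. \<alpha> k \<omega>) m"
    by (intro T_coeff_tendsto subspace_coeff_limit LIMSEQ_Suc[OF subspace_coeff_limit] assms(1))
  then show ?thesis
    by (simp add: T_coeff_finite_level[OF assms(2)] LIMSEQ_const_iff)
qed

end

subsection \<open>Derivatives of the coefficients\<close>

lemma has_partial_deriv_const [simp]: "has_partial_deriv i (\<lambda>_. a) \<omega> 0"
  by (simp add: has_partial_deriv_def)

lemma has_partial_deriv_diff:
  assumes "has_partial_deriv i f \<omega> d" "has_partial_deriv i g \<omega> e"
  shows "has_partial_deriv i (\<lambda>x. f x - g x) \<omega> (d - e)"
proof -
  have "(f (\<omega> + axis i t) - f \<omega>) / t - (g (\<omega> + axis i t) - g \<omega>) / t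
      = (f (\<omega> + axis i t) - g (\<omega> + axis i t) - (f \<omega> - g \<omega>)) / t" for t
    by (simp add: diff_divide_distrib)
  then show ?thesis
    using tendsto_diff[OF assms[unfolded has_partial_deriv_def]] by (simp add: has_partial_deriv_def)
qed

lemma has_partial_deriv_add:
  assumes "has_partial_deriv i f \<omega> d" "has_partial_deriv i g \<omega> e"
  shows "has_partial_deriv i (\<lambda>x. f x + g x) \<omega> (d + e)"
proof -
  have "(f (\<omega> + axis i t) - f \<omega>) / t + (g (\<omega> + axis i t) - g \<omega>) / t
      = (f (\<omega> + axis i t) + g (\<omega> + axis i t) - (f \<omega> + g \<omega>)) / t" for t
    by (simp add: diff_divide_distrib add_divide_distrib)
  then show ?thesis
    using tendsto_add[OF assms[unfolded has_partial_deriv_def]] by (simp add: has_partial_deriv_def)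
qed

lemma has_partial_deriv_sum:
  assumes "\<And>s. s \<in> I \<Longrightarrow> has_partial_deriv i (f s) \<omega> (d s)"
  shows "has_partial_deriv i (\<lambda>x. \<Sum>s\<in>I. f s x) \<omega> (\<Sum>s\<in>I. d s)"
  using assms by (induction I rule: infinite_finite_induct) (auto intro: has_partial_deriv_add)

lemma has_partial_deriv_imp_tendsto:
  assumes "has_partial_deriv i f \<omega> d"
  shows "((\<lambda>t. f (\<omega> + axis i t)) \<longlongrightarrow> f \<omega>) (at 0)"
proof -
  have "((\<lambda>t. (f (\<omega> + axis i t) - f \<omega>) / t * t + f \<omega>) \<longlongrightarrow> d * 0 + f \<omega>) (at 0)"
    using assms unfolding has_partial_deriv_def by (intro tendsto_intros)
  then have "((\<lambda>t. (f (\<omega> + axis i t) - f \<omega>) / t * t + f \<omega>) \<longlongrightarrow> f \<omega>) (at 0)"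
    by simp
  then show ?thesis
    by (rule Lim_transform_eventually) (auto simp: eventually_at_filter)
qed

lemma has_partial_deriv_mult:
  assumes "has_partial_deriv i f \<omega> d" "has_partial_deriv i g \<omega> e"
  shows "has_partial_deriv i (\<lambda>x. f x * g x) \<omega> (d * g \<omega> + f \<omega> * e)"
proof -
  have "((\<lambda>t. (f (\<omega> + axis i t) - f \<omega>) / t * g (\<omega> + axis i t) + f \<omega> * ((g (\<omega> + axis i t) - g \<omega>) / t))
      \<longlongrightarrow> d * g \<omega> + f \<omega> * e) (at 0)"
    using assms unfolding has_partial_deriv_def
    by (intro tendsto_intros has_partial_deriv_imp_tendsto[OF assms(2)])
  moreover have "(f (\<omega> + axis i t) - f \<omega>) / t * g (\<omega> + axis i t) + f \<omega> * ((g (\<omega> + axis i t) - g \<omega>) / t)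
     = (f (\<omega> + axis i t) * g (\<omega> + axis i t) - f \<omega> * g \<omega>) / t" for t
    by (simp add: diff_divide_distrib left_diff_distrib right_diff_distrib)
  ultimately show ?thesis
    by (simp add: has_partial_deriv_def)
qed

lemma eventually_in_polydisc:
  assumes "0 < \<rho>"
  shows "\<forall>\<^sub>F t in at 0. \<omega> + axis i t \<in> polydisc \<omega> \<rho>"
  unfolding eventually_at
  using assms by (intro exI[of _ \<rho>]) (auto simp: dist_absval polydisc_def axis_def)

lemma has_partial_deriv_cong:
  assumes "0 < \<rho>" "\<And>x. x \<in> polydisc \<omega> \<rho> \<Longrightarrow> f x = g x"
  shows "has_partial_deriv i f \<omega> d \<longleftrightarrow> has_partial_deriv i g \<omega> d"
  unfolding has_partial_deriv_def
  by (intro tendsto_cong eventually_mono[OF eventually_in_polydisc[OF assms(1)]])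
     (use assms in auto)

context completed_algebraic_closure
begin

text \<open>The field is not discrete, as the powers of \<open>1 / \<tau>\<close> are nonzero and
  tend to zero. Uniqueness of derivatives rests on this.\<close>

lemma at_0_neq_bot: "at (0 :: 'c) \<noteq> bot"
proof
  assume "at (0 :: 'c) = bot"
  then have "open {0 :: 'c}"
    by (simp add: at_eq_bot_iff)
  then obtain e where e: "0 < e" "\<And>y :: 'c. dist y 0 < e \<Longrightarrow> y = 0"
    by (metis open_dist singletonD singletonI)
  obtain n where "(1 / real CARD('f)) ^ n < e"
    using real_arch_pow_inv[of e "1 / real CARD('f)"] e(1) q_gt_1 by auto
  then have "dist ((1 / \<tau>) ^ n) 0 < e"
    by (simp add: dist_absval absval_power absval_divide absval_\<tau>)
  then have "(1 / \<tau>) ^ n = 0"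
    by (rule e(2))
  then show False by simp
qed

lemma has_partial_deriv_unique:
  assumes "has_partial_deriv i f \<omega> d" "has_partial_deriv i f \<omega> (e :: 'c)"
  shows "d = e"
  using assms tendsto_unique[OF at_0_neq_bot] unfolding has_partial_deriv_def by blast

lemma has_partial_deriv_imp_partial_deriv:
  "has_partial_deriv i f \<omega> (d :: 'c) \<Longrightarrow> partial_deriv i f \<omega> = d"
  unfolding has_partial_deriv_def partial_deriv_def by (rule tendsto_Lim[OF at_0_neq_bot])

text \<open>By additivity, the difference quotient of the power is the power of the difference
  quotient times \<open>t^(Q - 1)\<close> with \<open>Q = q^j\<close>, which tends to zero as
  \<open>Q > 1\<close>.\<close>

lemma has_partial_deriv_frobenius:
  assumes f: "has_partial_deriv i f \<omega> (d :: 'c)" and j: "0 < j"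
  shows "has_partial_deriv i (\<lambda>x. f x ^ (CARD('f) ^ j)) \<omega> 0"
proof -
  let ?Q = "CARD('f) ^ j"
  have "1 < ?Q"
    using one_less_power[OF q_gt_1 j] .
  define n where "n = ?Q - 2"
  have n: "?Q = Suc (Suc n)"
    using \<open>1 < ?Q\<close> by (simp add: n_def)
  have pow: "((\<lambda>t. g t ^ k) \<longlongrightarrow> l ^ k) F" if "(g \<longlongrightarrow> l) F" for g :: "'c \<Rightarrow> 'c" and l F k
    by (induction k) (auto intro!: tendsto_mult that)
  have "((\<lambda>t. ((f (\<omega> + axis i t) - f \<omega>) / t) ^ ?Q * t ^ Suc n) \<longlongrightarrow> d ^ ?Q * 0 ^ Suc n) (at 0)"
    using f unfolding has_partial_deriv_def by (intro tendsto_mult pow tendsto_ident_at)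
  moreover have "((f (\<omega> + axis i t) - f \<omega>) / t) ^ ?Q * t ^ Suc n = (f (\<omega> + axis i t) ^ ?Q - f \<omega> ^ ?Q) / t" for t
  proof (cases "t = 0")
    case False
    have "((f (\<omega> + axis i t) - f \<omega>) / t) ^ ?Q * t ^ Suc n = (f (\<omega> + axis i t) - f \<omega>) ^ ?Q * (t ^ Suc n / t ^ ?Q)"
      by (simp add: power_divide)
    also have "t ^ Suc n / t ^ ?Q = 1 / t"
      unfolding n using False by simp
    finally show ?thesis
      by (simp add: frobenius_power_diff)
  qed simp
  ultimately show ?thesis
    by (simp add: has_partial_deriv_def)
qed

text \<open>Derivatives at the centre are linear coefficients, and summing power series sums their
  coefficients.\<close>

lemma has_partial_deriv_infsum:
  fixes \<omega> :: "'c ^ 'n::finite"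
  assumes "0 < \<rho>" "null_family I b"
    and f: "\<And>s. s \<in> I \<Longrightarrow> bounded_analytic \<omega> \<rho> (b s) (f s)"
    and d: "\<And>s. s \<in> I \<Longrightarrow> has_partial_deriv i (f s) \<omega> (d s)"
  shows "has_partial_deriv i (\<lambda>x. infsum (\<lambda>s. f s x) I) \<omega> (infsum d I)"
    and "(d has_sum infsum d I) I"
proof -
  obtain C where C: "\<And>s. s \<in> I \<Longrightarrow> power_series_on \<omega> \<rho> (b s) (C s) (f s)"
    using f unfolding bounded_analytic_def by metis
  obtain B where B: "0 < B" "\<And>s. s \<in> I \<Longrightarrow> b s \<le> B"
    using null_family_bounded[OF assms(2)] by blast
  have eq: "d s = C s (unit_index i)" if "s \<in> I" for s
    using has_partial_deriv_unique[OF d[OF that] power_series_has_partial_deriv[OF assms(1) C[OF that]]] .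
  have "infsum d I = infsum (\<lambda>s. C s (unit_index i)) I"
    using eq by (rule infsum_cong)
  moreover have "(d has_sum l) I \<longleftrightarrow> ((\<lambda>s. C s (unit_index i)) has_sum l) I" for l
    using eq by (rule has_sum_cong)
  ultimately show "has_partial_deriv i (\<lambda>x. infsum (\<lambda>s. f s x) I) \<omega> (infsum d I)"
    and "(d has_sum infsum d I) I"
    using power_series_on_infsum[OF assms(1,2) C B(2)] B(1) power_series_has_partial_deriv[OF assms(1)]
    by auto
qed

lemma bounded_analytic_\<alpha>:
  fixes \<omega> :: "'c ^ 'n::finite"
  assumes "0 < c" "K_form_bounded_below \<iota> c \<omega>" "0 < R"
  obtains M where "0 < M" "\<And>k. bounded_analytic \<omega> (c / 2) (M / R ^ (CARD('f) ^ k - 1)) (\<alpha> k)"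
proof -
  obtain M where "0 < M" "\<And>n. bounded_analytic \<omega> (c / 2) (M / R ^ n) (exp_coefficient \<iota> n)"
    using bounded_analytic_exp_coefficient[OF assms] by metis
  then show ?thesis
    using that[of M] unfolding \<alpha>_def by blast
qed

lemma has_partial_deriv_\<alpha>:
  fixes \<omega> :: "'c ^ 'n::finite"
  assumes "\<omega> \<in> Omega \<iota>"
  shows "has_partial_deriv i (\<alpha> k) \<omega> (partial_deriv i (\<alpha> k) \<omega>)"
proof -
  obtain c where c: "0 < c" "K_form_bounded_below \<iota> c \<omega>"
    using Omega_imp_bounded_below[OF assms] .
  obtain M where "\<And>k. bounded_analytic \<omega> (c / 2) (M / 1 ^ (CARD('f) ^ k - 1)) (\<alpha> k)"
    using bounded_analytic_\<alpha>[OF c zero_less_one] by metis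
  then obtain d where "has_partial_deriv i (\<alpha> k) \<omega> d"
    using bounded_analytic_has_partial_deriv[of "c / 2"] c(1) by fastforce
  then show ?thesis
    using has_partial_deriv_imp_partial_deriv by metis
qed

lemma bounded_analytic_lattice_elt:
  fixes \<omega> :: "'c ^ 'n::finite"
  assumes "0 < \<rho>"
  obtains L where "0 < L" "bounded_analytic \<omega> \<rho> L (lattice_elt \<iota> a)"
proof -
  let ?f = "\<lambda>i x. \<iota> (A_to_K (a (Some i))) * (x $ i - \<omega> $ i)"
  define L where "L = (\<Sum>i\<in>UNIV. absval (\<iota> (A_to_K (a (Some i)))) * \<rho>) + absval (lattice_elt \<iota> a \<omega>) + 1"
  have nonneg: "0 \<le> absval (\<iota> (A_to_K (a (Some i)))) * \<rho>" for i
    using assms by simp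
  then have s: "0 \<le> (\<Sum>i\<in>UNIV. absval (\<iota> (A_to_K (a (Some i)))) * \<rho>)"
    by (intro sum_nonneg)
  have L: "0 < L" "absval (lattice_elt \<iota> a \<omega>) \<le> L"
    using s absval_nonneg[of "lattice_elt \<iota> a \<omega>"] unfolding L_def by linarith+
  have "bounded_analytic \<omega> \<rho> L (\<lambda>x. \<Sum>j\<in>UNIV. case j of None \<Rightarrow> lattice_elt \<iota> a \<omega> | Some i \<Rightarrow> ?f i x)"
  proof (rule bounded_analytic_sum[OF assms])
    fix j :: "'n option"
    show "bounded_analytic \<omega> \<rho> L (\<lambda>x. case j of None \<Rightarrow> lattice_elt \<iota> a \<omega> | Some i \<Rightarrow> ?f i x)"
    proof (cases j)
      case None
      then show ?thesis
        using bounded_analytic_mono[OF bounded_analytic_const[OF assms] L(2)] by simp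
    next
      case (Some i)
      have "absval (\<iota> (A_to_K (a (Some i)))) * \<rho> \<le> (\<Sum>i\<in>UNIV. absval (\<iota> (A_to_K (a (Some i)))) * \<rho>)"
        using nonneg by (intro member_le_sum) auto
      also have "\<dots> \<le> L"
        unfolding L_def using absval_nonneg[of "lattice_elt \<iota> a \<omega>"] by linarith
      finally show ?thesis
        using bounded_analytic_mono[OF bounded_analytic_coord[OF assms]] Some by simp
    qed
  qed (use L in auto)
  moreover have "(\<Sum>j\<in>UNIV. case j of None \<Rightarrow> lattice_elt \<iota> a \<omega> | Some i \<Rightarrow> ?f i x) = lattice_elt \<iota> a x" for x
    by (simp add: lattice_elt_def K_form_def UNIV_option_conv sum.reindex hcoord_def right_diff_distrib sum_subtractf)
  ultimately show ?thesis
    using that[OF L(1)] by simp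
qed

lemma has_partial_deriv_lattice_elt:
  fixes \<omega> :: "'c ^ 'n::finite"
  shows "has_partial_deriv i (lattice_elt \<iota> a) \<omega> (\<iota> (A_to_K (a (Some i))))"
proof -
  have eq: "lattice_elt \<iota> a (\<omega> + axis i t) - lattice_elt \<iota> a \<omega> = \<iota> (A_to_K (a (Some i))) * t" for t
  proof -
    have "lattice_elt \<iota> a (\<omega> + axis i t) - lattice_elt \<iota> a \<omega> = (\<Sum>j\<in>UNIV. \<iota> (A_to_K (a (Some j))) * (axis i t $ j))"
      by (simp add: lattice_elt_def K_form_def UNIV_option_conv sum.reindex hcoord_def distrib_left sum.distrib)
    also have "\<dots> = (\<Sum>j\<in>UNIV. if j = i then \<iota> (A_to_K (a (Some j))) * t else 0)"
      by (intro sum.cong) (auto simp: axis_def)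
    finally show ?thesis by simp
  qed
  show ?thesis
    unfolding has_partial_deriv_def eq
    by (rule Lim_transform_eventually[OF tendsto_const]) (auto simp: eventually_at_filter)
qed

text \<open>Differentiate \<open>e(\<lambda>) = 0\<close> term by term, for a period \<open>\<lambda>\<close> varying with \<open>\<omega>\<close>.\<close>

lemma partial_deriv_\<alpha>_sums:
  fixes \<omega> :: "'c ^ 'n::finite"
  assumes \<omega>: "\<omega> \<in> Omega \<iota>" and a: "a \<in> nonzero_vectors"
  shows "(\<lambda>k. partial_deriv i (\<alpha> k) \<omega> * lattice_elt \<iota> a \<omega> ^ (CARD('f) ^ k)) sums (- \<iota> (A_to_K (a (Some i))))"
proof -
  let ?q = "CARD('f)" and ?l = "lattice_elt \<iota> a" and ?a = "\<iota> (A_to_K (a (Some i)))"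
  obtain c where c: "0 < c" "K_form_bounded_below \<iota> c \<omega>"
    using Omega_imp_bounded_below[OF \<omega>] .
  then have c2: "0 < c / 2" by simp
  obtain L where L: "0 < L" "bounded_analytic \<omega> (c / 2) L ?l"
    using bounded_analytic_lattice_elt[OF c2] by metis
  \<comment> \<open>Taking the decay rate twice the bound \<open>L\<close> for the period leaves a
    factor \<open>(1 / 2) ^ k\<close> in the \<open>k\<close>-th term.\<close>
  have "0 < 2 * L" using L(1) by simp
  then obtain M where M: "0 < M" "\<And>k. bounded_analytic \<omega> (c / 2) (M / (2 * L) ^ (?q ^ k - 1)) (\<alpha> k)"
    using bounded_analytic_\<alpha>[OF c] by metis
  define h where "h = (\<lambda>k x. \<alpha> k x * ?l x ^ (?q ^ k))"
  have h: "bounded_analytic \<omega> (c / 2) (2 * M * L * (1 / 2) ^ k) (h k)" for k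
  proof -
    have "bounded_analytic \<omega> (c / 2) (M / (2 * L) ^ (?q ^ k - 1) * L ^ (?q ^ k)) (h k)"
      unfolding h_def by (intro bounded_analytic_mult bounded_analytic_power c2 M L)
    moreover have "M / (2 * L) ^ (?q ^ k - 1) * L ^ (?q ^ k) \<le> 2 * M * L * (1 / 2) ^ k"
    proof -
      define n where "n = ?q ^ k - 1"
      have n: "?q ^ k = Suc n"
        using q_gt_1 by (simp add: n_def)
      have "k < ?q ^ k"
        using q_gt_1 by (simp add: power_gt_expt)
      have "M / (2 * L) ^ (?q ^ k - 1) * L ^ (?q ^ k) = 2 * M * L * (1 / 2) ^ (?q ^ k)"
        unfolding n using L(1) by (simp add: power_mult_distrib field_simps)
      also have "\<dots> \<le> 2 * M * L * (1 / 2) ^ k"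
        using \<open>k < ?q ^ k\<close> L(1) M(1) by (intro mult_left_mono power_decreasing) auto
      finally show ?thesis .
    qed
    ultimately show ?thesis
      using bounded_analytic_mono by blast
  qed
  have null: "null_family UNIV (\<lambda>k. 2 * M * L * (1 / 2) ^ k)"
    using M(1) L(1) by (intro null_family_cmult null_family_geometric) auto
  \<comment> \<open>For \<open>k > 0\<close> the power of the period has derivative zero; for
    \<open>k = 0\<close> the period itself is differentiated, with coefficient
    \<open>\<alpha> 0 = 1\<close>.\<close>
  define d where "d = (\<lambda>k. partial_deriv i (\<alpha> k) \<omega> * ?l \<omega> ^ (?q ^ k) + (if k = 0 then ?a else 0))"
  have d: "has_partial_deriv i (h k) \<omega> (d k)" for k
  proof -
    have "has_partial_deriv i (\<lambda>x. ?l x ^ (?q ^ k)) \<omega> (if k = 0 then ?a else 0)"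
      using has_partial_deriv_frobenius[OF has_partial_deriv_lattice_elt, of k i a \<omega>]
        has_partial_deriv_lattice_elt[of i a \<omega>] by (cases "k = 0") auto
    from has_partial_deriv_mult[OF has_partial_deriv_\<alpha>[OF \<omega>, of i k] this]
    show ?thesis
      unfolding h_def d_def by (cases "k = 0") auto
  qed
  \<comment> \<open>The polydisc lies in \<open>Omega\<close>, so the moving period is a zero of the
    exponential at each of its points, not only at the centre.\<close>
  have sum0: "infsum (\<lambda>k. h k x) UNIV = 0" if x: "x \<in> polydisc \<omega> (c / 2)" for x
  proof -
    have "x \<in> polydisc \<omega> c"
      using x c(1) unfolding polydisc_def mem_Collect_eq
      by (intro allI) (drule spec, erule order.strict_trans, simp)
    then have "x \<in> Omega \<iota>"
      using bounded_below_polydisc[OF c] bounded_below_imp_Omega[OF c(1)] by blast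
    then have "(\<lambda>k. h k x) sums 0"
      using exp_lattice_sums_\<alpha>[of x "?l x"] exp_lattice_period[OF _ a, of x] by (simp add: h_def)
    moreover have "((\<lambda>k. h k x) has_sum infsum (\<lambda>k. h k x) UNIV) UNIV"
      using bounded_analytic_absval_le[OF h c2 x] by (intro ultrametric_has_sum_infsum[OF null])
    ultimately show ?thesis
      using has_sum_imp_sums sums_unique2 by metis
  qed
  have "has_partial_deriv i (\<lambda>x. infsum (\<lambda>k. h k x) UNIV) \<omega> (infsum d UNIV)"
    and dsum: "(d has_sum infsum d UNIV) UNIV"
    using has_partial_deriv_infsum[OF c2 null h d] by auto
  then have "has_partial_deriv i (\<lambda>x. 0) \<omega> (infsum d UNIV)"
    using has_partial_deriv_cong[OF c2, of \<omega> "\<lambda>x. infsum (\<lambda>k. h k x) UNIV" "\<lambda>_. 0"] sum0 by blast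
  then have "infsum d UNIV = 0"
    using has_partial_deriv_unique has_partial_deriv_const by blast
  then have "d sums 0"
    using has_sum_imp_sums[OF dsum] by simp
  moreover have "(\<lambda>k. if k = 0 then ?a else 0) sums ?a"
    using sums_If_finite[of "\<lambda>k. k = 0" "\<lambda>_. ?a"] by simp
  ultimately have "(\<lambda>n. (\<Sum>k<n. d k) - (\<Sum>k<n. if k = 0 then ?a else 0)) \<longlonglongrightarrow> 0 - ?a"
    unfolding sums_def by (intro tendsto_diff)
  then show ?thesis
    unfolding sums_def by (simp add: d_def sum.distrib)
qed

subsection \<open>Nonvanishing of the differential\<close>

text \<open>Coefficients of the Drinfeld module of the period lattice, divided by
  \<open>T\<close>.\<close>

definition phi :: "nat \<Rightarrow> 'c ^ 'n::finite \<Rightarrow> 'c" where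
  "phi m \<omega> = T_coeff (\<lambda>k. \<alpha> k \<omega>) (\<lambda>k. \<alpha> k \<omega>) m"

lemma phi_0 [simp]: "phi 0 \<omega> = 1"
  by (simp add: phi_def T_coeff.simps[of _ _ 0])

lemma phi_rec: "phi m \<omega> = \<tau> ^ (CARD('f) ^ m - 1) * \<alpha> m \<omega> - (\<Sum>j<m. phi j \<omega> * \<alpha> (m - j) \<omega> ^ (CARD('f) ^ j))"
  by (simp add: phi_def T_coeff.simps[of _ _ m])

lemma sum_phi_\<alpha>:
  assumes "0 < m"
  shows "(\<Sum>j=1..m. phi j \<omega> * \<alpha> (m - j) \<omega> ^ (CARD('f) ^ j)) = (\<tau> ^ (CARD('f) ^ m - 1) - 1) * \<alpha> m \<omega>"
proof -
  have "{..m} = insert 0 {1..m}" by auto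
  then have "(\<Sum>j=1..m. phi j \<omega> * \<alpha> (m - j) \<omega> ^ (CARD('f) ^ j)) =
      (\<Sum>j\<le>m. phi j \<omega> * \<alpha> (m - j) \<omega> ^ (CARD('f) ^ j)) - \<alpha> m \<omega>"
    by simp
  also have "(\<Sum>j\<le>m. phi j \<omega> * \<alpha> (m - j) \<omega> ^ (CARD('f) ^ j)) = \<tau> ^ (CARD('f) ^ m - 1) * \<alpha> m \<omega>"
    using phi_rec[of m \<omega>] by (simp add: lessThan_Suc_atMost[symmetric])
  finally show ?thesis by (simp add: left_diff_distrib)
qed

lemma phi_eq_0:
  fixes \<omega> :: "'c ^ 'n::finite"
  shows "\<omega> \<in> Omega \<iota> \<Longrightarrow> CARD('n option) < m \<Longrightarrow> phi m \<omega> = 0"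
  unfolding phi_def by (rule T_coeff_\<alpha>_eq_0)

text \<open>Strong induction along \<open>phi_rec\<close>. Among the powers of \<alpha>'s only the
  one with \<open>j = 0\<close> has a derivative that can be nonzero; it contributes the
  \<open>- 1\<close> in the factor on the right.\<close>

lemma has_partial_deriv_phi:
  fixes \<omega> :: "'c ^ 'n::finite"
  assumes \<omega>: "\<omega> \<in> Omega \<iota>"
  shows "\<exists>d. \<forall>m. has_partial_deriv i (phi m) \<omega> (d m) \<and>
    (0 < m \<longrightarrow> (\<Sum>j=1..m. d j * \<alpha> (m - j) \<omega> ^ (CARD('f) ^ j))
        = (\<tau> ^ (CARD('f) ^ m - 1) - 1) * partial_deriv i (\<alpha> m) \<omega>) \<and>
    (CARD('n option) < m \<longrightarrow> d m = 0)"
proof -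
  let ?q = "CARD('f)" and ?f = "\<lambda>m. partial_deriv i (\<alpha> m) \<omega>"
  have step: "has_partial_deriv i (phi m) \<omega> (\<tau> ^ (?q ^ m - 1) * ?f m -
      (\<Sum>j<m. d j * \<alpha> (m - j) \<omega> ^ (?q ^ j) + phi j \<omega> * (if j = 0 then ?f m else 0)))"
    if "\<And>j. j < m \<Longrightarrow> has_partial_deriv i (phi j) \<omega> (d j)" for m d
  proof -
    have "has_partial_deriv i (\<lambda>x. \<alpha> (m - j) x ^ (?q ^ j)) \<omega> (if j = 0 then ?f m else 0)" for j
      using has_partial_deriv_frobenius[OF has_partial_deriv_\<alpha>[OF \<omega>]] has_partial_deriv_\<alpha>[OF \<omega>, of i m]
      by (cases "j = 0") auto
    then have "has_partial_deriv i (\<lambda>x. \<Sum>j<m. phi j x * \<alpha> (m - j) x ^ (?q ^ j)) \<omega>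
        (\<Sum>j<m. d j * \<alpha> (m - j) \<omega> ^ (?q ^ j) + phi j \<omega> * (if j = 0 then ?f m else 0))"
      by (intro has_partial_deriv_sum has_partial_deriv_mult that) auto
    moreover have "has_partial_deriv i (\<lambda>x. \<tau> ^ (?q ^ m - 1) * \<alpha> m x) \<omega> (\<tau> ^ (?q ^ m - 1) * ?f m)"
      using has_partial_deriv_mult[OF has_partial_deriv_const has_partial_deriv_\<alpha>[OF \<omega>]] by simp
    ultimately have "has_partial_deriv i (\<lambda>x. \<tau> ^ (?q ^ m - 1) * \<alpha> m x - (\<Sum>j<m. phi j x * \<alpha> (m - j) x ^ (?q ^ j))) \<omega>
      (\<tau> ^ (?q ^ m - 1) * ?f m - (\<Sum>j<m. d j * \<alpha> (m - j) \<omega> ^ (?q ^ j) + phi j \<omega> * (if j = 0 then ?f m else 0)))"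
      by (rule has_partial_deriv_diff[rotated])
    then show ?thesis
      by (simp only: phi_rec[of m, symmetric])
  qed
  have "\<exists>d. has_partial_deriv i (phi m) \<omega> d" for m
  proof (induction m rule: less_induct)
    case (less m)
    then obtain d where "\<And>j. j < m \<Longrightarrow> has_partial_deriv i (phi j) \<omega> (d j)"
      by metis
    then show ?case using step by blast
  qed
  then obtain d where d: "\<And>m. has_partial_deriv i (phi m) \<omega> (d m)"
    by metis
  have d0: "d 0 = 0"
    by (rule has_partial_deriv_unique[OF d[of 0]]) (simp add: phi_0[abs_def])
  have "(\<Sum>j=1..m. d j * \<alpha> (m - j) \<omega> ^ (?q ^ j)) = (\<tau> ^ (?q ^ m - 1) - 1) * ?f m" if m: "0 < m" for m
  proof -
    let ?s = "\<lambda>j. d j * \<alpha> (m - j) \<omega> ^ (?q ^ j)"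
    have "d m = \<tau> ^ (?q ^ m - 1) * ?f m - (\<Sum>j<m. ?s j + phi j \<omega> * (if j = 0 then ?f m else 0))"
      using has_partial_deriv_unique[OF d[of m] step[OF d]] .
    also have "(\<Sum>j<m. ?s j + phi j \<omega> * (if j = 0 then ?f m else 0)) = (\<Sum>j<m. ?s j) + (\<Sum>j<m. if j = 0 then ?f m else 0)"
      unfolding sum.distrib by (intro arg_cong2[where f = "(+)"] sum.cong) auto
    finally have "d m = \<tau> ^ (?q ^ m - 1) * ?f m - ((\<Sum>j<m. ?s j) + ?f m)"
      using m by simp
    moreover have "{1..m} = insert m {1..<m}" "{..<m} = insert 0 {1..<m}"
      using m by auto
    then have "(\<Sum>j=1..m. ?s j) = d m + (\<Sum>j<m. ?s j)"
      by (simp add: d0)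
    ultimately show ?thesis by (simp add: left_diff_distrib)
  qed
  \<comment> \<open>Vanishing at one point would not suffice: \<open>phi m\<close> is zero on a
    polydisc around \<open>\<omega>\<close>.\<close>
  moreover have "d m = 0" if m: "CARD('n option) < m" for m
  proof -
    obtain c where c: "0 < c" "K_form_bounded_below \<iota> c \<omega>"
      using Omega_imp_bounded_below[OF \<omega>] .
    have "phi m x = 0" if "x \<in> polydisc \<omega> c" for x
      using bounded_below_polydisc[OF c that] bounded_below_imp_Omega[OF c(1)] phi_eq_0 m by blast
    then have "has_partial_deriv i (\<lambda>_. 0) \<omega> (d m)"
      using has_partial_deriv_cong[OF c(1), of \<omega> "phi m" "\<lambda>_. 0"] d by blast
    then show ?thesis
      using has_partial_deriv_unique has_partial_deriv_const by blast
  qed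
  ultimately show ?thesis
    using d by (intro exI[of _ d]) simp
qed

lemma infinite_nonzero_vectors: "infinite (nonzero_vectors :: ('n::finite option \<Rightarrow> 'f poly) set)"
proof
  assume fin: "finite (nonzero_vectors :: ('n option \<Rightarrow> 'f poly) set)"
  have "inj (\<lambda>n (_ :: 'n option). monom (1 :: 'f) n)"
    by (auto simp: inj_def fun_eq_iff monom_eq_iff')
  then have "infinite (range (\<lambda>n (_ :: 'n option). monom (1 :: 'f) n))"
    by (rule range_inj_infinite)
  moreover have "range (\<lambda>n (_ :: 'n option). monom (1 :: 'f) n) \<subseteq> nonzero_vectors"
    by (auto simp: monom_eq_0_iff)
  ultimately show False
    using fin finite_subset by blast
qed

text \<open>
  In the matrix, the row of the \<open>\<phi>\<^sub>j\<close> themselves replaces their derivatives with respect to the coordinate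
  \<open>\<omega>\<^sub>r\<close>, which is normalized to \<open>1\<close>.
\<close>

lemma \<alpha>_differential_nonzero:
  fixes \<omega> :: "'c ^ 'n::finite"
  assumes \<omega>: "\<omega> \<in> Omega \<iota>" and zero: "\<alpha> k \<omega> = 0"
  obtains i where "partial_deriv i (\<alpha> k) \<omega> \<noteq> 0"
proof (rule ccontr)
  let ?q = "CARD('f)" and ?r = "CARD('n option)"
  assume "\<not> thesis"
  then have pd0: "partial_deriv i (\<alpha> k) \<omega> = 0" for i
    using that by blast
  have k: "0 < k"
    using zero \<alpha>_0[of \<omega>] by (cases k) auto
  obtain D where "\<forall>i m. has_partial_deriv i (phi m) \<omega> (D i m) \<and>
    (0 < m \<longrightarrow> (\<Sum>j=1..m. D i j * \<alpha> (m - j) \<omega> ^ (?q ^ j)) = (\<tau> ^ (?q ^ m - 1) - 1) * partial_deriv i (\<alpha> m) \<omega>) \<and>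
    (?r < m \<longrightarrow> D i m = 0)"
    using choice[OF allI[OF has_partial_deriv_phi[OF \<omega>]]] ..
  then have D: "\<And>i m. 0 < m \<Longrightarrow> (\<Sum>j=1..m. D i j * \<alpha> (m - j) \<omega> ^ (?q ^ j)) = (\<tau> ^ (?q ^ m - 1) - 1) * partial_deriv i (\<alpha> m) \<omega>"
    "\<And>i m. ?r < m \<Longrightarrow> D i m = 0"
    by simp_all
  \<comment> \<open>\<open>None\<close> stands for the functions themselves and
    \<open>Some i\<close> for their derivatives; \<open>Ey\<close> is the relation that all these
    rows share.\<close>
  define E where "E = (\<lambda>p j. case p of None \<Rightarrow> phi j \<omega> | Some i \<Rightarrow> D i j)"
  define y where "y = (\<lambda>p m. case p of None \<Rightarrow> \<alpha> m \<omega> | Some i \<Rightarrow> partial_deriv i (\<alpha> m) \<omega>)"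
  have Ey: "(\<Sum>j=1..m. E p j * \<alpha> (m - j) \<omega> ^ (?q ^ j)) = (\<tau> ^ (?q ^ m - 1) - 1) * y p m" if "0 < m" for p m
    using D(1)[OF that] sum_phi_\<alpha>[OF that] by (cases p) (auto simp: E_def y_def)
  have E0: "E p m = 0" if "?r < m" for p m
    using D(2)[OF that] phi_eq_0[OF \<omega> that] by (cases p) (auto simp: E_def)
  have \<tau>m: "\<tau> ^ (?q ^ m - 1) - 1 \<noteq> 0" if "0 < m" for m
    using \<tau>_power_neq_1[of "?q ^ m - 1"] one_less_power[OF q_gt_1 that] by simp
  \<comment> \<open>Matrices are indexed by types, so the columns \<open>1, ..., r\<close> are
    labelled by the coordinate indices through \<open>l\<close>.\<close>
  obtain h where h: "bij_betw h {1..?r} (UNIV :: 'n option set)"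
    using ex_bij_betw_nat_finite_1[of "UNIV :: 'n option set"] by auto
  define l where "l = inv_into {1..?r} h"
  have l: "bij_betw l (UNIV :: 'n option set) {1..?r}"
    unfolding l_def by (rule bij_betw_inv_into[OF h])
  define A :: "'c ^ 'n option ^ 'n option" where "A = (\<chi> p s. E p (l s))"
  have rows: "v p = 0" if v: "(\<Sum>p\<in>UNIV. v p *s row p A) = 0" for v p
  proof -
    have vE: "(\<Sum>p\<in>UNIV. v p * E p j) = 0" if "0 < j" for j
    proof (cases "j \<le> ?r")
      case True
      then have "j \<in> {1..?r}" using that by simp
      then obtain s where s: "j = l s"
        using l unfolding bij_betw_def by blast
      have "(\<Sum>p\<in>UNIV. v p *s row p A) $ s = 0"
        using v by simp
      then show ?thesis
        by (simp add: sum_component row_def A_def s)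
    next
      case False
      then show ?thesis by (simp add: E0)
    qed
    have vy: "(\<Sum>p\<in>UNIV. v p * y p m) = 0" if m: "0 < m" for m
    proof -
      have "(\<tau> ^ (?q ^ m - 1) - 1) * (\<Sum>p\<in>UNIV. v p * y p m) = (\<Sum>p\<in>UNIV. v p * ((\<tau> ^ (?q ^ m - 1) - 1) * y p m))"
        by (simp add: sum_distrib_left mult.left_commute)
      also have "\<dots> = (\<Sum>p\<in>UNIV. \<Sum>j=1..m. v p * (E p j * \<alpha> (m - j) \<omega> ^ (?q ^ j)))"
        unfolding Ey[OF m, symmetric] sum_distrib_left ..
      also have "\<dots> = (\<Sum>j=1..m. \<Sum>p\<in>UNIV. v p * (E p j * \<alpha> (m - j) \<omega> ^ (?q ^ j)))"
        by (rule sum.swap)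
      also have "\<dots> = (\<Sum>j=1..m. (\<Sum>p\<in>UNIV. v p * E p j) * \<alpha> (m - j) \<omega> ^ (?q ^ j))"
        by (simp add: sum_distrib_right mult.assoc)
      also have "\<dots> = 0"
        by (rule sum.neutral) (use vE in auto)
      finally show ?thesis using \<tau>m[OF m] by simp
    qed
    have rel: "v None * lattice_elt \<iota> a \<omega> = - (\<Sum>i\<in>UNIV. v (Some i) * \<iota> (A_to_K (a (Some i))))"
      if a: "a \<in> nonzero_vectors" for a
    proof -
      let ?l = "lattice_elt \<iota> a \<omega>"
      define t where "t = (\<lambda>p. case p of None \<Rightarrow> 0 | Some i \<Rightarrow> - \<iota> (A_to_K (a (Some i))))"
      have "(\<lambda>m. y p m * ?l ^ (?q ^ m)) sums t p" for p
        using partial_deriv_\<alpha>_sums[OF \<omega> a] exp_lattice_sums_\<alpha>[OF \<omega>, of ?l] exp_lattice_period[OF \<omega> a]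
        by (cases p) (auto simp: y_def t_def)
      then have "(\<lambda>n. \<Sum>p\<in>UNIV. v p * (\<Sum>m<n. y p m * ?l ^ (?q ^ m))) \<longlonglongrightarrow> (\<Sum>p\<in>UNIV. v p * t p)"
        unfolding sums_def by (intro tendsto_sum tendsto_mult tendsto_const)
      moreover have "(\<Sum>p\<in>UNIV. v p * (\<Sum>m<n. y p m * ?l ^ (?q ^ m))) = (\<Sum>m<n. (\<Sum>p\<in>UNIV. v p * y p m) * ?l ^ (?q ^ m))" for n
        unfolding sum_distrib_left sum_distrib_right by (subst sum.swap) (simp add: mult.assoc)
      ultimately have 1: "(\<lambda>m. (\<Sum>p\<in>UNIV. v p * y p m) * ?l ^ (?q ^ m)) sums (\<Sum>p\<in>UNIV. v p * t p)"
        by (simp add: sums_def)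
      have 2: "(\<lambda>m. (\<Sum>p\<in>UNIV. v p * y p m) * ?l ^ (?q ^ m)) = (\<lambda>m. if m = 0 then v None * ?l else 0)"
      proof
        fix m
        have "(\<Sum>p\<in>UNIV. v p * y p 0) = v None"
        proof -
          have "partial_deriv i (\<alpha> 0) \<omega> = 0" for i
            using has_partial_deriv_imp_partial_deriv[OF has_partial_deriv_const[of i 1 \<omega>]]
            by (simp add: \<alpha>_0[abs_def])
          then show ?thesis
            by (simp add: y_def UNIV_option_conv sum.reindex)
        qed
        then show "(\<Sum>p\<in>UNIV. v p * y p m) * ?l ^ (?q ^ m) = (if m = 0 then v None * ?l else 0)"
          using vy[of m] by (cases "m = 0") auto
      qed
      have "(\<lambda>m. if m = 0 then v None * ?l else 0) sums (v None * ?l)"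
        using sums_If_finite[of "\<lambda>m. m = 0" "\<lambda>_. v None * ?l"] by simp
      with 1 have "(\<Sum>p\<in>UNIV. v p * t p) = v None * ?l"
        unfolding 2 by (rule sums_unique2)
      moreover have "(\<Sum>p\<in>UNIV. v p * t p) = - (\<Sum>i\<in>UNIV. v (Some i) * \<iota> (A_to_K (a (Some i))))"
        by (simp add: t_def UNIV_option_conv sum.reindex sum_negf)
      ultimately show ?thesis by simp
    qed
    \<comment> \<open>Unit vectors: the period 1 belongs to \<open>None\<close> and has all other
      coefficients zero, giving \<open>v None = 0\<close>; the period \<open>\<omega>_i\<close> then
      isolates \<open>v (Some i)\<close>.\<close>
    define e where "e = (\<lambda>(s :: 'n option) p. if p = s then 1 else 0 :: 'f poly)"
    have e: "e s \<in> nonzero_vectors" for s :: "'n option"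
      by (auto simp: e_def)
    have "lattice_elt \<iota> (e None) \<omega> = 1"
      by (simp add: lattice_elt_def K_form_def e_def UNIV_option_conv sum.reindex hcoord_def hom_one)
    then have vN: "v None = 0"
      using rel[OF e[of None]] by (simp add: e_def)
    have "v (Some i) = 0" for i
    proof -
      have "(\<Sum>j\<in>UNIV. v (Some j) * \<iota> (A_to_K (e (Some i) (Some j)))) = 0"
        using rel[OF e[of "Some i"]] vN by simp
      moreover have "(\<Sum>j\<in>UNIV. v (Some j) * \<iota> (A_to_K (e (Some i) (Some j)))) = (\<Sum>j\<in>UNIV. if j = i then v (Some j) else 0)"
        by (intro sum.cong) (auto simp: e_def hom_one)
      ultimately show ?thesis by simp
    qed
    then show "v p = 0" using vN by (cases p) auto
  qed
  have "\<exists>B. A ** B = mat 1"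
    unfolding matrix_right_invertible_independent_rows using rows by blast
  then have ker: "x = 0" if "A *v x = 0" for x
    using that matrix_left_right_inverse matrix_left_invertible_ker[of A] by blast
  \<comment> \<open>The column of the \<open>q^j\<close>-th powers in the relation for
    \<open>m = k\<close>. For \<open>j > k\<close> the entry must be 0, whereas truncated
    subtraction would produce \<open>\<alpha> 0 = 1\<close>.\<close>
  define x where "x = (\<chi> s. if l s \<le> k then \<alpha> (k - l s) \<omega> ^ (?q ^ l s) else 0)"
  have "(A *v x) $ p = 0" for p
  proof -
    have "y p k = 0"
      using pd0 zero by (cases p) (auto simp: y_def)
    have "(A *v x) $ p = (\<Sum>s\<in>UNIV. E p (l s) * (if l s \<le> k then \<alpha> (k - l s) \<omega> ^ (?q ^ l s) else 0))"
      by (simp add: matrix_vector_mult_def A_def x_def)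
    also have "\<dots> = (\<Sum>j=1..?r. E p j * (if j \<le> k then \<alpha> (k - j) \<omega> ^ (?q ^ j) else 0))"
      using sum.reindex_bij_betw[OF l, of "\<lambda>j. E p j * (if j \<le> k then \<alpha> (k - j) \<omega> ^ (?q ^ j) else 0)"] .
    \<comment> \<open>Passing through the longer range covers both cases: beyond \<open>r\<close>
      the factor \<open>E p j\<close> vanishes, beyond \<open>k\<close> the conditional
      does.\<close>
    also have "\<dots> = (\<Sum>j=1..max ?r k. E p j * (if j \<le> k then \<alpha> (k - j) \<omega> ^ (?q ^ j) else 0))"
      by (rule sum.mono_neutral_left) (auto simp: E0)
    also have "\<dots> = (\<Sum>j=1..k. E p j * (if j \<le> k then \<alpha> (k - j) \<omega> ^ (?q ^ j) else 0))"
      by (rule sum.mono_neutral_right) auto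
    also have "\<dots> = (\<Sum>j=1..k. E p j * \<alpha> (k - j) \<omega> ^ (?q ^ j))"
      by (intro sum.cong) auto
    also have "\<dots> = 0"
      using Ey[OF k, of p] \<open>y p k = 0\<close> by simp
    finally show ?thesis .
  qed
  then have "A *v x = 0"
    by (simp only: vec_eq_iff zero_index) simp
  then have "x = 0"
    by (rule ker)
  have \<alpha>0: "\<alpha> (k - j) \<omega> = 0" if "1 \<le> j" "j \<le> ?r" "j \<le> k" for j
  proof -
    have "j \<in> {1..?r}" using that by simp
    then obtain s where s: "j = l s"
      using l unfolding bij_betw_def by blast
    have "x $ s = 0" using \<open>x = 0\<close> by simp
    then have "\<alpha> (k - j) \<omega> ^ (?q ^ j) = 0"
      using that unfolding x_def s by simp
    then show ?thesis by simp
  qed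
  show False
  proof (cases "k \<le> ?r")
    case True
    then show False using \<alpha>0[of k] k by simp
  next
    case False
    \<comment> \<open>All coefficients from \<open>k - r\<close> to \<open>k\<close> vanish; since
      the recursion reaches back only \<open>r\<close> steps, the zeros propagate upwards.\<close>
    have tail: "\<alpha> m \<omega> = 0" if "k - ?r \<le> m" for m
      using that
    proof (induction m rule: less_induct)
      case (less m)
      consider "m = k" | "m < k" | "k < m" by linarith
      then show ?case
      proof cases
        case 1
        then show ?thesis using zero by simp
      next
        case 2
        then show ?thesis using \<alpha>0[of "k - m"] less.prems by simp
      next
        case 3
        then have m: "0 < m" by simp
        have "phi j \<omega> * \<alpha> (m - j) \<omega> ^ (?q ^ j) = 0" if "j \<in> {1..m}" for j
        proof (cases "j \<le> ?r")
          case True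
          then have "\<alpha> (m - j) \<omega> = 0"
            using 3 that by (intro less.IH) auto
          then show ?thesis by simp
        next
          case False
          then show ?thesis using phi_eq_0[OF \<omega>] by simp
        qed
        then have "(\<tau> ^ (?q ^ m - 1) - 1) * \<alpha> m \<omega> = 0"
          unfolding sum_phi_\<alpha>[OF m, symmetric] by (rule sum.neutral[OF ballI])
        then show ?thesis using \<tau>m[OF m] by simp
      qed
    qed
    define P where "P = (\<Sum>m<k - ?r. monom (\<alpha> m \<omega>) (?q ^ m))"
    \<comment> \<open>The linear coefficient of \<open>P\<close> is \<open>\<alpha> 0 = 1\<close>,
      which makes \<open>P\<close> nonzero.\<close>
    have "coeff P 1 = (\<Sum>m<k - ?r. if m = 0 then 1 else 0)"
      unfolding P_def coeff_sum
    proof (rule sum.cong)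
      fix m
      show "coeff (monom (\<alpha> m \<omega>) (?q ^ m)) 1 = (if m = 0 then 1 else 0)"
      proof (cases "m = 0")
        case False
        then have "1 < ?q ^ m"
          by (intro one_less_power[OF q_gt_1]) simp
        then have "?q ^ m \<noteq> 1"
          by (rule less_imp_neq[THEN not_sym])
        then show ?thesis
          using False by (simp only: coeff_monom if_False)
      qed simp
    qed simp
    then have "coeff P 1 = 1"
      using False by simp
    then have "P \<noteq> 0" by auto
    have "poly P (lattice_elt \<iota> a \<omega>) = 0" if a: "a \<in> nonzero_vectors" for a
    proof -
      have "(\<lambda>m. \<alpha> m \<omega> * lattice_elt \<iota> a \<omega> ^ (?q ^ m)) sums (\<Sum>m<k - ?r. \<alpha> m \<omega> * lattice_elt \<iota> a \<omega> ^ (?q ^ m))"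
        by (rule sums_finite) (auto simp: tail)
      then show ?thesis
        using exp_lattice_sums_\<alpha>[OF \<omega>, of "lattice_elt \<iota> a \<omega>"] exp_lattice_period[OF \<omega> a] sums_unique2
        by (fastforce simp: P_def poly_sum poly_monom)
    qed
    then have "(\<lambda>a. lattice_elt \<iota> a \<omega>) ` nonzero_vectors \<subseteq> {z. poly P z = 0}"
      by blast
    then have "finite ((\<lambda>a. lattice_elt \<iota> a \<omega>) ` nonzero_vectors)"
      using poly_roots_finite[OF \<open>P \<noteq> 0\<close>] finite_subset by blast
    moreover have "inj_on (\<lambda>a. lattice_elt \<iota> a \<omega>) nonzero_vectors"
      using lattice_elt_eq_iff[OF \<omega>] by (auto simp: inj_on_def)
    ultimately show False
      using finite_imageD infinite_nonzero_vectors by blast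
  qed
qed

end

subsection \<open>Affinoid functions\<close>

lemma polynomial_fun_const: "polynomial_fun (\<lambda>_. a)"
  unfolding polynomial_fun_def
  by (intro exI[of _ "{\<lambda>_. 0}"] exI[of _ "\<lambda>_. a"]) (simp add: monomial_at_def)

lemma polynomial_fun_coord: "polynomial_fun (\<lambda>x. x $ i)"
  unfolding polynomial_fun_def
  by (intro exI[of _ "{unit_index i}"] exI[of _ "\<lambda>_. 1"]) simp

lemma polynomial_fun_add:
  assumes "polynomial_fun p" "polynomial_fun s"
  shows "polynomial_fun (\<lambda>x. p x + s x)"
proof -
  obtain M c where p: "finite M" "p = (\<lambda>x. \<Sum>m\<in>M. c m * monomial_at 0 m x)"
    using assms(1) unfolding polynomial_fun_def by blast
  obtain N d where s: "finite N" "s = (\<lambda>x. \<Sum>m\<in>N. d m * monomial_at 0 m x)"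
    using assms(2) unfolding polynomial_fun_def by blast
  define e where "e = (\<lambda>m. (if m \<in> M then c m else 0) + (if m \<in> N then d m else 0))"
  have "p x = (\<Sum>m\<in>M \<union> N. (if m \<in> M then c m else 0) * monomial_at 0 m x)" for x
    unfolding p(2) using p(1) s(1) by (intro sum.mono_neutral_cong_left) auto
  moreover have "s x = (\<Sum>m\<in>M \<union> N. (if m \<in> N then d m else 0) * monomial_at 0 m x)" for x
    unfolding s(2) using p(1) s(1) by (intro sum.mono_neutral_cong_left) auto
  ultimately have "(\<lambda>x. p x + s x) = (\<lambda>x. \<Sum>m\<in>M \<union> N. e m * monomial_at 0 m x)"
    by (simp only: e_def distrib_right sum.distrib)
  then show ?thesis
    unfolding polynomial_fun_def using p(1) s(1) by blast
qed

lemma polynomial_fun_mult: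
  assumes "polynomial_fun p" "polynomial_fun s"
  shows "polynomial_fun (\<lambda>x. p x * s x)"
proof -
  obtain M c where p: "finite M" "p = (\<lambda>x. \<Sum>m\<in>M. c m * monomial_at 0 m x)"
    using assms(1) unfolding polynomial_fun_def by blast
  obtain N d where s: "finite N" "s = (\<lambda>x. \<Sum>m\<in>N. d m * monomial_at 0 m x)"
    using assms(2) unfolding polynomial_fun_def by blast
  define h :: "('b \<Rightarrow> nat) \<times> ('b \<Rightarrow> nat) \<Rightarrow> 'b \<Rightarrow> nat" where "h = (\<lambda>(m, k) i. m i + k i)"
  define e where "e = (\<lambda>m. \<Sum>z\<in>{z \<in> M \<times> N. h z = m}. c (fst z) * d (snd z))"
  have "p x * s x = (\<Sum>m\<in>h ` (M \<times> N). e m * monomial_at 0 m x)" for x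
  proof -
    have "p x * s x = (\<Sum>z\<in>M \<times> N. c (fst z) * d (snd z) * monomial_at 0 (h z) x)"
      unfolding p(2) s(2) sum_product sum.cartesian_product
      by (intro sum.cong) (auto simp: h_def monomial_at_add)
    also have "\<dots> = (\<Sum>m\<in>h ` (M \<times> N). \<Sum>z\<in>{z \<in> M \<times> N. h z = m}. c (fst z) * d (snd z) * monomial_at 0 (h z) x)"
      by (rule sum.image_gen) (use p(1) s(1) in simp)
    also have "\<dots> = (\<Sum>m\<in>h ` (M \<times> N). e m * monomial_at 0 m x)"
      unfolding e_def sum_distrib_right by (intro sum.cong) auto
    finally show ?thesis .
  qed
  then show ?thesis
    unfolding polynomial_fun_def using p(1) s(1)
    by (intro exI[of _ "h ` (M \<times> N)"] exI[of _ e]) (simp add: fun_eq_iff)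
qed

lemma polynomial_fun_sum:
  "(\<And>i. i \<in> I \<Longrightarrow> polynomial_fun (f i)) \<Longrightarrow> polynomial_fun (\<lambda>x. \<Sum>i\<in>I. f i x)"
  by (induction I rule: infinite_finite_induct) (auto intro: polynomial_fun_const polynomial_fun_add)

definition rational_fun :: "('c::field ^ 'n::finite) set \<Rightarrow> ('c ^ 'n \<Rightarrow> 'c) \<Rightarrow> bool" where
  "rational_fun U f \<longleftrightarrow> (\<exists>p s. polynomial_fun p \<and> polynomial_fun s \<and> (\<forall>x\<in>U. s x \<noteq> 0 \<and> f x = p x / s x))"

lemma rational_fun_polynomial: "polynomial_fun p \<Longrightarrow> rational_fun U p"
  unfolding rational_fun_def by (intro exI[of _ p] exI[of _ "\<lambda>_. 1"]) (simp add: polynomial_fun_const)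

lemma rational_fun_add:
  assumes "rational_fun U f" "rational_fun U h"
  shows "rational_fun U (\<lambda>x. f x + h x)"
proof -
  obtain p s where f: "polynomial_fun p" "polynomial_fun s" "\<And>x. x \<in> U \<Longrightarrow> s x \<noteq> 0 \<and> f x = p x / s x"
    using assms(1) unfolding rational_fun_def by blast
  obtain p' s' where h: "polynomial_fun p'" "polynomial_fun s'" "\<And>x. x \<in> U \<Longrightarrow> s' x \<noteq> 0 \<and> h x = p' x / s' x"
    using assms(2) unfolding rational_fun_def by blast
  show ?thesis
    unfolding rational_fun_def using f h
    by (intro exI[of _ "\<lambda>x. p x * s' x + p' x * s x"] exI[of _ "\<lambda>x. s x * s' x"])
       (auto intro!: polynomial_fun_add polynomial_fun_mult simp: add_frac_eq)
qed

lemma rational_fun_mult: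
  assumes "rational_fun U f" "rational_fun U h"
  shows "rational_fun U (\<lambda>x. f x * h x)"
proof -
  obtain p s where f: "polynomial_fun p" "polynomial_fun s" "\<And>x. x \<in> U \<Longrightarrow> s x \<noteq> 0 \<and> f x = p x / s x"
    using assms(1) unfolding rational_fun_def by blast
  obtain p' s' where h: "polynomial_fun p'" "polynomial_fun s'" "\<And>x. x \<in> U \<Longrightarrow> s' x \<noteq> 0 \<and> h x = p' x / s' x"
    using assms(2) unfolding rational_fun_def by blast
  show ?thesis
    unfolding rational_fun_def using f h
    by (intro exI[of _ "\<lambda>x. p x * p' x"] exI[of _ "\<lambda>x. s x * s' x"]) (auto intro!: polynomial_fun_mult)
qed

lemma rational_fun_sum:
  "(\<And>i. i \<in> I \<Longrightarrow> rational_fun U (f i)) \<Longrightarrow> rational_fun U (\<lambda>x. \<Sum>i\<in>I. f i x)"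
  by (induction I rule: infinite_finite_induct)
     (auto intro: rational_fun_polynomial polynomial_fun_const rational_fun_add)

lemma rational_fun_prod:
  "(\<And>i. i \<in> I \<Longrightarrow> rational_fun U (f i)) \<Longrightarrow> rational_fun U (\<lambda>x. \<Prod>i\<in>I. f i x)"
  by (induction I rule: infinite_finite_induct)
     (auto intro: rational_fun_polynomial polynomial_fun_const rational_fun_mult)

lemma polynomial_fun_hcoord: "polynomial_fun (\<lambda>x. hcoord x j)"
  by (cases j) (auto simp: hcoord_def intro: polynomial_fun_const polynomial_fun_coord)

lemma polynomial_fun_lattice_elt: "polynomial_fun (lattice_elt \<iota> a)"
  unfolding lattice_elt_def[abs_def] K_form_def
  by (intro polynomial_fun_sum polynomial_fun_mult polynomial_fun_const polynomial_fun_hcoord)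

subsection \<open>Smoothness\<close>

lemma analytic_germ_const: "analytic_germ \<omega> (\<lambda>_. a)"
  by (rule bounded_analytic_imp_analytic_germ[OF _ bounded_analytic_const, of 1]) auto

lemma generator_in_germ_ideal:
  assumes "analytic_germ \<omega> f"
  shows "f \<in> germ_ideal \<omega> {f}"
  unfolding germ_ideal_def using assms
  by (auto intro!: exI[of _ "{f}"] exI[of _ "\<lambda>_ _. 1"] analytic_germ_const)

text \<open>An identity that holds eventually in \<open>nhds \<omega>\<close> holds at
  \<open>\<omega>\<close> itself.\<close>

lemma germ_ideal_eq_0:
  assumes "h \<in> germ_ideal \<omega> G" "\<And>f. f \<in> G \<Longrightarrow> f \<omega> = 0"
  shows "h \<omega> = 0"
proof -
  obtain S u where S: "S \<subseteq> G" "\<forall>\<^sub>F x in nhds \<omega>. h x = (\<Sum>f\<in>S. u f x * f x)"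
    using assms(1) unfolding germ_ideal_def by blast
  have "h \<omega> = (\<Sum>f\<in>S. u f \<omega> * f \<omega>)"
    by (rule eventually_nhds_x_imp_x[OF S(2)])
  also have "\<dots> = 0"
    using assms(2) S(1) by (intro sum.neutral) auto
  finally show ?thesis .
qed

context completed_algebraic_closure
begin

text \<open>Agreement with \<alpha> is known only on \<open>Omega\<close>; a polydisc inside
  \<open>Omega\<close> is what transfers analyticity and derivatives.\<close>

lemma para_Eisenstein_bounded_analytic:
  fixes \<omega> :: "'c ^ 'n::finite"
  assumes "\<omega> \<in> Omega \<iota>"
  obtains \<rho> b where "0 < \<rho>" "bounded_analytic \<omega> \<rho> b (para_Eisenstein \<iota> k)"
    "\<forall>x\<in>polydisc \<omega> \<rho>. para_Eisenstein \<iota> k x = \<alpha> k x"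
proof -
  obtain c where c: "0 < c" "K_form_bounded_below \<iota> c \<omega>"
    using Omega_imp_bounded_below[OF assms] .
  obtain M where M: "bounded_analytic \<omega> (c / 2) (M / 1 ^ (CARD('f) ^ k - 1)) (\<alpha> k)"
    using bounded_analytic_\<alpha>[OF c zero_less_one] by metis
  have eq: "para_Eisenstein \<iota> k x = \<alpha> k x" if "x \<in> polydisc \<omega> (c / 2)" for x
  proof -
    have "x \<in> polydisc \<omega> c"
      using that c(1) unfolding polydisc_def mem_Collect_eq
      by (intro allI) (drule spec, erule order.strict_trans, simp)
    then have "x \<in> Omega \<iota>"
      using bounded_below_polydisc[OF c] bounded_below_imp_Omega[OF c(1)] by blast
    then show ?thesis by (rule para_Eisenstein_eq)
  qed
  show ?thesis
  proof (rule that)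
    show "0 < c / 2" using c(1) by simp
    show "bounded_analytic \<omega> (c / 2) (M / 1 ^ (CARD('f) ^ k - 1)) (para_Eisenstein \<iota> k)"
      using M by (rule bounded_analytic_cong) (simp add: eq)
  qed (use eq in blast)
qed

lemma para_Eisenstein_analytic_germ:
  fixes \<omega> :: "'c ^ 'n::finite"
  assumes "\<omega> \<in> Omega \<iota>"
  shows "analytic_germ \<omega> (para_Eisenstein \<iota> k)"
  by (rule para_Eisenstein_bounded_analytic[OF assms]) (rule bounded_analytic_imp_analytic_germ)

lemma partial_deriv_para_Eisenstein:
  fixes \<omega> :: "'c ^ 'n::finite"
  assumes "\<omega> \<in> Omega \<iota>"
  shows "partial_deriv i (para_Eisenstein \<iota> k) \<omega> = partial_deriv i (\<alpha> k) \<omega>"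
proof -
  obtain \<rho> b where "0 < \<rho>" "bounded_analytic \<omega> \<rho> b (para_Eisenstein \<iota> k)"
      "\<forall>x\<in>polydisc \<omega> \<rho>. para_Eisenstein \<iota> k x = \<alpha> k x"
    by (rule para_Eisenstein_bounded_analytic[OF assms])
  then have "has_partial_deriv i (para_Eisenstein \<iota> k) \<omega> (partial_deriv i (\<alpha> k) \<omega>)"
    using has_partial_deriv_\<alpha>[OF assms] has_partial_deriv_cong[of \<rho> \<omega> "para_Eisenstein \<iota> k" "\<alpha> k"] by blast
  then show ?thesis
    by (rule has_partial_deriv_imp_partial_deriv)
qed

text \<open>Keeping only the finitely many sets whose weight reaches \<open>e / 2\<close> gives a
  rational function without poles on the affinoid. The error is uniform because the weights depend
  on \<open>n\<close> alone.\<close>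

lemma para_Eisenstein_affinoid_fun:
  "affinoid_fun (Omega_aff \<iota> n) (para_Eisenstein \<iota> k :: 'c ^ 'n::finite \<Rightarrow> 'c)"
  unfolding affinoid_fun_def
proof safe
  fix e :: real
  assume e: "0 < e"
  let ?U = "Omega_aff \<iota> n :: ('c ^ 'n) set" and ?m = "CARD('f) ^ k - 1"
  define c where "c = 1 / real CARD('f) ^ n"
  have c: "0 < c"
    using q_gt_1 by (simp add: c_def)
  define X :: "('n option \<Rightarrow> 'f poly) set set"
    where "X = {S \<in> vector_sets ?m. e / 2 \<le> (\<Prod>a\<in>S. weight c a)}"
  have X: "finite X" "X \<subseteq> vector_sets ?m"
  proof -
    show "finite X"
      unfolding X_def
      by (rule null_family_vector_sets[OF c, of ?m, unfolded null_family_def, rule_format, OF half_gt_zero[OF e]])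
  qed (auto simp: X_def)
  define r where "r = (\<lambda>x :: 'c ^ 'n. \<Sum>S\<in>X. \<Prod>a\<in>S. - 1 / lattice_elt \<iota> a x)"
  have U: "x \<in> Omega \<iota>" "K_form_bounded_below \<iota> c x" if "x \<in> ?U" for x
    using that Omega_aff_bounded_below[OF that] by (auto simp: Omega_aff_def c_def)
  have "rational_fun ?U (\<lambda>x. - 1 / lattice_elt \<iota> a x)" if "a \<in> nonzero_vectors" for a
    unfolding rational_fun_def
    using U(1) lattice_elt_eq_0_iff that
    by (intro exI[of _ "\<lambda>_. - 1"] exI[of _ "lattice_elt \<iota> a"])
       (auto intro: polynomial_fun_const polynomial_fun_lattice_elt)
  moreover have "a \<in> nonzero_vectors" if "S \<in> X" "a \<in> S" for S a
    using X(2) that unfolding vector_sets_def Fpow_def by blast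
  ultimately have "rational_fun ?U r"
    unfolding r_def by (intro rational_fun_sum rational_fun_prod) blast
  then obtain p s where ps: "polynomial_fun p" "polynomial_fun s" "\<And>x. x \<in> ?U \<Longrightarrow> s x \<noteq> 0 \<and> r x = p x / s x"
    unfolding rational_fun_def by blast
  have "absval (para_Eisenstein \<iota> k x - r x) < e" if x: "x \<in> ?U" for x
  proof -
    let ?f = "\<lambda>S. \<Prod>a\<in>S. - 1 / lattice_elt \<iota> a x"
    have "(?f has_sum \<alpha> k x) (vector_sets ?m)"
      unfolding \<alpha>_def by (rule exp_coefficient_has_sum[OF c U(2)[OF x]])
    moreover have "(?f has_sum r x) X"
      unfolding r_def by (rule has_sum_finite[OF X(1)])
    ultimately have "(?f has_sum (\<alpha> k x - r x)) (vector_sets ?m - X)"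
      using X(2) by (rule has_sum_Diff)
    then have "absval (\<alpha> k x - r x) \<le> e / 2"
    proof (rule absval_has_sum_le)
      fix S :: "('n option \<Rightarrow> 'f poly) set"
      assume S: "S \<in> vector_sets ?m - X"
      then have "absval (?f S) \<le> (\<Prod>a\<in>S. weight c a)"
        unfolding absval_prod
        by (intro prod_mono conjI) (auto simp: vector_sets_def Fpow_def
            intro!: absval_inverse_lattice_elt_le[OF c U(2)[OF x], simplified])
      also have "\<dots> < e / 2"
        using S unfolding X_def by (simp only: Diff_iff mem_Collect_eq not_le de_Morgan_conj) blast
      finally show "absval (?f S) \<le> e / 2"
        by (rule less_imp_le)
    qed (use e in simp)
    then show ?thesis
      using e by (simp add: para_Eisenstein_eq[OF U(1)[OF x]])
  qed
  then show "\<exists>p s. polynomial_fun p \<and> polynomial_fun s \<and>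
      (\<forall>x\<in>?U. s x \<noteq> 0 \<and> absval (para_Eisenstein \<iota> k x - p x / s x) < e)"
    using ps by (intro exI[of _ p] exI[of _ s]) auto
qed

lemma smooth_vanishing_locus_para_Eisenstein:
  "smooth_analytic_subspace \<iota> (vanishing_locus \<iota> (para_Eisenstein \<iota> k :: 'c ^ 'n::finite \<Rightarrow> 'c))"
proof -
  let ?f = "para_Eisenstein \<iota> k :: 'c ^ 'n \<Rightarrow> 'c"
  let ?Z = "vanishing_locus \<iota> ?f"
  have "points ?Z = {\<omega> \<in> Omega \<iota>. \<forall>h \<in> stalk_ideal ?Z \<omega>. h \<omega> = 0}"
  proof -
    have "?f \<omega> = 0 \<longleftrightarrow> (\<forall>h \<in> germ_ideal \<omega> {?f}. h \<omega> = 0)" if "\<omega> \<in> Omega \<iota>" for \<omega>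
      using generator_in_germ_ideal[OF para_Eisenstein_analytic_germ[OF that, of k]] germ_ideal_eq_0[of _ \<omega> "{?f}"]
      by blast
    then show ?thesis
      by (auto simp: vanishing_locus_def)
  qed
  moreover have "\<exists>G. finite G \<and> (\<forall>h\<in>G. affinoid_fun (Omega_aff \<iota> n) h) \<and>
        (\<forall>\<omega> \<in> Omega_aff \<iota> n. (\<forall>h\<in>G. analytic_germ \<omega> h) \<and> stalk_ideal ?Z \<omega> = germ_ideal \<omega> G)" for n
    by (intro exI[of _ "{?f}"])
       (auto simp: vanishing_locus_def Omega_aff_def para_Eisenstein_affinoid_fun[unfolded Omega_aff_def] para_Eisenstein_analytic_germ)
  moreover have "smooth_at ?Z \<omega>" if \<omega>: "\<omega> \<in> points ?Z" for \<omega>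
  proof -
    have \<Omega>: "\<omega> \<in> Omega \<iota>" and "?f \<omega> = 0"
      using \<omega> by (auto simp: vanishing_locus_def)
    then have "\<alpha> k \<omega> = 0"
      by (simp add: para_Eisenstein_eq)
    then obtain i where i: "partial_deriv i ?f \<omega> \<noteq> 0"
      using \<alpha>_differential_nonzero[OF \<Omega>] partial_deriv_para_Eisenstein[OF \<Omega>] by metis
    show ?thesis
      unfolding smooth_at_def
    \<comment> \<open>With a single generator, independence of differentials means that one partial
      derivative is nonzero.\<close>
    proof (intro exI[of _ 1] exI[of _ "\<lambda>_. ?f"] conjI allI impI)
      show "analytic_germ \<omega> ?f"
        by (rule para_Eisenstein_analytic_germ[OF \<Omega>])
      show "stalk_ideal ?Z \<omega> = germ_ideal \<omega> ((\<lambda>_. ?f) ` {..<1::nat})"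
        by (simp add: vanishing_locus_def lessThan_Suc)
      fix b :: "nat \<Rightarrow> 'c" and j :: nat
      assume "\<forall>i. (\<Sum>j<1. b j * partial_deriv i ?f \<omega>) = 0" "j < 1"
      then show "b j = 0"
        using i by (cases "b 0 = 0") auto
    qed
  qed
  ultimately show ?thesis
    unfolding smooth_analytic_subspace_def analytic_subspace_def by blast
qed

end

theorem theorem2p2:
  fixes \<iota> :: "'f::{field,finite} fls \<Rightarrow> 'c::complete_valued_field"
    and k :: nat
  assumes "completed_algebraic_closure \<iota>"
  shows "smooth_analytic_subspace \<iota>
    (vanishing_locus \<iota> (para_Eisenstein \<iota> k :: 'c ^ 'n::finite \<Rightarrow> 'c))"
  by (rule completed_algebraic_closure.smooth_vanishing_locus_para_Eisenstein[OF assms])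

end
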